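(* Let $K,L\subseteq\mathbb R^n$ be convex bodies. Then, for every $\left(\frac{3}{4}\right)^n\leq\theta\leq 1$, $$ |K+_\theta L|^{\frac{1}{n}}\geq \frac{1}{2}{{2n}\choose{n}}^{\frac{1}{n}}\left(1-\theta^{\frac{1}{n}}\right)\left(|K|^{\frac{1}{n}}+|L|^{\frac{1}{n}}\right), $$ and, for every $0\leq\theta\leq \left(\frac{3}{4}\right)^n$, $$ |K+_\theta L|^{\frac{1}{n}}\geq \left(1-\left(\frac{4}{3}-\frac{1}{6}{{2n}\choose{n}}^{\frac{1}{n}}\right)\theta^{\frac{1}{n}}\right)\left(|K|^{\frac{1}{n}}+|L|^{\frac{1}{n}}\right). $$ Moreover, given any $\left(\frac{3}{4}\right)^n\leq\theta<1$, there is equality in the first inequality if and only if $K=-L$ is an $n$-dimensional simplex.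
   Context: A convex body is a compact convex subset of $\mathbb R^n$ with non-empty interior; $|\cdot|$ denotes $n$-dimensional Lebesgue measure (volume). $K+L=\{x+y: x\in K, y\in L\}$ is the Minkowski sum. Let $M(K,L)=\max_{z\in\mathbb R^n}|K\cap(z-L)|$. For $0\leq\theta\leq1$, the $\theta$-convolution body of $K$ and $L$ is $$K+_\theta L=\{z\in K+L:\ |K\cap(z-L)|\geq\theta M(K,L)\}.$$
   Formalization: In the equality case, "K = -L" is proved up to translation (K = v - L for some v, with K an n-simplex), since the literal condition K = -L is not necessary: translating L keeps equality. *)

theory Defs
  imports "HOL-Analysis.Analysis"
begin

definition convex_body :: "'a::euclidean_space set \<Rightarrow> bool" where
  "convex_body K \<longleftrightarrow> compact K \<and> convex K \<and> interior K \<noteq> {}"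

abbreviation vol :: "'a::euclidean_space set \<Rightarrow> real" where
  "vol S \<equiv> measure lebesgue S"

definition minkowski_sum :: "'a::euclidean_space set \<Rightarrow> 'a set \<Rightarrow> 'a set" where
  "minkowski_sum K L = {x + y | x y. x \<in> K \<and> y \<in> L}"

definition reflect_translate :: "'a::euclidean_space \<Rightarrow> 'a set \<Rightarrow> 'a set" where
  "reflect_translate z L = (\<lambda>y. z - y) ` L"

(* M(K,L) = max_z |K \<inter> (z - L)| (the maximum is attained for convex bodies) *)
definition Mvol :: "'a::euclidean_space set \<Rightarrow> 'a set \<Rightarrow> real" where
  "Mvol K L = (SUP z. vol (K \<inter> reflect_translate z L))"

definition conv_body :: "'a::euclidean_space set \<Rightarrow> real \<Rightarrow> 'a set \<Rightarrow> 'a set" where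
  "conv_body K \<theta> L = {z \<in> minkowski_sum K L. vol (K \<inter> reflect_translate z L) \<ge> \<theta> * Mvol K L}"

end

theory Submission
  imports Defs
begin

text \<open>
  Let \<open>f z = |K \<inter> (z - L)|\<close>, with maximum \<open>M\<close> at \<open>z\<^sub>0\<close>, and \<open>g x = (f (z\<^sub>0 + x) / M)\<^bsup>1/n\<^esup>\<close>. By the
  Brunn-Minkowski inequality \<open>g\<close> is concave on its support. On each ray replace \<open>g\<close> by \<open>min 1\<close> of a
  supporting line at level \<open>t = \<theta>\<^bsup>1/n\<^esup>\<close>: the integral of \<open>n r\<^bsup>n-1\<^esup> g\<^bsup>n\<^esup>\<close> along the ray becomes a convex
  function of the inverse slope, so it is largest at an end point, and for \<open>t \<ge> 3/4\<close> (as
  \<open>2n choose n < 4\<^bsup>n\<^esup>\<close>) this is the profile linear from the origin. Integrating over all rays gives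
  \<open>|K||L| / M = \<integral> g\<^bsup>n\<^esup> \<le> |{g \<ge> t}| / ((2n choose n) (1 - t)\<^bsup>n\<^esup>)\<close>, and \<open>M \<le> min |K| |L|\<close> yields the first
  inequality. The second one interpolates between \<open>t = 0\<close> and \<open>t = 3/4\<close> by Brunn-Minkowski.

  Equality forces \<open>|K| = |L| = M\<close>, hence \<open>K = z\<^sub>0 - L\<close>, and \<open>g\<close> linear on every ray. Then
  \<open>K \<inter> (x + K)\<close> has the volume of the homothet of \<open>K\<close> it contains, so it is that homothet, which makes
  the extreme points of \<open>K\<close> affinely independent.
\<close>

subsection \<open>Layer cake formula and the Brunn-Minkowski inequality\<close>

text \<open>The inverse slope is normalised to a parameter \<open>u\<close> in (0, 1], where
  \<open>u = 1\<close> is the chord of the profile between radius 0 and radius \<open>R\<close>. The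
  ray integral is then at most \<open>R^n ((1 - u) + u C)\<close> with
  \<open>C = 1 / ((2n choose n) (1 - t)^n)\<close>; the limit \<open>u = 0\<close> is the profile
  that stays at 1 up to \<open>R\<close> and drops to 0 there. The chord wins when
  \<open>C > 1\<close>, and 3/4 is the least threshold for which this holds in every dimension,
  because \<open>(2n choose n)^(1/n)\<close> tends to 4.

  Two obstacles shape the argument. The profile is concave only where it is positive, so positivity
  hypotheses accompany every use of concavity. Equality of integrals controls only almost every ray;
  linearity on a ray survives limits of directions, which extends it to all rays.

  Brunn-Minkowski enters three times: for the concavity of \<open>g\<close>, for the interpolation
  between levels, and as \<open>|K + L|^(1/n) \<ge> |K|^(1/n) + |L|^(1/n)\<close>, the case
  \<open>t = 0\<close> of the second inequality.\<close>

lemma brunn_minkowski_real_compact: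
  fixes A B H :: "real set"
  assumes A: "compact A" "A \<noteq> {}" and B: "compact B" "B \<noteq> {}" and H: "H \<in> lmeasurable"
    and l: "0 < l" "l < 1"
    and sub: "\<And>x y. x \<in> A \<Longrightarrow> y \<in> B \<Longrightarrow> (1 - l) * x + l * y \<in> H"
  shows "(1 - l) * measure lebesgue A + l * measure lebesgue B \<le> measure lebesgue H"
proof -
  obtain a where a: "a \<in> A" "\<And>x. x \<in> A \<Longrightarrow> x \<le> a"
    using compact_attains_sup[OF A] by blast
  obtain b where b: "b \<in> B" "\<And>x. x \<in> B \<Longrightarrow> b \<le> x"
    using compact_attains_inf[OF B] by blast
  \<comment> \<open>The scaled copies are shifted so that the largest point of the first and the
    smallest point of the second are both \<open>(1 - l) * a + l * b\<close>. They overlap in that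
    point only and both lie in \<open>H\<close>, so their lengths add up inside
    \<open>H\<close>.\<close>
  define A' where "A' = (\<lambda>x. (1 - l) *\<^sub>R x + l * b) ` A"
  define B' where "B' = (\<lambda>x. l *\<^sub>R x + (1 - l) * a) ` B"
  have cA: "compact A'" and cB: "compact B'"
    unfolding A'_def B'_def
    by (intro compact_continuous_image continuous_intros A B)+
  have mA: "measure lebesgue A' = (1 - l) * measure lebesgue A"
    unfolding A'_def using l measure_lebesgue_affine[of "1 - l" "l * b" A] by simp
  have mB: "measure lebesgue B' = l * measure lebesgue B"
    unfolding B'_def using l measure_lebesgue_affine[of l "(1 - l) * a" B] by simp
  have "A' \<inter> B' \<subseteq> {(1 - l) * a + l * b}"
  proof -
    { fix x y assume "x \<in> A" "y \<in> B" "(1 - l) * x + l * b = l * y + (1 - l) * a"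
      moreover have "(1 - l) * x \<le> (1 - l) * a" "l * b \<le> l * y"
        using a(2)[OF \<open>x \<in> A\<close>] b(2)[OF \<open>y \<in> B\<close>] l by (auto intro: mult_left_mono)
      ultimately have "(1 - l) * x + l * b = (1 - l) * a + l * b" by linarith }
    then show ?thesis unfolding A'_def B'_def by auto
  qed
  then have "negligible (A' \<inter> B')"
    using negligible_sing negligible_subset by blast
  then have "measure lebesgue (A' \<union> B') = measure lebesgue A' + measure lebesgue B'"
    using measure_Un3[of A' lebesgue B'] cA cB
    by (simp add: lmeasurable_compact negligible_imp_measure0)
  moreover have "A' \<union> B' \<subseteq> H"
    unfolding A'_def B'_def using sub[OF _ b(1)] sub[OF a(1)] by (auto simp: add.commute)
  then have "measure lebesgue (A' \<union> B') \<le> measure lebesgue H"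
    using cA cB H by (intro measure_mono_fmeasurable) (auto intro: lmeasurable_compact fmeasurableD)
  ultimately show ?thesis using mA mB by simp
qed

lemma lmeasurable_inner_compact:
  fixes S :: "'a::euclidean_space set"
  assumes "S \<in> lmeasurable" "bounded S" "e > 0"
  obtains T where "compact T" "T \<subseteq> S" "measure lebesgue S - e < measure lebesgue T"
proof -
  have "S \<in> sets lebesgue" using assms by auto
  from sets_lebesgue_inner_closed[OF this \<open>e > 0\<close>]
  obtain T where T: "closed T" "T \<subseteq> S" "S - T \<in> lmeasurable" "emeasure lebesgue (S - T) < ennreal e"
    by blast
  have c: "compact T" using T(1,2) assms(2) bounded_subset compact_eq_bounded_closed by blast
  have "measure lebesgue (S - T) < e"
    using T(3,4) by (simp add: emeasure_eq_measure2 assms(3) ennreal_less_iff)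
  moreover have "measure lebesgue (S - T) = measure lebesgue S - measure lebesgue T"
    using assms T c by (intro measurable_measure_Diff) (auto simp: lmeasurable_compact)
  ultimately show ?thesis using that[OF c T(2)] by linarith
qed

text \<open>Superlevel sets of measurable functions need not be compact, so inner regularity takes
  over. \<open>H\<close> is only required to contain the combination, since a sum of measurable sets
  may fail to be measurable.\<close>

lemma brunn_minkowski_real:
  fixes A B H :: "real set"
  assumes A: "A \<in> lmeasurable" "bounded A" "A \<noteq> {}" and B: "B \<in> lmeasurable" "bounded B" "B \<noteq> {}"
    and H: "H \<in> lmeasurable" and l: "0 < l" "l < 1"
    and sub: "\<And>x y. x \<in> A \<Longrightarrow> y \<in> B \<Longrightarrow> (1 - l) * x + l * y \<in> H"
  shows "(1 - l) * measure lebesgue A + l * measure lebesgue B \<le> measure lebesgue H"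
proof (rule field_le_epsilon)
  fix e :: real assume e: "e > 0"
  obtain a b where ab: "a \<in> A" "b \<in> B" using A B by blast
  obtain T where T: "compact T" "T \<subseteq> A" "measure lebesgue A - e < measure lebesgue T"
    using lmeasurable_inner_compact[OF A(1,2) e] by blast
  obtain U where U: "compact U" "U \<subseteq> B" "measure lebesgue B - e < measure lebesgue U"
    using lmeasurable_inner_compact[OF B(1,2) e] by blast
  \<comment> \<open>The compact approximations may be empty when \<open>e\<close> exceeds the
    measure of the set; one added point of the original set restores nonemptiness.\<close>
  have "(1 - l) * measure lebesgue (insert a T) + l * measure lebesgue (insert b U) \<le> measure lebesgue H"
    by (rule brunn_minkowski_real_compact) (use T U ab H l sub in auto)
  moreover have "measure lebesgue T \<le> measure lebesgue (insert a T)"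
    using T by (intro measure_mono_fmeasurable) (auto intro: lmeasurable_compact fmeasurableD)
  moreover have "measure lebesgue U \<le> measure lebesgue (insert b U)"
    using U by (intro measure_mono_fmeasurable) (auto intro: lmeasurable_compact fmeasurableD)
  ultimately have "(1 - l) * (measure lebesgue A - e) + l * (measure lebesgue B - e) \<le> measure lebesgue H"
    using T(3) U(3) l by (smt (verit) mult_left_mono)
  then show "(1 - l) * measure lebesgue A + l * measure lebesgue B \<le> measure lebesgue H + e"
    by (simp add: algebra_simps)
qed

lemma weighted_am_gm:
  fixes x y l :: real
  assumes "0 \<le> x" "0 \<le> y" "0 < l" "l < 1"
  shows "x powr (1 - l) * y powr l \<le> (1 - l) * x + l * y"
proof (cases "x = 0 \<or> y = 0")
  case False
  then show ?thesis using Youngs_inequality_0[of "1 - l" l x y] assms by simp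
qed (use assms in auto)

lemma nn_integral_power_Icc:
  assumes "0 \<le> b" "1 \<le> n"
  shows "(\<integral>\<^sup>+s. ennreal (real n * s ^ (n - 1)) * indicator {0..b} s \<partial>lborel) = ennreal (b ^ n)"
proof -
  have "(\<integral>\<^sup>+s. ennreal (real n * s ^ (n - 1)) * indicator {0..b} s \<partial>lborel) = ennreal (b ^ n) - ennreal (0 ^ n)"
    using assms by (subst nn_integral_FTC_Icc[where F="\<lambda>s. s ^ n"])
      (auto intro!: derivative_eq_intros simp: zero_power)
  then show ?thesis using assms by (simp add: zero_power)
qed

text \<open>The power \<open>f x ^ n\<close> is the integral of \<open>n * s ^ (n - 1)\<close> over
  \<open>0 \<le> s \<le> f x\<close>, and the two integrals are exchanged. The measure is general
  because the formula serves both Lebesgue measure and the weight \<open>n r^(n-1)\<close> on a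
  ray.\<close>

lemma layer_cake_power:
  assumes "sigma_finite_measure M" and f[measurable]: "f \<in> borel_measurable M"
    and f01: "\<And>x. x \<in> space M \<Longrightarrow> 0 \<le> f x \<and> f x \<le> (1::real)" and n: "1 \<le> n"
  shows "(\<integral>\<^sup>+x. ennreal (f x ^ n) \<partial>M) =
    (\<integral>\<^sup>+s. ennreal (real n * s ^ (n - 1)) * indicator {0..1} s * emeasure M {x \<in> space M. s \<le> f x} \<partial>lborel)"
proof -
  interpret sigma_finite_measure M by fact
  interpret pair_sigma_finite M lborel ..
  have "(\<integral>\<^sup>+x. ennreal (f x ^ n) \<partial>M) =
     (\<integral>\<^sup>+x. (\<integral>\<^sup>+s. ennreal (real n * s ^ (n - 1)) * indicator {0..1} s * indicator {x \<in> space M. s \<le> f x} x \<partial>lborel) \<partial>M)"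
  proof (rule nn_integral_cong)
    fix x assume x: "x \<in> space M"
    have "ennreal (f x ^ n) = (\<integral>\<^sup>+s. ennreal (real n * s ^ (n - 1)) * indicator {0..f x} s \<partial>lborel)"
      using nn_integral_power_Icc[OF _ n] f01[OF x] by simp
    also have "\<dots> = (\<integral>\<^sup>+s. ennreal (real n * s ^ (n - 1)) * indicator {0..1} s * indicator {x \<in> space M. s \<le> f x} x \<partial>lborel)"
      by (rule nn_integral_cong) (use f01[OF x] x in \<open>auto split: split_indicator\<close>)
    finally show "ennreal (f x ^ n) = \<dots>" .
  qed
  also have "\<dots> = (\<integral>\<^sup>+s. (\<integral>\<^sup>+x. ennreal (real n * s ^ (n - 1)) * indicator {0..1} s * indicator {x \<in> space M. s \<le> f x} x \<partial>M) \<partial>lborel)"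
  proof (rule Fubini'[symmetric])
    have *: "indicator {x \<in> space M. s \<le> f x} x = (if x \<in> space M \<and> s \<le> f x then 1 else (0::ennreal))" for x s
      by auto
    show "(\<lambda>(x, s). ennreal (real n * s ^ (n - 1)) * indicator {0..1} s * indicator {x \<in> space M. s \<le> f x} x)
      \<in> borel_measurable (M \<Otimes>\<^sub>M lborel)"
      unfolding * by measurable
  qed
  also have "\<dots> = (\<integral>\<^sup>+s. ennreal (real n * s ^ (n - 1)) * indicator {0..1} s * emeasure M {x \<in> space M. s \<le> f x} \<partial>lborel)"
    by (rule nn_integral_cong) (simp add: nn_integral_cmult)
  finally show ?thesis .
qed

lemma emeasure_lborel_eq_measure_lebesgue:
  assumes "S \<in> sets borel" "S \<in> lmeasurable"
  shows "emeasure lborel S = ennreal (measure lebesgue S)"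
proof -
  have "emeasure lebesgue S = ennreal (measure lebesgue S)" using assms by (simp only: emeasure_eq_measure2)
  moreover have "emeasure lebesgue S = emeasure lborel S" using assms by simp
  ultimately show ?thesis by simp
qed

text \<open>Once both functions are scaled to supremum 1, their superlevel sets at every level in
  (0, 1) are nonempty, so the one-dimensional Brunn-Minkowski inequality compares them level by
  level. Integration over the levels gives an additive inequality, which implies the multiplicative
  one by the arithmetic-geometric mean inequality.\<close>

lemma prekopa_leindler_real:
  fixes f g h :: "real \<Rightarrow> real"
  assumes meas[measurable]: "f \<in> borel_measurable borel" "g \<in> borel_measurable borel" "h \<in> borel_measurable borel"
    and nonneg: "\<And>x. 0 \<le> f x" "\<And>x. 0 \<le> g x" "\<And>x. 0 \<le> h x"
    and bdd: "\<And>x. f x \<le> c" "\<And>x. g x \<le> c"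
    and supp: "\<And>x. r < \<bar>x\<bar> \<Longrightarrow> f x = 0" "\<And>x. r < \<bar>x\<bar> \<Longrightarrow> g x = 0" "\<And>x. r < \<bar>x\<bar> \<Longrightarrow> h x = 0"
    and int: "integrable lborel f" "integrable lborel g" "integrable lborel h"
    and l: "0 < l" "l < 1"
    and le: "\<And>x y. f x powr (1 - l) * g y powr l \<le> h ((1 - l) * x + l * y)"
  shows "(\<integral>x. f x \<partial>lborel) powr (1 - l) * (\<integral>x. g x \<partial>lborel) powr l \<le> (\<integral>x. h x \<partial>lborel)"
proof -
  define a where "a = (SUP x. f x)"
  define b where "b = (SUP x. g x)"
  have bda: "bdd_above (range f)" and bdb: "bdd_above (range g)"
    using bdd by (auto intro!: bdd_aboveI2)
  have fa: "f x \<le> a" and gb: "g x \<le> b" for x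
    unfolding a_def b_def using bda bdb by (auto intro: cSUP_upper)
  have a0: "0 \<le> a" and b0: "0 \<le> b" using fa[of 0] gb[of 0] nonneg(1,2)[of 0] by linarith+
  have hint: "0 \<le> (\<integral>x. h x \<partial>lborel)" using nonneg by simp
  show ?thesis
  proof (cases "a = 0 \<or> b = 0")
    case True
    then have "f = (\<lambda>_. 0) \<or> g = (\<lambda>_. 0)"
      using fa gb nonneg by (auto simp: fun_eq_iff antisym)
    then have "(\<integral>x. f x \<partial>lborel) = 0 \<or> (\<integral>x. g x \<partial>lborel) = 0" by auto
    then show ?thesis using hint by auto
  next
    case False
    with a0 b0 have a: "0 < a" and b: "0 < b" by auto
    define k where "k = a powr (1 - l) * b powr l"
    have k: "0 < k" using a b by (simp add: k_def)
    define F where "F x = f x / a" for x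
    define G where "G x = g x / b" for x
    \<comment> \<open>The cap at 1 fits \<open>H\<close> to the levels in [0, 1]. It costs nothing,
      since \<open>H\<close> is only to be bounded from below on these levels.\<close>
    define H where "H x = min 1 (h x / k)" for x
    have [measurable]: "F \<in> borel_measurable borel" "G \<in> borel_measurable borel" "H \<in> borel_measurable borel"
      unfolding F_def G_def H_def by measurable
    have F01: "0 \<le> F x \<and> F x \<le> 1" and G01: "0 \<le> G x \<and> G x \<le> 1" and H01: "0 \<le> H x \<and> H x \<le> 1" for x
      using fa gb a b k nonneg unfolding F_def G_def H_def by auto
    have lev: "(1 - l) * emeasure lborel {x. s \<le> F x} + l * emeasure lborel {x. s \<le> G x} \<le> emeasure lborel {x. s \<le> H x}"
      if s: "0 < s" "s < 1" for s
    proof -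
      have lmb: "{x. s \<le> p x} \<in> lmeasurable \<and> bounded {x. s \<le> p x}"
        if [measurable]: "p \<in> borel_measurable borel" and p: "\<And>x. r < \<bar>x\<bar> \<Longrightarrow> p x = 0" for p :: "real \<Rightarrow> real"
      proof -
        have "{x. s \<le> p x} \<subseteq> {-r..r}"
        proof
          fix x assume "x \<in> {x. s \<le> p x}"
          then have "\<not> r < \<bar>x\<bar>" using p[of x] s by auto
          then show "x \<in> {-r..r}" by auto
        qed
        then have "bounded {x. s \<le> p x}" using bounded_closed_interval bounded_subset by blast
        moreover have "{x. s \<le> p x} \<in> sets lebesgue" by (rule sets_completionI_sets) measurable
        ultimately show ?thesis using bounded_set_imp_lmeasurable by blast
      qed
      have lm: "{x. s \<le> F x} \<in> lmeasurable" "{x. s \<le> G x} \<in> lmeasurable" "{x. s \<le> H x} \<in> lmeasurable"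
        and bs: "bounded {x. s \<le> F x}" "bounded {x. s \<le> G x}"
        using lmb[of F] lmb[of G] lmb[of H] supp by (simp_all add: F_def G_def H_def)
      have "s * a < a" "s * b < b" using s a b by auto
      then have "\<exists>x. s * a < f x" "\<exists>x. s * b < g x"
        unfolding a_def b_def using less_cSUP_iff[OF _ bda] less_cSUP_iff[OF _ bdb] by (auto simp: a_def b_def)
      then have ne: "{x. s \<le> F x} \<noteq> {}" "{x. s \<le> G x} \<noteq> {}"
        using a b by (auto simp: F_def G_def field_simps intro: less_imp_le)
      have "(1 - l) * measure lebesgue {x. s \<le> F x} + l * measure lebesgue {x. s \<le> G x} \<le> measure lebesgue {x. s \<le> H x}"
      proof (rule brunn_minkowski_real[OF lm(1) _ ne(1) lm(2) _ ne(2) lm(3) l])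
        show "bounded {x. s \<le> F x}" "bounded {x. s \<le> G x}"
          by (fact bs)+
        fix x y assume "x \<in> {x. s \<le> F x}" "y \<in> {x. s \<le> G x}"
        then have "s * a \<le> f x" "s * b \<le> g y" using a b by (auto simp: F_def G_def field_simps)
        then have "(s * a) powr (1 - l) * (s * b) powr l \<le> f x powr (1 - l) * g y powr l"
          using s a b l by (intro mult_mono powr_mono2) auto
        also have "\<dots> \<le> h ((1 - l) * x + l * y)" by (rule le)
        also have "(s * a) powr (1 - l) * (s * b) powr l = (s powr (1 - l) * s powr l) * k"
          using s a b by (simp add: powr_mult k_def)
        also have "s powr (1 - l) * s powr l = s" using s by (simp flip: powr_add)
        finally show "(1 - l) * x + l * y \<in> {x. s \<le> H x}"
          using s k by (auto simp: H_def field_simps)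
      qed
      then have "ennreal ((1 - l) * measure lebesgue {x. s \<le> F x} + l * measure lebesgue {x. s \<le> G x})
          \<le> ennreal (measure lebesgue {x. s \<le> H x})" by (rule ennreal_leI)
      moreover have "emeasure lborel {x. s \<le> F x} = ennreal (measure lebesgue {x. s \<le> F x})"
         "emeasure lborel {x. s \<le> G x} = ennreal (measure lebesgue {x. s \<le> G x})"
         "emeasure lborel {x. s \<le> H x} = ennreal (measure lebesgue {x. s \<le> H x})"
        using lm by (simp_all add: emeasure_lborel_eq_measure_lebesgue)
      ultimately show ?thesis using l by (simp add: ennreal_mult ennreal_plus)
    qed
    have LF: "(\<integral>\<^sup>+x. ennreal (F x) \<partial>lborel) = (\<integral>\<^sup>+s. indicator {0..1} s * emeasure lborel {x. s \<le> F x} \<partial>lborel)"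
      using layer_cake_power[of lborel F 1] F01 by (simp add: sigma_finite_lborel)
    have LG: "(\<integral>\<^sup>+x. ennreal (G x) \<partial>lborel) = (\<integral>\<^sup>+s. indicator {0..1} s * emeasure lborel {x. s \<le> G x} \<partial>lborel)"
      using layer_cake_power[of lborel G 1] G01 by (simp add: sigma_finite_lborel)
    have LH: "(\<integral>\<^sup>+x. ennreal (H x) \<partial>lborel) = (\<integral>\<^sup>+s. indicator {0..1} s * emeasure lborel {x. s \<le> H x} \<partial>lborel)"
      using layer_cake_power[of lborel H 1] H01 by (simp add: sigma_finite_lborel)
    have *: "emeasure lborel {x. s \<le> f' x} = emeasure lborel (Pair s -` {(s, x). s \<le> f' x})" for s and f' :: "real \<Rightarrow> real"
      by (rule arg_cong[where f="emeasure lborel"]) auto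
    have [measurable]: "(\<lambda>s. emeasure lborel {x. s \<le> f' x}) \<in> borel_measurable lborel"
      if [measurable]: "f' \<in> borel_measurable borel" for f' :: "real \<Rightarrow> real"
    proof -
      have "{p \<in> space (lborel \<Otimes>\<^sub>M lborel). fst p \<le> f' (snd p)} \<in> sets (lborel \<Otimes>\<^sub>M lborel)" by measurable
      also have "{p \<in> space (lborel \<Otimes>\<^sub>M lborel). fst p \<le> f' (snd p)} = {(s, x). s \<le> f' x}"
        by (auto simp: space_pair_measure)
      finally show ?thesis unfolding * by (rule lborel.measurable_emeasure_Pair)
    qed
    have "(1 - l) * (\<integral>\<^sup>+x. ennreal (F x) \<partial>lborel) + l * (\<integral>\<^sup>+x. ennreal (G x) \<partial>lborel)
      = (\<integral>\<^sup>+s. (1 - l) * (indicator {0..1} s * emeasure lborel {x. s \<le> F x}) + l * (indicator {0..1} s * emeasure lborel {x. s \<le> G x}) \<partial>lborel)"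
      unfolding LF LG by (subst nn_integral_add) (simp_all add: nn_integral_cmult)
    \<comment> \<open>The levels 0 and 1 are discarded as a null set: at 0 the superlevel sets are
      the whole line, and at 1 they may be empty.\<close>
    also have "\<dots> \<le> (\<integral>\<^sup>+s. indicator {0..1} s * emeasure lborel {x. s \<le> H x} \<partial>lborel)"
    proof (rule nn_integral_mono_AE)
      show "AE s in lborel. (1 - l) * (indicator {0..1} s * emeasure lborel {x. s \<le> F x}) + l * (indicator {0..1} s * emeasure lborel {x. s \<le> G x})
        \<le> indicator {0..1} s * emeasure lborel {x. s \<le> H x}"
        using AE_lborel_singleton[of "0::real"] AE_lborel_singleton[of "1::real"]
      proof eventually_elim
        case (elim s)
        then show ?case using lev[of s] by (auto split: split_indicator)
      qed
    qed
    also have "\<dots> = (\<integral>\<^sup>+x. ennreal (H x) \<partial>lborel)" by (rule LH[symmetric])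
    also have "\<dots> \<le> (\<integral>\<^sup>+x. ennreal (h x / k) \<partial>lborel)"
      by (intro nn_integral_mono ennreal_leI) (simp add: H_def)
    finally have main: "ennreal (1 - l) * (\<integral>\<^sup>+x. ennreal (F x) \<partial>lborel) + ennreal l * (\<integral>\<^sup>+x. ennreal (G x) \<partial>lborel) \<le> (\<integral>\<^sup>+x. ennreal (h x / k) \<partial>lborel)" .
    have iF: "(\<integral>\<^sup>+x. ennreal (F x) \<partial>lborel) = ennreal ((\<integral>x. f x \<partial>lborel) / a)"
      using int F01 by (subst nn_integral_eq_integral) (auto simp: F_def[abs_def])
    have iG: "(\<integral>\<^sup>+x. ennreal (G x) \<partial>lborel) = ennreal ((\<integral>x. g x \<partial>lborel) / b)"
      using int G01 by (subst nn_integral_eq_integral) (auto simp: G_def[abs_def])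
    have ih: "(\<integral>\<^sup>+x. ennreal (h x / k) \<partial>lborel) = ennreal ((\<integral>x. h x \<partial>lborel) / k)"
      using int nonneg k by (subst nn_integral_eq_integral) auto
    let ?f = "\<integral>x. f x \<partial>lborel" and ?g = "\<integral>x. g x \<partial>lborel" and ?h = "\<integral>x. h x \<partial>lborel"
    have fg: "0 \<le> ?f" "0 \<le> ?g" using nonneg by auto
    have "ennreal ((1 - l) * (?f / a) + l * (?g / b)) \<le> ennreal (?h / k)"
      using main fg a b l unfolding iF iG ih
      by (simp add: ennreal_mult ennreal_plus del: times_divide_eq_right)
    then have "(1 - l) * (?f / a) + l * (?g / b) \<le> ?h / k"
      using hint k by simp
    moreover have "(?f / a) powr (1 - l) * (?g / b) powr l \<le> (1 - l) * (?f / a) + l * (?g / b)"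
      using fg a b l by (intro weighted_am_gm) auto
    ultimately have "(?f / a) powr (1 - l) * (?g / b) powr l \<le> ?h / k" by linarith
    moreover have "(?f / a) powr (1 - l) * (?g / b) powr l = ?f powr (1 - l) * ?g powr l / k"
      using fg a b by (simp add: powr_divide k_def)
    ultimately show ?thesis using k by (simp add: field_simps)
  qed
qed


text \<open>Bounded functions supported in a cube: fixing one coordinate stays in the class with the
  same \<open>r\<close>, and all integrals are finite. The bounds range over all functions
  \<open>x\<close>, extensional or not, so that updated points \<open>x(i := y)\<close> need no side
  condition.\<close>

definition box_fun :: "'i set \<Rightarrow> real \<Rightarrow> (('i \<Rightarrow> real) \<Rightarrow> real) \<Rightarrow> bool" where
  "box_fun I r f \<longleftrightarrow> f \<in> borel_measurable (Pi\<^sub>M I (\<lambda>_. lborel)) \<and> (\<forall>x. 0 \<le> f x \<and> f x \<le> r) \<and>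
    (\<forall>x i. i \<in> I \<longrightarrow> r < \<bar>x i\<bar> \<longrightarrow> f x = 0)"

interpretation lborel_product: product_sigma_finite "\<lambda>_. lborel :: real measure" ..

lemma box_fun_integrable:
  assumes "finite I" "box_fun I r f"
  shows "integrable (Pi\<^sub>M I (\<lambda>_. lborel)) f"
    and "(\<integral>x. f x \<partial>Pi\<^sub>M I (\<lambda>_. lborel)) \<le> r * (2 * r) ^ card I"
proof -
  let ?M = "Pi\<^sub>M I (\<lambda>_. lborel :: real measure)"
  have f[measurable]: "f \<in> borel_measurable ?M" and f0: "0 \<le> f x" "f x \<le> r" and supp: "i \<in> I \<Longrightarrow> r < \<bar>x i\<bar> \<Longrightarrow> f x = 0" for x i
    using assms by (auto simp: box_fun_def)
  have r: "0 \<le> r" using f0[of undefined] by linarith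
  let ?B = "Pi\<^sub>E I (\<lambda>_. {-r..r})"
  have B: "?B \<in> sets ?M" using assms(1) by (intro sets_PiM_I_finite) auto
  have em: "emeasure ?M ?B = ennreal ((2 * r) ^ card I)"
    using assms(1) r by (subst lborel_product.emeasure_PiM) (auto simp: ennreal_power)
  have out: "f x = 0" if "x \<in> space ?M" "x \<notin> ?B" for x
  proof -
    have "\<exists>i\<in>I. \<not> (-r \<le> x i \<and> x i \<le> r)" using that by (auto simp: space_PiM PiE_iff)
    then show ?thesis using supp by (metis abs_le_iff linorder_not_less minus_le_iff)
  qed
  show int: "integrable ?M f"
    by (rule integrableI_bounded_set[OF B, where B=r]) (use em f0 out in auto)
  have "(\<integral>x. f x \<partial>?M) \<le> (\<integral>x. r * indicator ?B x \<partial>?M)"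
  proof (rule integral_mono[OF int])
    show "integrable ?M (\<lambda>x. r * indicator ?B x)" using B em by (intro integrable_mult_right integrable_real_indicator) auto
    show "f x \<le> r * indicator ?B x" if "x \<in> space ?M" for x
      using out[OF that] f0[of x] by (auto split: split_indicator)
  qed
  also have "\<dots> = r * (2 * r) ^ card I" using B em r by (simp add: measure_def)
  finally show "(\<integral>x. f x \<partial>?M) \<le> r * (2 * r) ^ card I" .
qed

text \<open>Fubini's theorem for one coordinate, together with every hypothesis that the
  one-dimensional Prekopa-Leindler inequality demands of the partial integral
  \<open>F\<close>.\<close>

lemma box_fun_integral_slice:
  assumes I: "finite I" "i \<notin> I" and f: "box_fun (insert i I) r f"
  defines "F \<equiv> \<lambda>y. \<integral>x. f (x(i := y)) \<partial>Pi\<^sub>M I (\<lambda>_. lborel)"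
  shows "box_fun I r (\<lambda>x. f (x(i := y)))"
    and "F \<in> borel_measurable borel" and "0 \<le> F y" and "F y \<le> r * (2 * r) ^ card I"
    and "r < \<bar>y\<bar> \<Longrightarrow> F y = 0" and "integrable lborel F"
    and "(\<integral>x. f x \<partial>Pi\<^sub>M (insert i I) (\<lambda>_. lborel)) = (\<integral>y. F y \<partial>lborel)"
proof -
  let ?M = "\<lambda>I. Pi\<^sub>M I (\<lambda>_. lborel :: real measure)"
  have fm[measurable]: "f \<in> borel_measurable (?M (insert i I))" and f0: "0 \<le> f x" "f x \<le> r"
    and supp: "j \<in> insert i I \<Longrightarrow> r < \<bar>x j\<bar> \<Longrightarrow> f x = 0" for x j
    using f by (auto simp: box_fun_def)
  have upd[measurable]: "(\<lambda>(y, x). x(i := y)) \<in> measurable (lborel \<Otimes>\<^sub>M ?M I) (?M (insert i I))"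
    using measurable_add_dim[of i I "\<lambda>_. lborel :: real measure"]
    by (auto simp: measurable_split_conv intro: measurable_compose[OF measurable_pair_swap'])
  have fu[measurable]: "(\<lambda>(y, x). f (x(i := y))) \<in> borel_measurable (lborel \<Otimes>\<^sub>M ?M I)"
    using measurable_compose[OF upd fm] by (simp add: case_prod_beta')
  show slice: "box_fun I r (\<lambda>x. f (x(i := y)))" for y
  proof -
    have "(\<lambda>x. f (x(i := y))) \<in> borel_measurable (?M I)"
      using measurable_compose[OF measurable_Pair1'[of y lborel] fu] by simp
    moreover have "f (x(i := y)) = 0" if "j \<in> I" "r < \<bar>x j\<bar>" for x j
      using supp[of j "x(i := y)"] that I by (cases "j = i") auto
    ultimately show ?thesis using f0 by (auto simp: box_fun_def)
  qed
  show Fm[measurable]: "F \<in> borel_measurable borel"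
  proof -
    interpret sigma_finite_measure "?M I" by (rule lborel_product.sigma_finite[OF I(1)])
    show ?thesis unfolding F_def
      using borel_measurable_lebesgue_integral[OF fu] by simp
  qed
  show F0: "0 \<le> F y" for y unfolding F_def using f0 by simp
  show Fb: "F y \<le> r * (2 * r) ^ card I" for y
    unfolding F_def by (rule box_fun_integrable(2)[OF I(1) slice])
  show Fs: "F y = 0" if "r < \<bar>y\<bar>" for y
    unfolding F_def using supp[of i "_(i := y)"] that by simp
  show Fi: "integrable lborel F"
  proof (rule integrableI_bounded_set[of "{-r..r}" _ _ "r * (2 * r) ^ card I"])
    show "AE x in lborel. x \<in> {- r..r} \<longrightarrow> norm (F x) \<le> r * (2 * r) ^ card I" using F0 Fb by simp
    show "AE x in lborel. x \<notin> {- r..r} \<longrightarrow> F x = 0"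
      using Fs by (intro AE_I2) (metis abs_le_iff atLeastAtMost_iff linorder_not_less minus_le_iff)
  qed (use f0[of undefined] in \<open>auto simp: emeasure_lborel_Icc_eq\<close>)
  have "ennreal (\<integral>x. f x \<partial>?M (insert i I)) = (\<integral>\<^sup>+x. f x \<partial>?M (insert i I))"
    using f0 I f by (intro nn_integral_eq_integral[symmetric]) (auto intro: box_fun_integrable(1))
  also have "\<dots> = (\<integral>\<^sup>+ y. (\<integral>\<^sup>+ x. f (x(i := y)) \<partial>?M I) \<partial>lborel)"
    using I by (intro lborel_product.product_nn_integral_insert_rev) auto
  also have "\<dots> = (\<integral>\<^sup>+ y. F y \<partial>lborel)"
    unfolding F_def using f0 box_fun_integrable(1)[OF I(1) slice]
    by (intro nn_integral_cong nn_integral_eq_integral) auto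
  also have "\<dots> = ennreal (\<integral>y. F y \<partial>lborel)"
    using F0 Fi by (intro nn_integral_eq_integral) auto
  finally show "(\<integral>x. f x \<partial>?M (insert i I)) = (\<integral>y. F y \<partial>lborel)"
    using f0 F0 by simp
qed

text \<open>Tensorisation: with one coordinate fixed at \<open>s\<close> and \<open>u\<close>, the
  induction hypothesis compares the integrals of the slices, and this comparison is the pointwise
  hypothesis of the one-dimensional inequality.\<close>

lemma prekopa_leindler_PiM:
  assumes "finite I" and l: "0 < l" "l < 1"
    and "box_fun I r f" "box_fun I r g" "box_fun I r h"
    and "\<And>x y. f x powr (1 - l) * g y powr l \<le> h (\<lambda>i. (1 - l) * x i + l * y i)"
  shows "(\<integral>x. f x \<partial>Pi\<^sub>M I (\<lambda>_. lborel)) powr (1 - l) * (\<integral>x. g x \<partial>Pi\<^sub>M I (\<lambda>_. lborel)) powr l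
    \<le> (\<integral>x. h x \<partial>Pi\<^sub>M I (\<lambda>_. lborel))"
  using assms(1,4-)
proof (induction I arbitrary: f g h rule: finite_induct)
  case empty
  \<comment> \<open>The empty product has a single point, the constant \<open>undefined\<close>, and
    a convex combination of it with itself gives it back.\<close>
  have "(\<lambda>i::'a. (1 - l) * undefined + l * undefined) = (\<lambda>_. undefined)"
    by (auto simp: algebra_simps)
  then show ?case using empty(4)[of "\<lambda>_. undefined" "\<lambda>_. undefined"]
    by (simp add: PiM_empty lebesgue_integral_count_space_finite)
next
  case (insert i I)
  note sf = box_fun_integral_slice[OF insert.hyps(1,2) insert.prems(1)]
  note sg = box_fun_integral_slice[OF insert.hyps(1,2) insert.prems(2)]
  note sh = box_fun_integral_slice[OF insert.hyps(1,2) insert.prems(3)]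
  show ?case unfolding sf(7) sg(7) sh(7)
  proof (rule prekopa_leindler_real[OF sf(2) sg(2) sh(2) sf(3) sg(3) sh(3) sf(4) sg(4) sf(5) sg(5) sh(5) sf(6) sg(6) sh(6) l])
    fix s u :: real
    show "(\<integral>x. f (x(i := s)) \<partial>Pi\<^sub>M I (\<lambda>_. lborel)) powr (1 - l) * (\<integral>x. g (x(i := u)) \<partial>Pi\<^sub>M I (\<lambda>_. lborel)) powr l
      \<le> (\<integral>x. h (x(i := (1 - l) * s + l * u)) \<partial>Pi\<^sub>M I (\<lambda>_. lborel))"
    proof (rule insert.IH[OF sf(1) sg(1) sh(1)])
      fix x y
      have "(\<lambda>j. (1 - l) * (x(i := s)) j + l * (y(i := u)) j) = (\<lambda>j. (1 - l) * x j + l * y j)(i := (1 - l) * s + l * u)"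
        by auto
      then show "f (x(i := s)) powr (1 - l) * g (y(i := u)) powr l \<le> h ((\<lambda>j. (1 - l) * x j + l * y j)(i := (1 - l) * s + l * u))"
        using insert.prems(4)[of "x(i := s)" "y(i := u)"] by metis
    qed
  qed
qed

text \<open>Indicators of the two sets and of their combination satisfy the Prekopa-Leindler
  hypothesis. The exponents do not involve the dimension; \<open>n\<close>-th roots appear only
  after rescaling.\<close>

lemma prekopa_leindler_compact:
  fixes A B :: "'a::euclidean_space set"
  assumes A: "compact A" and B: "compact B" and l: "0 < l" "l < 1"
  shows "measure lebesgue A powr (1 - l) * measure lebesgue B powr l
    \<le> measure lebesgue ((\<lambda>(x, y). (1 - l) *\<^sub>R x + l *\<^sub>R y) ` (A \<times> B))"
proof -
  define C where "C = (\<lambda>(x, y). (1 - l) *\<^sub>R x + l *\<^sub>R y) ` (A \<times> B)"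
  have C: "compact C" unfolding C_def case_prod_beta
    by (intro compact_continuous_image continuous_intros compact_Times A B)
  obtain r where r: "\<And>x. x \<in> A \<union> B \<union> C \<Longrightarrow> norm x \<le> r" "1 \<le> r"
  proof -
    have "bounded (A \<union> B \<union> C)" using A B C by (simp add: compact_imp_bounded)
    then obtain r where "\<forall>x\<in>A \<union> B \<union> C. norm x \<le> r" unfolding bounded_iff by blast
    then show ?thesis using that[of "max 1 r"] by force
  qed
  \<comment> \<open>\<open>P\<close> turns coordinate functions into vectors, and Lebesgue measure
    is the image of the product measure under it.\<close>
  define P where "P x = (\<Sum>b\<in>Basis. x b *\<^sub>R b)" for x :: "'a \<Rightarrow> real"
  let ?M = "Pi\<^sub>M (Basis::'a set) (\<lambda>_. lborel :: real measure)"
  have Pm[measurable]: "P \<in> borel_measurable ?M" unfolding P_def by measurable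
  have Pin: "P x \<bullet> b = x b" if "b \<in> Basis" for x b
    using that by (simp add: P_def inner_sum_left inner_Basis if_distrib sum.delta cong: if_cong)
  have box: "box_fun Basis r (\<lambda>x. indicator S (P x))" if "compact S" "S \<subseteq> A \<union> B \<union> C" for S
  proof -
    have [measurable]: "S \<in> sets borel" using that by (simp add: borel_compact)
    have "P x \<notin> S" if "b \<in> Basis" "r < \<bar>x b\<bar>" for x b
    proof
      assume "P x \<in> S"
      then have "norm (P x) \<le> r" using r(1) \<open>S \<subseteq> A \<union> B \<union> C\<close> by blast
      moreover have "\<bar>x b\<bar> \<le> norm (P x)" using Basis_le_norm[OF that(1), of "P x"] Pin[OF that(1)] by simp
      ultimately show False using that by linarith
    qed
    then show ?thesis using r(2) unfolding box_fun_def
      by (auto split: split_indicator)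
  qed
  have int: "(\<integral>x. indicator S (P x) \<partial>?M) = measure lebesgue S" if "compact S" for S :: "'a set"
  proof -
    have S[measurable]: "S \<in> sets borel" using that by (simp add: borel_compact)
    have "measure lebesgue S = measure lborel S" by (simp add: S)
    also have "\<dots> = (\<integral>x. indicator S x \<partial>lborel)" by simp
    also have "\<dots> = (\<integral>x. indicator S x \<partial>distr ?M borel P)"
      by (subst lborel_eq) (simp add: P_def[abs_def])
    also have "\<dots> = (\<integral>x. indicator S (P x) \<partial>?M)" by (subst integral_distr) simp_all
    finally show ?thesis by simp
  qed
  have "(\<integral>x. indicator A (P x) \<partial>?M) powr (1 - l) * (\<integral>x. indicator B (P x) \<partial>?M) powr l \<le> (\<integral>x. indicator C (P x) \<partial>?M)"
  proof (rule prekopa_leindler_PiM[OF _ l box box box])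
    fix x y
    have "P (\<lambda>i. (1 - l) * x i + l * y i) = (1 - l) *\<^sub>R P x + l *\<^sub>R P y"
      by (simp add: P_def scaleR_add_left sum.distrib scaleR_sum_right)
    then show "indicator A (P x) powr (1 - l) * indicator B (P y) powr l \<le> (indicator C (P (\<lambda>i. (1 - l) * x i + l * y i)) :: real)"
      by (auto simp: C_def split: split_indicator)
  qed (use A B C in auto)
  then show ?thesis unfolding int[OF A] int[OF B] int[OF C] by (simp add: C_def)
qed

section \<open>From the multiplicative to the additive form of the Brunn-Minkowski
  inequality\<close>

lemma measure_lebesgue_scaleR:
  fixes S :: "'a::euclidean_space set"
  shows "measure lebesgue ((\<lambda>x. c *\<^sub>R x) ` S) = \<bar>c\<bar> ^ DIM('a) * measure lebesgue S"
  using measure_lebesgue_affine[of c 0 S] by simp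

lemma powr_inverse_nat_power:
  fixes x :: real
  assumes "0 \<le> x" "0 < n"
  shows "(x powr (1 / real n)) ^ n = x"
  using assms by (cases "x = 0") (simp_all add: powr_powr flip: powr_realpow)

lemma power_powr_inverse_nat:
  fixes x :: real
  assumes "0 \<le> x" "0 < n"
  shows "(x ^ n) powr (1 / real n) = x"
  using assms by (cases "x = 0") (simp_all add: powr_powr flip: powr_realpow)

theorem brunn_minkowski_compact:
  fixes A B :: "'a::euclidean_space set"
  assumes A: "compact A" "A \<noteq> {}" and B: "compact B" "B \<noteq> {}"
  shows "measure lebesgue A powr (1 / real DIM('a)) + measure lebesgue B powr (1 / real DIM('a))
    \<le> measure lebesgue {x + y | x y. x \<in> A \<and> y \<in> B} powr (1 / real DIM('a))"
proof -
  let ?n = "DIM('a)" and ?C = "{x + y | x y. x \<in> A \<and> y \<in> B}"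
  define a where "a = measure lebesgue A powr (1 / real ?n)"
  define b where "b = measure lebesgue B powr (1 / real ?n)"
  have C: "compact ?C" by (rule compact_sums[OF A(1) B(1)])
  have le_sum: "measure lebesgue S powr (1 / real ?n) \<le> measure lebesgue ?C powr (1 / real ?n)"
    if "compact S" "(+) p ` S \<subseteq> ?C" for S p
  proof -
    have "measure lebesgue ((+) p ` S) \<le> measure lebesgue ?C"
      using that C by (intro measure_mono_fmeasurable) (auto intro!: lmeasurable_compact fmeasurableD compact_translation)
    then show ?thesis by (intro powr_mono2) (simp_all add: measure_translation)
  qed
  have an: "a ^ ?n = measure lebesgue A" and bn: "b ^ ?n = measure lebesgue B"
    unfolding a_def b_def by (simp_all add: powr_inverse_nat_power)
  consider "a = 0" | "b = 0" | "a > 0" "b > 0" unfolding a_def b_def by fastforce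
  then show ?thesis
  proof cases
    case 1
    obtain p where "p \<in> A" using A by auto
    then show ?thesis using le_sum[OF B(1), of p] 1 unfolding a_def by auto
  next
    case 2
    obtain p where p: "p \<in> B" using B by auto
    have "(+) p ` A \<subseteq> ?C" using p by (auto, metis add.commute)
    then show ?thesis using le_sum[OF A(1), of p] 2 unfolding b_def by auto
  next
    case 3
    \<comment> \<open>With this weight the combination of the two sets, each rescaled to volume 1,
      is their sum divided by \<open>a + b\<close>; the multiplicative bound then reads
      \<open>1 \<le> |A + B| / (a + b)^n\<close>.\<close>
    define l where "l = b / (a + b)"
    have l: "0 < l" "l < 1" "1 - l = a / (a + b)" using 3 by (auto simp: l_def field_simps)
    define A' where "A' = (\<lambda>x. (1 / a) *\<^sub>R x) ` A"
    define B' where "B' = (\<lambda>x. (1 / b) *\<^sub>R x) ` B"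
    have cA: "compact A'" and cB: "compact B'" using A B by (auto simp: A'_def B'_def intro: compact_scaling)
    have "measure lebesgue A' = 1" "measure lebesgue B' = 1"
      unfolding A'_def B'_def measure_lebesgue_scaleR using 3 by (auto simp: power_divide an[symmetric] bn[symmetric])
    with prekopa_leindler_compact[OF cA cB l(1,2)]
    have "1 \<le> measure lebesgue ((\<lambda>(x, y). (1 - l) *\<^sub>R x + l *\<^sub>R y) ` (A' \<times> B'))" by simp
    also have "(\<lambda>(x, y). (1 - l) *\<^sub>R x + l *\<^sub>R y) ` (A' \<times> B') = (\<lambda>x. (1 / (a + b)) *\<^sub>R x) ` ?C"
    proof -
      have "(1 - l) *\<^sub>R (1 / a) *\<^sub>R x + l *\<^sub>R (1 / b) *\<^sub>R y = (1 / (a + b)) *\<^sub>R (x + y)" for x y :: 'a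
        unfolding l(3) using 3 by (simp add: l_def scaleR_add_right)
      then show ?thesis unfolding A'_def B'_def by (force simp: image_iff)
    qed
    finally have "1 \<le> (1 / (a + b)) ^ ?n * measure lebesgue ?C"
      unfolding measure_lebesgue_scaleR using 3 by simp
    then have "(a + b) ^ ?n \<le> measure lebesgue ?C" using 3 by (simp add: field_simps power_divide)
    then have "((a + b) ^ ?n) powr (1 / real ?n) \<le> measure lebesgue ?C powr (1 / real ?n)"
      using 3 by (intro powr_mono2) auto
    then show ?thesis using 3 by (simp add: power_powr_inverse_nat a_def[symmetric] b_def[symmetric])
  qed
qed

subsection \<open>Concave profiles on a ray\<close>

lemma power_convex_combination_le:
  fixes x y :: real
  assumes "0 \<le> x" "0 \<le> y" "0 \<le> u" "u \<le> 1"
  shows "((1 - u) * x + u * y) ^ n \<le> (1 - u) * x ^ n + u * y ^ n"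
proof -
  have "convex_on {0..} (\<lambda>x::real. x ^ n)"
    using convex_power_odd[of n] convex_on_subset[OF convex_power_even[of n], of "{0..}"] by (cases "even n") auto
  from convex_onD[OF this, of u x y] assms show ?thesis by simp
qed

text \<open>Row \<open>2 * n\<close> of Pascal's triangle sums to \<open>4 ^ n\<close> and has
  further positive entries. Strictness matters at \<open>t = 3/4\<close>, where it still forces
  \<open>u = 1\<close> in the equality case.\<close>

lemma central_binomial_less:
  assumes "1 \<le> n"
  shows "(2 * n) choose n < 4 ^ n"
proof -
  have "(2 * n) choose n < (\<Sum>k\<le>2 * n. (2 * n) choose k)"
  proof -
    have "((2 * n) choose n) + ((2 * n) choose 0) = (\<Sum>k\<in>{n, 0}. (2 * n) choose k)" using assms by simp
    also have "\<dots> \<le> (\<Sum>k\<le>2 * n. (2 * n) choose k)" by (rule sum_mono2) auto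
    finally show ?thesis by simp
  qed
  also have "\<dots> = 4 ^ n" using choose_row_sum[of "2 * n"] by (simp add: power_mult)
  finally show ?thesis .
qed

text \<open>Integration by parts trades a factor \<open>1 - s\<close> for a factor \<open>s\<close>,
  so the induction on \<open>m\<close> keeps \<open>a\<close> arbitrary.\<close>

lemma has_integral_Beta_nat:
  "((\<lambda>s::real. s ^ a * (1 - s) ^ m) has_integral (fact a * fact m / fact (a + m + 1))) {0..1}"
proof (induction m arbitrary: a)
  case 0
  have "((\<lambda>s::real. s ^ a) has_integral (1 ^ Suc a / real (Suc a) - 0 ^ Suc a / real (Suc a))) {0..1}"
  proof (rule fundamental_theorem_of_calculus)
    fix s :: real
    have "((\<lambda>s. s ^ Suc a / real (Suc a)) has_real_derivative (real (Suc a) * s ^ a / real (Suc a))) (at s within {0..1})"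
      using DERIV_cdivide[OF DERIV_pow[of "Suc a" s "{0..1}"], of "real (Suc a)"]
      by (simp del: of_nat_Suc power_Suc)
    then show "((\<lambda>s. s ^ Suc a / real (Suc a)) has_vector_derivative s ^ a) (at s within {0..1})"
      by (simp del: of_nat_Suc power_Suc flip: has_real_derivative_iff_has_vector_derivative)
  qed simp
  moreover have "fact a * fact 0 / fact (a + 0 + 1) = 1 / real (Suc a)" by (simp del: of_nat_Suc)
  ultimately show ?case by simp
next
  case (Suc m)
  have "((\<lambda>s::real. real (Suc a) * s ^ a * (1 - s) ^ Suc m - real (Suc m) * (s ^ Suc a * (1 - s) ^ m)) has_integral
    (1 ^ Suc a * (1 - 1) ^ Suc m - 0 ^ Suc a * (1 - 0) ^ Suc m)) {0..1}"
  proof (rule fundamental_theorem_of_calculus)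
    fix s :: real
    have "((\<lambda>s. s ^ Suc a * (1 - s) ^ Suc m) has_real_derivative
       (real (Suc a) * s ^ a) * (1 - s) ^ Suc m + (real (Suc m) * (1 - s) ^ m * (0 - 1)) * s ^ Suc a) (at s within {0..1})"
      by (intro DERIV_mult) (rule derivative_eq_intros refl | simp del: power_Suc of_nat_Suc)+
    then show "((\<lambda>s. s ^ Suc a * (1 - s) ^ Suc m) has_vector_derivative
       real (Suc a) * s ^ a * (1 - s) ^ Suc m - real (Suc m) * (s ^ Suc a * (1 - s) ^ m)) (at s within {0..1})"
      by (simp del: of_nat_Suc power_Suc add: mult_ac flip: has_real_derivative_iff_has_vector_derivative)
  qed simp
  from has_integral_add[OF this has_integral_mult_right[OF Suc.IH[of "Suc a"], of "real (Suc m)"]]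
  have "((\<lambda>s::real. real (Suc a) * (s ^ a * (1 - s) ^ Suc m)) has_integral
      (real (Suc m) * (fact (Suc a) * fact m / fact (Suc a + m + 1)))) {0..1}"
    by (simp add: mult.assoc)
  from has_integral_mult_right[OF this, of "1 / real (Suc a)"]
  have "((\<lambda>s::real. 1 / real (Suc a) * (real (Suc a) * (s ^ a * (1 - s) ^ Suc m))) has_integral
      (1 / real (Suc a) * (real (Suc m) * (fact (Suc a) * fact m / fact (Suc a + m + 1))))) {0..1}" .
  moreover have "(\<lambda>s::real. 1 / real (Suc a) * (real (Suc a) * (s ^ a * (1 - s) ^ Suc m))) = (\<lambda>s. s ^ a * (1 - s) ^ Suc m)"
    by (simp del: of_nat_Suc)
  moreover have "1 / real (Suc a) * (real (Suc m) * (fact (Suc a) * fact m / fact (Suc a + m + 1))) =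
    fact a * fact (Suc m) / fact (a + Suc m + 1)"
    by (simp del: of_nat_Suc add: fact_Suc[of a] fact_Suc[of m] del: fact_Suc)
  ultimately show ?case by metis
qed

text \<open>Origin of the binomial coefficient: \<open>n\<close> times the Beta integral with
  exponents \<open>n - 1\<close> and \<open>n\<close> is \<open>n! n! / (2n)!\<close>.\<close>

lemma nn_integral_central_binomial:
  assumes "1 \<le> n"
  shows "(\<integral>\<^sup>+s. ennreal (real n * s ^ (n - 1)) * indicator {0..1} s * ennreal ((1 - s) ^ n) \<partial>lborel)
    = ennreal (1 / real ((2 * n) choose n))"
proof -
  have eq: "real n * (fact (n - 1) * fact n / fact (n - 1 + n + 1)) = 1 / real ((2 * n) choose n)"
  proof -
    have "n - 1 + n + 1 = 2 * n" using assms by simp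
    moreover have "real n * fact (n - 1) = fact n" using assms by (simp add: fact_reduce[of n])
    moreover have "real ((2 * n) choose n) = fact (2 * n) / (fact n * fact n)"
      using binomial_fact[of n "2 * n", where 'a=real] by simp
    ultimately show ?thesis by (simp add: mult.assoc[symmetric] mult_2)
  qed
  have "((\<lambda>s::real. real n * (s ^ (n - 1) * (1 - s) ^ n)) has_integral (1 / real ((2 * n) choose n))) {0..1}"
    using has_integral_mult_right[OF has_integral_Beta_nat[of "n - 1" n], of "real n"] unfolding eq .
  then have "((\<lambda>s::real. if s \<in> {0..1} then real n * (s ^ (n - 1) * (1 - s) ^ n) else 0) has_integral (1 / real ((2 * n) choose n))) UNIV"
    by (simp only: has_integral_restrict_UNIV)
  then have "(\<integral>\<^sup>+s. ennreal (if s \<in> {0..1} then real n * (s ^ (n - 1) * (1 - s) ^ n) else 0) \<partial>lborel) = ennreal (1 / real ((2 * n) choose n))"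
    by (intro nn_integral_has_integral_lborel) auto
  moreover have "(\<integral>\<^sup>+s. ennreal (real n * s ^ (n - 1)) * indicator {0..1} s * ennreal ((1 - s) ^ n) \<partial>lborel)
     = (\<integral>\<^sup>+s. ennreal (if s \<in> {0..1} then real n * (s ^ (n - 1) * (1 - s) ^ n) else 0) \<partial>lborel)"
    by (rule nn_integral_cong) (auto split: split_indicator simp: ennreal_mult[symmetric] mult.assoc)
  ultimately show ?thesis by simp
qed

lemma nn_integral_ray_layer_cake:
  fixes p :: "real \<Rightarrow> real"
  assumes [measurable]: "p \<in> borel_measurable borel" and p01: "\<And>r. 0 \<le> p r \<and> p r \<le> 1" and n: "1 \<le> n"
  shows "(\<integral>\<^sup>+r. ennreal (real n * r ^ (n - 1)) * indicator {0<..} r * ennreal (p r ^ n) \<partial>lborel) =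
    (\<integral>\<^sup>+s. ennreal (real n * s ^ (n - 1)) * indicator {0..1} s *
       (\<integral>\<^sup>+r. ennreal (real n * r ^ (n - 1)) * indicator {0<..} r * indicator {r. s \<le> p r} r \<partial>lborel) \<partial>lborel)"
proof -
  let ?M = "density lborel (\<lambda>r::real. ennreal (real n * r ^ (n - 1)) * indicator {0<..} r)"
  have sf: "sigma_finite_measure ?M"
    by (subst sigma_finite_measure.sigma_finite_iff_density_finite[OF sigma_finite_lborel]) (auto split: split_indicator)
  have "(\<integral>\<^sup>+r. ennreal (p r ^ n) \<partial>?M) = (\<integral>\<^sup>+s. ennreal (real n * s ^ (n - 1)) * indicator {0..1} s * emeasure ?M {r \<in> space ?M. s \<le> p r} \<partial>lborel)"
    by (rule layer_cake_power[OF sf]) (use p01 n in auto)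
  then show ?thesis
    by (simp add: nn_integral_density emeasure_density)
qed

lemma nn_integral_power_Ioc:
  assumes "0 \<le> b" "1 \<le> n"
  shows "(\<integral>\<^sup>+s. ennreal (real n * s ^ (n - 1)) * indicator {0<..} s * indicator {..b} s \<partial>lborel) = ennreal (b ^ n)"
proof -
  have "(\<integral>\<^sup>+s. ennreal (real n * s ^ (n - 1)) * indicator {0<..} s * indicator {..b} s \<partial>lborel)
    = (\<integral>\<^sup>+s. ennreal (real n * s ^ (n - 1)) * indicator {0..b} s \<partial>lborel)"
    by (rule nn_integral_cong_AE) (use AE_lborel_singleton[of "0::real"] in eventually_elim, auto split: split_indicator)
  then show ?thesis using nn_integral_power_Icc[OF assms] by simp
qed

lemma nn_integral_ray_linear:
  assumes c: "0 < c" and n: "1 \<le> n"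
  shows "(\<integral>\<^sup>+r. ennreal (real n * r ^ (n - 1)) * indicator {0<..} r * ennreal (min 1 (max 0 (1 - c * r)) ^ n) \<partial>lborel)
    = ennreal ((1 / c) ^ n / real ((2 * n) choose n))"
proof -
  have "(\<integral>\<^sup>+r. ennreal (real n * r ^ (n - 1)) * indicator {0<..} r * ennreal (min 1 (max 0 (1 - c * r)) ^ n) \<partial>lborel)
    = (\<integral>\<^sup>+s. ennreal (real n * s ^ (n - 1)) * indicator {0..1} s *
       (\<integral>\<^sup>+r. ennreal (real n * r ^ (n - 1)) * indicator {0<..} r * indicator {r. s \<le> min 1 (max 0 (1 - c * r))} r \<partial>lborel) \<partial>lborel)"
    using n by (intro nn_integral_ray_layer_cake) auto
  also have "\<dots> = (\<integral>\<^sup>+s. ennreal ((1 / c) ^ n) * (ennreal (real n * s ^ (n - 1)) * indicator {0..1} s * ennreal ((1 - s) ^ n)) \<partial>lborel)"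
  proof (rule nn_integral_cong_AE, use AE_lborel_singleton[of "0::real"] in eventually_elim)
    case (elim s)
    show ?case
    proof (cases "0 \<le> s \<and> s \<le> 1")
      case True
      then have s: "0 < s" "s \<le> 1" using elim by auto
      have "(\<integral>\<^sup>+r. ennreal (real n * r ^ (n - 1)) * indicator {0<..} r * indicator {r. s \<le> min 1 (max 0 (1 - c * r))} r \<partial>lborel)
        = (\<integral>\<^sup>+r. ennreal (real n * r ^ (n - 1)) * indicator {0<..} r * indicator {..(1 - s) / c} r \<partial>lborel)"
        by (rule nn_integral_cong) (use s c in \<open>auto split: split_indicator simp: field_simps\<close>)
      also have "\<dots> = ennreal (((1 - s) / c) ^ n)" using s c n by (intro nn_integral_power_Ioc) auto
      also have "\<dots> = ennreal ((1 / c) ^ n) * ennreal ((1 - s) ^ n)"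
        using s c by (simp add: ennreal_mult[symmetric] power_divide)
      finally show ?thesis by (simp add: mult_ac)
    qed auto
  qed
  also have "\<dots> = ennreal ((1 / c) ^ n) * ennreal (1 / real ((2 * n) choose n))"
    by (subst nn_integral_cmult) (measurable, simp only: nn_integral_central_binomial[OF n])
  also have "\<dots> = ennreal ((1 / c) ^ n / real ((2 * n) choose n))"
    using c by (simp add: ennreal_mult[symmetric])
  finally show ?thesis .
qed


text \<open>A line of slope \<open>-m\<close> through \<open>(R, t)\<close> supports the profile. It
  is stated as a bound on the radius in terms of the value, because layers are measured by radii;
  \<open>u\<close> is \<open>1 / m\<close> scaled so that the chord from \<open>(0, 1)\<close> to
  \<open>(R, t)\<close> has \<open>u = 1\<close>. That chord descends at most as steeply as the
  line, hence \<open>u \<le> 1\<close>.\<close>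

lemma concave_ray_support:
  fixes p :: "real \<Rightarrow> real"
  assumes cont: "isCont p R" and p0: "p 0 = 1" and R: "0 < R" "p R = t" and t: "0 < t" "t < 1"
    and conc: "\<And>x y u. 0 \<le> x \<Longrightarrow> 0 \<le> y \<Longrightarrow> 0 < p x \<Longrightarrow> 0 < p y \<Longrightarrow> 0 \<le> u \<Longrightarrow> u \<le> 1 \<Longrightarrow>
      (1 - u) * p x + u * p y \<le> p ((1 - u) * x + u * y)"
  obtains u where "0 < u" "u \<le> 1" "\<And>r. 0 \<le> r \<Longrightarrow> 0 < p r \<Longrightarrow> r \<le> R * ((1 - u) + u * ((1 - p r) / (1 - t)))"
proof -
  \<comment> \<open>Rates of descent of a concave profile increase: the chord from \<open>x\<close>
    to \<open>R\<close> is no steeper than the one from \<open>R\<close> to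
    \<open>y\<close>.\<close>
  have three: "(p x - t) / (R - x) \<le> (t - p y) / (y - R)" if x: "0 \<le> x" "x < R" "0 < p x" and y: "R < y" "0 < p y" for x y
  proof -
    define v where "v = (R - x) / (y - x)"
    have v: "0 \<le> v" "v \<le> 1" "1 - v = (y - R) / (y - x)" using x y by (auto simp: v_def field_simps)
    have "(1 - v) * x + v * y = R"
    proof -
      have "v * (y - x) = R - x" using x y by (simp add: v_def)
      then show ?thesis by (simp add: algebra_simps)
    qed
    then have "(1 - v) * p x + v * p y \<le> t" using conc[of x y v] x y v R by simp
    then have "((1 - v) * p x + v * p y) * (y - x) \<le> t * (y - x)" using x y by (intro mult_right_mono) auto
    moreover have "((1 - v) * p x + v * p y) * (y - x) = ((1 - v) * (y - x)) * p x + (v * (y - x)) * p y"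
      by (simp add: algebra_simps)
    moreover have "(1 - v) * (y - x) = y - R" "v * (y - x) = R - x"
      using x y by (simp_all only: v(3)) (simp_all add: v_def)
    ultimately have "(y - R) * p x + (R - x) * p y \<le> t * (y - x)" by simp
    then show ?thesis using x y by (simp add: field_simps)
  qed
  \<comment> \<open>By continuity the profile is still positive slightly beyond \<open>R\<close>;
    the chord to such a point bounds all rates on the left, so their supremum \<open>m\<close> is
    finite.\<close>
  obtain y0 where y0: "R < y0" "0 < p y0"
  proof -
    have "eventually (\<lambda>y. 0 < p y) (at R)"
      using cont R t order_tendstoD(1)[of p "p R" "at R" 0] by (simp add: isCont_def)
    then obtain d where d: "d > 0" "\<And>y. y \<noteq> R \<Longrightarrow> dist y R < d \<Longrightarrow> 0 < p y"
      unfolding eventually_at by auto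
    show ?thesis using that[of "R + d / 2"] d by (auto simp: dist_real_def)
  qed
  define S where "S = (\<lambda>x. (p x - t) / (R - x)) ` {x. 0 \<le> x \<and> x < R \<and> 0 < p x}"
  define m where "m = Sup S"
  have bd: "bdd_above S" unfolding S_def using three y0 by (auto intro!: bdd_aboveI2)
  have m1: "(p x - t) / (R - x) \<le> m" if "0 \<le> x" "x < R" "0 < p x" for x
    unfolding m_def using that bd by (intro cSup_upper) (auto simp: S_def)
  have m2: "m \<le> (t - p y) / (y - R)" if "R < y" "0 < p y" for y
    unfolding m_def using that three R p0 by (intro cSup_least) (auto simp: S_def intro!: exI[of _ 0])
  have m0: "(1 - t) / R \<le> m" using m1[of 0] R p0 by simp
  then have m: "0 < m" using t R by (smt (verit) divide_pos_pos)
  have key: "r \<le> R + (t - p r) / m" if "0 \<le> r" "0 < p r" for r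
  proof -
    consider "r < R" | "r = R" | "R < r" by linarith
    then show ?thesis
    proof cases
      case 1
      then have "p r - t \<le> m * (R - r)" using m1[of r] that by (simp add: field_simps)
      then show ?thesis using m by (simp add: field_simps)
    next
      case 2 then show ?thesis using R by simp
    next
      case 3
      then have "m * (r - R) \<le> t - p r" using m2[of r] that by (simp add: field_simps)
      then show ?thesis using m by (simp add: field_simps)
    qed
  qed
  define u where "u = (1 - t) / (R * m)"
  have "1 - t \<le> R * m" using m0 R by (simp add: field_simps)
  then have "0 < u" "u \<le> 1" using m R t by (auto simp: u_def field_simps)
  moreover have "R * ((1 - u) + u * ((1 - q) / (1 - t))) = R + (t - q) / m" for q
    using t R m by (simp add: u_def field_simps)
  ultimately show ?thesis using that[of u] key by simp
qed

lemma open_AE_notin_imp_empty: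
  fixes S :: "'a::euclidean_space set"
  assumes "open S" "AE x in lborel. x \<notin> S"
  shows "S = {}"
proof (rule ccontr)
  assume "S \<noteq> {}"
  then have "\<not> negligible S" using open_not_negligible[OF assms(1)] by simp
  moreover have "S \<in> null_sets lborel"
    using assms by (subst AE_iff_null_sets) auto
  ultimately show False by (simp add: negligible_iff_null_sets null_sets_completionI)
qed

text \<open>The layer at height \<open>s\<close> ends no later than
  \<open>R ((1 - u) + u (1 - s) / (1 - t))\<close>, and convexity of the \<open>n\<close>-th power
  separates the two terms before the integration over \<open>s\<close>. Equality forces
  \<open>u = 1\<close>, so that the bounding line is the chord itself.\<close>

lemma ray_integral_le:
  fixes p :: "real \<Rightarrow> real"
  assumes cont: "continuous_on UNIV p" and p0: "p 0 = 1" and p01: "\<And>r. 0 \<le> p r \<and> p r \<le> 1"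
    and R: "0 < R" "p R = t" and t: "3/4 \<le> t" "t < 1" and n: "1 \<le> n"
    and conc: "\<And>x y u. 0 \<le> x \<Longrightarrow> 0 \<le> y \<Longrightarrow> 0 < p x \<Longrightarrow> 0 < p y \<Longrightarrow> 0 \<le> u \<Longrightarrow> u \<le> 1 \<Longrightarrow>
      (1 - u) * p x + u * p y \<le> p ((1 - u) * x + u * y)"
  defines "C \<equiv> 1 / (real ((2 * n) choose n) * (1 - t) ^ n)"
  defines "J \<equiv> (\<integral>\<^sup>+r. ennreal (real n * r ^ (n - 1)) * indicator {0<..} r * ennreal (p r ^ n) \<partial>lborel)"
  shows "J \<le> ennreal (C * R ^ n)"
    and "J = ennreal (C * R ^ n) \<Longrightarrow> 0 \<le> r \<Longrightarrow> p r = max 0 (1 - (1 - t) / R * r)"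
proof -
  have [measurable]: "p \<in> borel_measurable borel" using cont by (rule borel_measurable_continuous_onI)
  have isC: "isCont p x" for x using cont by (simp add: continuous_on_eq_continuous_at)
  obtain u where u: "0 < u" "u \<le> 1"
    and sup: "\<And>r. 0 \<le> r \<Longrightarrow> 0 < p r \<Longrightarrow> r \<le> R * ((1 - u) + u * ((1 - p r) / (1 - t)))"
    using concave_ray_support[OF isC p0 R _ t(2) conc] t by auto
  let ?b = "real ((2 * n) choose n)"
  have b: "0 < ?b" by simp
  \<comment> \<open>Here \<open>3/4 \<le> t\<close> enters: \<open>C\<close> is the ratio between
    the bounds at \<open>u = 1\<close> and \<open>u = 0\<close>.\<close>
  have C1: "1 < C"
  proof -
    have "(1 - t) ^ n \<le> (1/4) ^ n" using t by (intro power_mono) auto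
    then have "?b * (1 - t) ^ n \<le> ?b * (1/4) ^ n" using b by simp
    also have "\<dots> < 4 ^ n * (1/4) ^ n"
    proof -
      have "?b < real (4 ^ n)" using central_binomial_less[OF n] by linarith
      then show ?thesis by simp
    qed
    also have "\<dots> = 1" by (simp flip: power_mult_distrib)
    finally show ?thesis using b t by (simp add: C_def field_simps)
  qed
  have bound: "J \<le> ennreal (R ^ n * ((1 - u) + u * C))"
  proof -
    have "J = (\<integral>\<^sup>+s. ennreal (real n * s ^ (n - 1)) * indicator {0..1} s *
       (\<integral>\<^sup>+r. ennreal (real n * r ^ (n - 1)) * indicator {0<..} r * indicator {r. s \<le> p r} r \<partial>lborel) \<partial>lborel)"
      unfolding J_def using p01 n by (intro nn_integral_ray_layer_cake) auto
    also have "\<dots> \<le> (\<integral>\<^sup>+s. ennreal (R ^ n * (1 - u)) * (ennreal (real n * s ^ (n - 1)) * indicator {0..1} s) +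
         ennreal (R ^ n * u / (1 - t) ^ n) * (ennreal (real n * s ^ (n - 1)) * indicator {0..1} s * ennreal ((1 - s) ^ n)) \<partial>lborel)"
    proof (rule nn_integral_mono_AE, use AE_lborel_singleton[of "0::real"] in eventually_elim)
      case (elim s)
      show ?case
      proof (cases "0 \<le> s \<and> s \<le> 1")
        case True
        then have s: "0 < s" "s \<le> 1" using elim by auto
        let ?w = "(1 - u) * 1 + u * ((1 - s) / (1 - t))"
        have w0: "0 \<le> ?w" using u s t by auto
        have "(\<integral>\<^sup>+r. ennreal (real n * r ^ (n - 1)) * indicator {0<..} r * indicator {r. s \<le> p r} r \<partial>lborel)
          \<le> (\<integral>\<^sup>+r. ennreal (real n * r ^ (n - 1)) * indicator {0<..} r * indicator {..R * ?w} r \<partial>lborel)"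
        proof (rule nn_integral_mono)
          fix r :: real
          have "r \<le> R * ?w" if "0 < r" "s \<le> p r"
          proof -
            have "r \<le> R * ((1 - u) + u * ((1 - p r) / (1 - t)))" using sup[of r] that s by auto
            also have "\<dots> \<le> R * ((1 - u) + u * ((1 - s) / (1 - t)))"
              using R u t that by (intro mult_left_mono add_left_mono divide_right_mono) auto
            finally show ?thesis by simp
          qed
          then show "ennreal (real n * r ^ (n - 1)) * indicator {0<..} r * indicator {r. s \<le> p r} r
              \<le> ennreal (real n * r ^ (n - 1)) * indicator {0<..} r * indicator {..R * ?w} r"
            by (auto split: split_indicator)
        qed
        also have "\<dots> = ennreal ((R * ?w) ^ n)" using R w0 n by (intro nn_integral_power_Ioc) auto
        also have "\<dots> \<le> ennreal (R ^ n * ((1 - u) * 1 ^ n + u * ((1 - s) / (1 - t)) ^ n))"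
          unfolding power_mult_distrib using R u s t
          by (intro ennreal_leI mult_left_mono power_convex_combination_le) auto
        also have "\<dots> = ennreal (R ^ n * (1 - u) + R ^ n * u / (1 - t) ^ n * (1 - s) ^ n)"
          by (simp add: algebra_simps power_divide)
        also have "\<dots> = ennreal (R ^ n * (1 - u)) + ennreal (R ^ n * u / (1 - t) ^ n) * ennreal ((1 - s) ^ n)"
        proof -
          have k: "0 \<le> R ^ n * u / (1 - t) ^ n" "0 \<le> (1 - s) ^ n" using R u s t by auto
          have "0 \<le> R ^ n * (1 - u)" using R u by simp
          from ennreal_plus[OF this mult_nonneg_nonneg[OF k]] ennreal_mult[OF k] show ?thesis by (simp only:)
        qed
        finally have "ennreal (real n * s ^ (n - 1)) *
            (\<integral>\<^sup>+r. ennreal (real n * r ^ (n - 1)) * indicator {0<..} r * indicator {r. s \<le> p r} r \<partial>lborel)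
            \<le> ennreal (real n * s ^ (n - 1)) * (ennreal (R ^ n * (1 - u)) + ennreal (R ^ n * u / (1 - t) ^ n) * ennreal ((1 - s) ^ n))"
          by (rule mult_left_mono) simp
        then show ?thesis using s by (simp add: distrib_left mult_ac)
      qed auto
    qed
    also have "\<dots> = ennreal (R ^ n * (1 - u)) * (\<integral>\<^sup>+s. ennreal (real n * s ^ (n - 1)) * indicator {0..1} s \<partial>lborel) +
        ennreal (R ^ n * u / (1 - t) ^ n) * (\<integral>\<^sup>+s. ennreal (real n * s ^ (n - 1)) * indicator {0..1} s * ennreal ((1 - s) ^ n) \<partial>lborel)"
      by (subst nn_integral_add) (measurable, simp add: nn_integral_cmult)
    also have "\<dots> = ennreal (R ^ n * (1 - u)) * ennreal (1 ^ n) + ennreal (R ^ n * u / (1 - t) ^ n) * ennreal (1 / ?b)"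
      by (simp only: nn_integral_central_binomial[OF n] nn_integral_power_Icc[OF zero_le_one n])
    also have "\<dots> = ennreal (R ^ n * (1 - u) + R ^ n * u / (1 - t) ^ n * (1 / ?b))"
      using R u t by (subst ennreal_plus) (auto simp: ennreal_mult[symmetric])
    also have "R ^ n * (1 - u) + R ^ n * u / (1 - t) ^ n * (1 / ?b) = R ^ n * ((1 - u) + u * C)"
      by (simp add: C_def algebra_simps)
    finally show ?thesis .
  qed
  have uC: "(1 - u) + u * C = C - (1 - u) * (C - 1)" by (simp add: algebra_simps)
  have "R ^ n * ((1 - u) + u * C) \<le> C * R ^ n"
    unfolding uC using u C1 R by (simp add: mult.commute)
  then show "J \<le> ennreal (C * R ^ n)"
    using bound by (meson ennreal_leI order_trans)
  show "p r = max 0 (1 - (1 - t) / R * r)" if J: "J = ennreal (C * R ^ n)" and r: "0 \<le> r"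
  proof -
    have "C * R ^ n \<le> R ^ n * ((1 - u) + u * C)"
      using bound unfolding J using u C1 R by (subst (asm) ennreal_le_iff) auto
    then have "(1 - u) * (C - 1) \<le> 0" unfolding uC using R by (simp add: mult.commute)
    then have u1: "u = 1" using u C1 by (smt (verit) mult_pos_pos)
    define c where "c = (1 - t) / R"
    have c: "0 < c" using t R by (simp add: c_def)
    define q where "q r = min 1 (max 0 (1 - c * r))" for r
    have [measurable]: "q \<in> borel_measurable borel" unfolding q_def by measurable
    have pq: "p r \<le> q r" if "0 \<le> r" for r
    proof (cases "p r > 0")
      case True
      then have "r \<le> R * ((1 - p r) / (1 - t))" using sup[OF that] u1 by simp
      then have "c * r \<le> 1 - p r" using R t by (simp add: c_def field_simps)
      then show ?thesis using p01[of r] by (simp add: q_def)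
    qed (use p01[of r] in \<open>auto simp: q_def\<close>)
    let ?w = "\<lambda>r::real. ennreal (real n * r ^ (n - 1)) * indicator {0<..} r"
    have Jq: "(\<integral>\<^sup>+r. ?w r * ennreal (q r ^ n) \<partial>lborel) = J"
      unfolding q_def nn_integral_ray_linear[OF c n] J by (simp add: c_def C_def power_divide mult.commute)
    \<comment> \<open>Since \<open>p \<le> q\<close> and the integral is finite, the difference of
      the weighted powers has integral 0 and vanishes almost everywhere. The set where
      \<open>p < q\<close> is open by continuity, hence empty.\<close>
    have "(\<integral>\<^sup>+r. ?w r * ennreal (q r ^ n) - ?w r * ennreal (p r ^ n) \<partial>lborel) =
      (\<integral>\<^sup>+r. ?w r * ennreal (q r ^ n) \<partial>lborel) - (\<integral>\<^sup>+r. ?w r * ennreal (p r ^ n) \<partial>lborel)"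
    proof (rule nn_integral_diff)
      show "(\<integral>\<^sup>+r. ?w r * ennreal (p r ^ n) \<partial>lborel) \<noteq> \<infinity>" using J unfolding J_def by simp
      have "?w r * ennreal (p r ^ n) \<le> ?w r * ennreal (q r ^ n)" for r
        using pq[of r] p01[of r] by (auto split: split_indicator intro!: mult_left_mono ennreal_leI power_mono)
      then show "AE r in lborel. ?w r * ennreal (p r ^ n) \<le> ?w r * ennreal (q r ^ n)" by simp
    qed measurable
    also have "\<dots> = J - J" by (simp only: Jq flip: J_def)
    finally have "(\<integral>\<^sup>+r. ?w r * ennreal (q r ^ n) - ?w r * ennreal (p r ^ n) \<partial>lborel) = J - J" .
    then have "AE r in lborel. ?w r * ennreal (q r ^ n) - ?w r * ennreal (p r ^ n) = 0"
      using J by (simp add: nn_integral_0_iff_AE)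
    then have ae: "AE r in lborel. \<not> (0 < r \<and> p r < q r)"
    proof eventually_elim
      case (elim r)
      show ?case
      proof
        assume r: "0 < r \<and> p r < q r"
        then have "p r ^ n < q r ^ n" using p01[of r] n by (intro power_strict_mono) auto
        then have "real n * r ^ (n - 1) * p r ^ n < real n * r ^ (n - 1) * q r ^ n" using r n by auto
        then have "?w r * ennreal (p r ^ n) < ?w r * ennreal (q r ^ n)"
          using r p01[of r] by (simp add: ennreal_mult[symmetric] ennreal_less_iff q_def)
        then show False using elim by (metis ennreal_minus_eq_0 not_le)
      qed
    qed
    have "open {r. 0 < r \<and> p r < q r}"
      unfolding q_def by (intro open_Collect_conj open_Collect_less continuous_intros cont)
    then have "{r. 0 < r \<and> p r < q r} = {}"
      by (rule open_AE_notin_imp_empty) (use ae in simp)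
    then have "p r = q r" if "0 < r" using pq[of r] that by fastforce
    moreover have "p r = q r" if "r = 0" using that p0 by (simp add: q_def)
    ultimately have "p r = q r" using r by fastforce
    moreover have "0 \<le> c * r" using r c by simp
    then have "q r = max 0 (1 - c * r)" by (auto simp: q_def)
    ultimately show ?thesis by (simp only: c_def)
  qed
qed

subsection \<open>Ball's bodies and level sets of concave profiles\<close>

lemma nn_integral_lborel_scaleR:
  fixes F :: "'a::euclidean_space \<Rightarrow> ennreal"
  assumes [measurable]: "F \<in> borel_measurable borel" and r: "0 < r"
  shows "(\<integral>\<^sup>+y. F (r *\<^sub>R y) \<partial>lborel) = ennreal ((1 / r) ^ DIM('a)) * (\<integral>\<^sup>+x. F x \<partial>lborel)"
proof -
  have "(\<integral>\<^sup>+x. F x \<partial>lborel) = (\<integral>\<^sup>+x. F x \<partial>density (distr lborel borel (\<lambda>x. 0 + r *\<^sub>R x)) (\<lambda>_. ennreal (\<bar>r\<bar> ^ DIM('a))))"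
    using lborel_affine[of r "0::'a"] r by simp
  also have "\<dots> = (\<integral>\<^sup>+y. ennreal (r ^ DIM('a)) * F (r *\<^sub>R y) \<partial>lborel)"
    using r by (simp add: nn_integral_density nn_integral_distr)
  also have "\<dots> = ennreal (r ^ DIM('a)) * (\<integral>\<^sup>+y. F (r *\<^sub>R y) \<partial>lborel)" by (rule nn_integral_cmult) simp
  finally have "ennreal ((1 / r) ^ DIM('a)) * (\<integral>\<^sup>+x. F x \<partial>lborel) =
     ennreal ((1 / r) ^ DIM('a) * r ^ DIM('a)) * (\<integral>\<^sup>+y. F (r *\<^sub>R y) \<partial>lborel)"
    using r by (subst ennreal_mult) (simp_all add: mult.assoc)
  also have "(1 / r) ^ DIM('a) * r ^ DIM('a) = 1" using r by (simp flip: power_mult_distrib)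
  finally show ?thesis by simp
qed

text \<open>In the formula along rays the substitution \<open>x = r y\<close> leaves this weight in
  \<open>r\<close>. Integrated over \<open>r \<ge> 1 / R x\<close> it gives \<open>R x ^ n\<close>,
  which cancels the factor \<open>(1 / R x) ^ n\<close> there.\<close>

lemma nn_integral_inverse_power_tail:
  assumes a: "0 < a" and n: "1 \<le> n"
  shows "(\<integral>\<^sup>+r. ennreal (real n * (1 / r) ^ (n + 1)) * indicator {a..} r \<partial>lborel) = ennreal ((1 / a) ^ n)"
proof -
  have "(\<integral>\<^sup>+r. ennreal (real n * (1 / r) ^ (n + 1)) * indicator {a..} r \<partial>lborel) = ennreal (0 - (- ((1 / a) ^ n)))"
  proof (rule nn_integral_FTC_atLeast[where F="\<lambda>r. - ((1 / r) ^ n)"])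
    fix r assume r: "a \<le> r"
    then have "r \<noteq> 0" using a by auto
    then have "((\<lambda>r. - ((1 / r) ^ n)) has_real_derivative - (real n * (1 / r) ^ (n - 1) * (- 1 / r\<^sup>2))) (at r)"
      by (auto intro!: derivative_eq_intros simp: power2_eq_square)
    moreover have "- (real n * (1 / r) ^ (n - 1) * (- 1 / r\<^sup>2)) = real n * ((1 / r) ^ (n - 1) * (1 / r)\<^sup>2)"
      by (simp add: power_divide)
    moreover have "(1 / r) ^ (n - 1) * (1 / r)\<^sup>2 = (1 / r) ^ (n + 1)"
      using n by (simp flip: power_add)
    ultimately show "((\<lambda>r. - ((1 / r) ^ n)) has_real_derivative real n * (1 / r) ^ (n + 1)) (at r)" by simp
    show "0 \<le> real n * (1 / r) ^ (n + 1)" using r a by simp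
  next
    have "((\<lambda>r::real. (1 / r)) \<longlongrightarrow> 0) at_top"
      by (intro tendsto_divide_0[OF tendsto_const] filterlim_at_top_imp_at_infinity filterlim_ident)
    then have "((\<lambda>r::real. - ((1 / r) ^ n)) \<longlongrightarrow> - (0 ^ n)) at_top" by (intro tendsto_intros)
    then show "((\<lambda>r::real. - ((1 / r) ^ n)) \<longlongrightarrow> 0) at_top" using n by (simp add: zero_power)
  qed measurable
  then show ?thesis by simp
qed

text \<open>Integration along rays without polar coordinates: the radial function \<open>R\<close> of a star body
  only has to be homogeneous of degree \<open>-1\<close>, and the set \<open>{R \<ge> 1}\<close> plays the role of the sphere.\<close>

lemma nn_integral_along_rays:
  fixes G :: "'a::euclidean_space \<Rightarrow> ennreal"
  assumes G[measurable]: "G \<in> borel_measurable borel" and R[measurable]: "R \<in> borel_measurable borel"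
    and Rpos: "\<And>y. y \<noteq> 0 \<Longrightarrow> 0 < R y" and Rhom: "\<And>y c. y \<noteq> 0 \<Longrightarrow> 0 < c \<Longrightarrow> R (c *\<^sub>R y) = R y / c"
  defines "n \<equiv> DIM('a)"
  shows "(\<integral>\<^sup>+x. G x \<partial>lborel) = (\<integral>\<^sup>+y. indicator {y. y \<noteq> 0 \<and> 1 \<le> R y} y * (ennreal ((1 / R y) ^ n) *
     (\<integral>\<^sup>+r. ennreal (real n * r ^ (n - 1)) * indicator {0<..} r * G (r *\<^sub>R y) \<partial>lborel)) \<partial>lborel)"
proof -
  have n: "1 \<le> n" by (simp add: n_def Suc_leI)
  have meas[measurable]: "{y. y \<noteq> 0 \<and> 1 \<le> R y} \<in> sets borel" by measurable
  let ?I = "indicator {y. y \<noteq> 0 \<and> 1 \<le> R y} :: 'a \<Rightarrow> ennreal"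
  let ?w = "\<lambda>r. ennreal (real n * r ^ (n - 1)) * indicator {0<..} r"
  have "(\<integral>\<^sup>+y. ?I y * (ennreal ((1 / R y) ^ n) * (\<integral>\<^sup>+r. ?w r * G (r *\<^sub>R y) \<partial>lborel)) \<partial>lborel)
    = (\<integral>\<^sup>+y. (\<integral>\<^sup>+r. ?I y * (ennreal ((1 / R y) ^ n) * (?w r * G (r *\<^sub>R y))) \<partial>lborel) \<partial>lborel)"
    by (rule nn_integral_cong) (simp add: nn_integral_cmult)
  also have "\<dots> = (\<integral>\<^sup>+r. (\<integral>\<^sup>+y. ?I y * (ennreal ((1 / R y) ^ n) * (?w r * G (r *\<^sub>R y))) \<partial>lborel) \<partial>lborel)"
    by (rule lborel_pair.Fubini') measurable
  \<comment> \<open>At fixed \<open>r\<close> the substitution \<open>x = r y\<close> contributes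
    \<open>(1 / r) ^ n\<close>, and homogeneity turns \<open>R y\<close> into
    \<open>r * R x\<close>.\<close>
  also have "\<dots> = (\<integral>\<^sup>+r. (\<integral>\<^sup>+x. ennreal (real n * (1 / r) ^ (n + 1)) * indicator {0<..} r * (if x \<noteq> 0 \<and> 1 \<le> r * R x then ennreal ((1 / R x) ^ n) * G x else 0) \<partial>lborel) \<partial>lborel)"
  proof (rule nn_integral_cong)
    fix r :: real
    show "(\<integral>\<^sup>+y. ?I y * (ennreal ((1 / R y) ^ n) * (?w r * G (r *\<^sub>R y))) \<partial>lborel) =
      (\<integral>\<^sup>+x. ennreal (real n * (1 / r) ^ (n + 1)) * indicator {0<..} r * (if x \<noteq> 0 \<and> 1 \<le> r * R x then ennreal ((1 / R x) ^ n) * G x else 0) \<partial>lborel)"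
    proof (cases "0 < r")
      case True
      define F where "F x = ennreal (real n * r ^ (n - 1) * (1 / r) ^ n) * (if x \<noteq> 0 \<and> 1 \<le> r * R x then ennreal ((1 / R x) ^ n) * G x else 0)" for x
      have [measurable]: "F \<in> borel_measurable borel" unfolding F_def by measurable
      have "(\<integral>\<^sup>+y. ?I y * (ennreal ((1 / R y) ^ n) * (?w r * G (r *\<^sub>R y))) \<partial>lborel) = (\<integral>\<^sup>+y. F (r *\<^sub>R y) \<partial>lborel)"
      proof (rule nn_integral_cong)
        fix y :: 'a
        show "?I y * (ennreal ((1 / R y) ^ n) * (?w r * G (r *\<^sub>R y))) = F (r *\<^sub>R y)"
        proof (cases "y = 0")
          case False
          have h: "R (r *\<^sub>R y) = R y / r" using Rhom[OF False True] .
          have e: "ennreal ((1 / R y) ^ n) * ennreal (real n * r ^ (n - 1)) =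
             ennreal (real n * r ^ (n - 1) * (1 / r) ^ n) * ennreal ((1 / (R y / r)) ^ n)"
            using Rpos[OF False] True by (simp add: ennreal_mult[symmetric] power_divide mult_ac)
          show ?thesis using True False e
            by (auto simp: F_def h mult.assoc[symmetric] split: split_indicator)
        qed (simp add: F_def)
      qed
      also have "\<dots> = ennreal ((1 / r) ^ n) * (\<integral>\<^sup>+x. F x \<partial>lborel)"
        unfolding n_def by (rule nn_integral_lborel_scaleR) (use True in auto)
      also have "\<dots> = (\<integral>\<^sup>+x. ennreal ((1 / r) ^ n) * F x \<partial>lborel)" by (rule nn_integral_cmult[symmetric]) simp
      also have "\<dots> = (\<integral>\<^sup>+x. ennreal (real n * (1 / r) ^ (n + 1)) * indicator {0<..} r * (if x \<noteq> 0 \<and> 1 \<le> r * R x then ennreal ((1 / R x) ^ n) * G x else 0) \<partial>lborel)"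
      proof (rule nn_integral_cong)
        fix x :: 'a
        have "(1 / r) ^ n * (real n * r ^ (n - 1) * (1 / r) ^ n) = real n * (1 / r) ^ (n + 1)"
        proof -
          have "r ^ (n - 1) * (1 / r) ^ n = 1 / r"
            using True n power_add[of "1 / r" "n - 1" 1] by (simp add: power_one_over field_simps)
          then have "(1 / r) ^ n * (real n * r ^ (n - 1) * (1 / r) ^ n) = real n * ((1 / r) ^ n * (1 / r))"
            by (metis mult.assoc mult.commute)
          then show ?thesis by simp
        qed
        then have "ennreal ((1 / r) ^ n) * ennreal (real n * r ^ (n - 1) * (1 / r) ^ n) = ennreal (real n * (1 / r) ^ (n + 1))"
          using True by (subst ennreal_mult[symmetric]) auto
        then show "ennreal ((1 / r) ^ n) * F x = ennreal (real n * (1 / r) ^ (n + 1)) * indicator {0<..} r * (if x \<noteq> 0 \<and> 1 \<le> r * R x then ennreal ((1 / R x) ^ n) * G x else 0)"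
          using True unfolding F_def by (simp add: mult.assoc[symmetric])
      qed
      finally show ?thesis .
    qed simp
  qed
  also have "\<dots> = (\<integral>\<^sup>+x. (\<integral>\<^sup>+r. ennreal (real n * (1 / r) ^ (n + 1)) * indicator {0<..} r * (if x \<noteq> 0 \<and> 1 \<le> r * R x then ennreal ((1 / R x) ^ n) * G x else 0) \<partial>lborel) \<partial>lborel)"
    by (rule lborel_pair.Fubini') measurable
  also have "\<dots> = (\<integral>\<^sup>+x. G x \<partial>lborel)"
  proof (rule nn_integral_cong_AE, use AE_lborel_singleton[of "0::'a"] in eventually_elim)
    case (elim x)
    then have R0: "0 < R x" by (rule Rpos)
    have "(\<integral>\<^sup>+r. ennreal (real n * (1 / r) ^ (n + 1)) * indicator {0<..} r * (if x \<noteq> 0 \<and> 1 \<le> r * R x then ennreal ((1 / R x) ^ n) * G x else 0) \<partial>lborel)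
      = (\<integral>\<^sup>+r. (ennreal (real n * (1 / r) ^ (n + 1)) * indicator {1 / R x..} r) * (ennreal ((1 / R x) ^ n) * G x) \<partial>lborel)"
    proof (rule nn_integral_cong)
      fix r
      have "(0 < r \<and> 1 \<le> r * R x) \<longleftrightarrow> 1 / R x \<le> r"
      proof
        assume "1 / R x \<le> r"
        moreover have "0 < 1 / R x" using R0 by simp
        ultimately have "0 < r" by linarith
        then show "0 < r \<and> 1 \<le> r * R x" using \<open>1 / R x \<le> r\<close> R0 by (simp add: field_simps)
      qed (use R0 in \<open>simp add: field_simps\<close>)
      then show "ennreal (real n * (1 / r) ^ (n + 1)) * indicator {0<..} r * (if x \<noteq> 0 \<and> 1 \<le> r * R x then ennreal ((1 / R x) ^ n) * G x else 0)
        = (ennreal (real n * (1 / r) ^ (n + 1)) * indicator {1 / R x..} r) * (ennreal ((1 / R x) ^ n) * G x)"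
        using elim by (auto split: split_indicator)
    qed
    also have "\<dots> = (\<integral>\<^sup>+r. ennreal (real n * (1 / r) ^ (n + 1)) * indicator {1 / R x..} r \<partial>lborel) * (ennreal ((1 / R x) ^ n) * G x)"
      by (rule nn_integral_multc) simp
    also have "\<dots> = ennreal ((R x) ^ n) * (ennreal ((1 / R x) ^ n) * G x)"
      using nn_integral_inverse_power_tail[of "1 / R x" n] R0 n by simp
    also have "\<dots> = ennreal ((R x) ^ n * (1 / R x) ^ n) * G x"
      using R0 by (subst ennreal_mult) (auto simp: mult.assoc)
    also have "(R x) ^ n * (1 / R x) ^ n = 1" using R0 by (simp flip: power_mult_distrib)
    finally show ?case by simp
  qed
  finally show ?thesis by simp
qed

text \<open>Isolates the properties of the normalised covariogram behind the volume bound. Concavity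
  is asked only between points of positive value, as the extension by 0 outside the bounded support
  is not concave.\<close>

locale concave_profile =
  fixes g :: "'a::euclidean_space \<Rightarrow> real"
  assumes cont: "continuous_on UNIV g"
    and g01: "0 \<le> g x" "g x \<le> 1"
    and g0: "g 0 = 1"
    and conc: "0 < g x \<Longrightarrow> 0 < g y \<Longrightarrow> 0 \<le> u \<Longrightarrow> u \<le> 1 \<Longrightarrow>
      (1 - u) * g x + u * g y \<le> g ((1 - u) *\<^sub>R x + u *\<^sub>R y)"
    and bdd: "bounded {x. 0 < g x}"
begin

lemma borel_g [measurable]: "g \<in> borel_measurable borel"
  using cont by (rule borel_measurable_continuous_onI)

lemma tendsto_ray: "(\<lambda>r. g (r *\<^sub>R y)) \<midarrow>s\<rightarrow> g (s *\<^sub>R y)"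
proof -
  have "continuous_on UNIV (\<lambda>r. g (r *\<^sub>R y))"
    by (intro continuous_on_compose2[OF cont] continuous_intros) auto
  then show ?thesis by (simp add: continuous_on_eq_continuous_at isCont_def)
qed

text \<open>The radial function of the level set \<open>{x. t \<le> g x}\<close>. At the origin
  every radius would qualify, and 0 is a default value.\<close>

definition radius :: "real \<Rightarrow> 'a \<Rightarrow> real" where
  "radius t y = (if y = 0 then 0 else Sup {r. 0 \<le> r \<and> t \<le> g (r *\<^sub>R y)})"

context
  fixes t :: real
  assumes t: "0 < t" "t < 1"
begin

text \<open>The level set is closed, bounded and, by concavity and \<open>g 0 = 1\<close>,
  star-shaped about the origin; so the supremum is attained and all smaller radii qualify.
  Homogeneity and measurability of the radius are read off from this equivalence.\<close>

lemma radius_iff: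
  assumes y: "y \<noteq> 0" and s: "0 \<le> s"
  shows "s \<le> radius t y \<longleftrightarrow> t \<le> g (s *\<^sub>R y)"
proof -
  define S where "S = {r. 0 \<le> r \<and> t \<le> g (r *\<^sub>R y)}"
  have S0: "0 \<in> S" using t g0 by (simp add: S_def)
  obtain B where B: "\<And>x. 0 < g x \<Longrightarrow> norm x \<le> B" using bdd unfolding bounded_iff by auto
  have bd: "bdd_above S"
  proof (rule bdd_aboveI)
    fix r assume "r \<in> S"
    then have "norm (r *\<^sub>R y) \<le> B" "0 \<le> r" using B[of "r *\<^sub>R y"] t by (auto simp: S_def)
    then show "r \<le> B / norm y" using y by (simp add: field_simps)
  qed
  have "closed S"
    unfolding S_def
    by (intro closed_Collect_conj closed_Collect_le continuous_intros continuous_on_compose2[OF cont]) auto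
  then have "Sup S \<in> S" using bd S0 closed_contains_Sup by blast
  have rS: "radius t y = Sup S" using y by (simp add: radius_def S_def)
  show ?thesis
  proof
    assume "t \<le> g (s *\<^sub>R y)"
    then have "s \<in> S" using s by (simp add: S_def)
    then show "s \<le> radius t y" unfolding rS using bd by (rule cSup_upper)
  next
    assume le: "s \<le> radius t y"
    let ?m = "Sup S"
    have m: "0 \<le> ?m" "t \<le> g (?m *\<^sub>R y)" using \<open>Sup S \<in> S\<close> by (auto simp: S_def)
    show "t \<le> g (s *\<^sub>R y)"
    proof (cases "?m = 0")
      case True
      then show ?thesis using le s t g0 rS by auto
    next
      case False
      define u where "u = s / ?m"
      have u: "0 \<le> u" "u \<le> 1" "u * ?m = s" using le s m False rS by (auto simp: u_def field_simps)
      have "0 \<le> (1 - u) * (1 - t)" using u t by simp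
      then have "t \<le> (1 - u) * 1 + u * t" by (simp add: algebra_simps)
      also have "\<dots> \<le> (1 - u) * g 0 + u * g (?m *\<^sub>R y)"
        using u m g0 by (simp add: mult_left_mono)
      also have "\<dots> \<le> g ((1 - u) *\<^sub>R 0 + u *\<^sub>R ?m *\<^sub>R y)" using conc[of 0 "?m *\<^sub>R y" u] u m t g0 by auto
      finally show ?thesis using u by simp
    qed
  qed
qed

lemma radius_pos:
  assumes y: "y \<noteq> 0"
  shows "0 < radius t y"
proof -
  have "eventually (\<lambda>r. t < g (r *\<^sub>R y)) (at 0)"
    using tendsto_ray[of y 0] t g0 by (intro order_tendstoD(1)[of _ "g (0 *\<^sub>R y)"]) auto
  then obtain d where "d > 0" "\<And>r. r \<noteq> 0 \<Longrightarrow> dist r 0 < d \<Longrightarrow> t < g (r *\<^sub>R y)"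
    unfolding eventually_at by auto
  from this(1) this(2)[of "d / 2"] have "t \<le> g ((d / 2) *\<^sub>R y)" by (simp add: dist_real_def)
  then show ?thesis using radius_iff[OF y, of "d / 2"] \<open>d > 0\<close> by auto
qed

lemma radius_hom:
  assumes y: "y \<noteq> 0" and c: "0 < c"
  shows "radius t (c *\<^sub>R y) = radius t y / c"
proof -
  have cy: "c *\<^sub>R y \<noteq> 0" using y c by simp
  have *: "s \<le> radius t (c *\<^sub>R y) \<longleftrightarrow> s \<le> radius t y / c" if "0 \<le> s" for s
    using radius_iff[OF cy that] radius_iff[OF y, of "s * c"] that c by (simp add: field_simps)
  show ?thesis
    using *[of "radius t (c *\<^sub>R y)"] *[of "radius t y / c"] radius_pos[OF y] radius_pos[OF cy] c by auto
qed

lemma radius_value: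
  assumes y: "y \<noteq> 0"
  shows "g (radius t y *\<^sub>R y) = t"
proof -
  have "t \<le> g (radius t y *\<^sub>R y)" using radius_iff[OF y, of "radius t y"] radius_pos[OF y] by simp
  moreover have "\<not> t < g (radius t y *\<^sub>R y)"
  proof
    assume less: "t < g (radius t y *\<^sub>R y)"
    from tendsto_ray less have "eventually (\<lambda>r. t < g (r *\<^sub>R y)) (at (radius t y))"
      by (rule order_tendstoD(1))
    then obtain d where d: "d > 0" "\<And>r. r \<noteq> radius t y \<Longrightarrow> dist r (radius t y) < d \<Longrightarrow> t < g (r *\<^sub>R y)"
      unfolding eventually_at by auto
    from d(1) d(2)[of "radius t y + d / 2"] have "t \<le> g ((radius t y + d / 2) *\<^sub>R y)" by (simp add: dist_real_def)
    then show False using radius_iff[OF y, of "radius t y + d / 2"] radius_pos[OF y] \<open>d > 0\<close> by auto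
  qed
  ultimately show ?thesis by simp
qed

lemma borel_radius: "radius t \<in> borel_measurable borel"
  unfolding borel_measurable_iff_ge
proof
  fix a :: real
  show "{w \<in> space borel. a \<le> radius t w} \<in> sets borel"
  proof (cases "0 < a")
    case True
    have "{w \<in> space borel. a \<le> radius t w} = {w. w \<noteq> 0 \<and> t \<le> g (a *\<^sub>R w)}"
      using radius_iff[of _ a] True by (auto simp: radius_def)
    also have "\<dots> \<in> sets borel" by measurable
    finally show ?thesis .
  next
    case False
    have "0 \<le> radius t w" for w using radius_pos[of w] by (cases "w = 0") (auto simp: radius_def)
    then have "{w \<in> space borel. a \<le> radius t w} = UNIV" using False by (auto intro: order_trans[of _ 0])
    then show ?thesis by simp
  qed
qed

end

lemma level_set_lmeasurable:
  assumes "0 < t"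
  shows "{x. t \<le> g x} \<in> lmeasurable" "{x. t \<le> g x} \<in> sets borel"
proof -
  show b: "{x. t \<le> g x} \<in> sets borel" by measurable
  have "bounded {x. t \<le> g x}" using bdd by (rule bounded_subset) (use assms in auto)
  then show "{x. t \<le> g x} \<in> lmeasurable" using b by (intro bounded_set_imp_lmeasurable) auto
qed

text \<open>On the ray through \<open>y\<close> the bound is \<open>C * radius t y ^ n\<close>,
  which cancels the factor in the formula along rays. What remains is \<open>C\<close> times the
  volume of the points of radius at least 1, and these form the level set up to the origin.\<close>

lemma ball_body_bound:
  fixes t :: real
  assumes t: "3/4 \<le> t" "t < 1"
  defines "n \<equiv> DIM('a)"
  defines "C \<equiv> 1 / (real ((2 * n) choose n) * (1 - t) ^ n)"
  shows "(\<integral>\<^sup>+x. ennreal (g x ^ n) \<partial>lborel) \<le> ennreal (C * measure lebesgue {x. t \<le> g x})"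
    and "(\<integral>\<^sup>+x. ennreal (g x ^ n) \<partial>lborel) = ennreal (C * measure lebesgue {x. t \<le> g x}) \<Longrightarrow>
      \<exists>c. \<forall>r\<ge>0. g (r *\<^sub>R y) = max 0 (1 - c * r)"
proof -
  have t0: "0 < t" using t by simp
  note rad = radius_iff[OF t0 t(2)] radius_pos[OF t0 t(2)] radius_hom[OF t0 t(2)] radius_value[OF t0 t(2)]
  have [measurable]: "radius t \<in> borel_measurable borel" by (rule borel_radius[OF t0 t(2)])
  have n: "1 \<le> n" by (simp add: n_def Suc_leI)
  define J where "J y = (\<integral>\<^sup>+r. ennreal (real n * r ^ (n - 1)) * indicator {0<..} r * ennreal (g (r *\<^sub>R y) ^ n) \<partial>lborel)" for y
  have Jm[measurable]: "J \<in> borel_measurable borel" unfolding J_def by measurable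
  have C0: "0 \<le> C" using t by (simp add: C_def)
  note ray = ray_integral_le[where p="\<lambda>r. g (r *\<^sub>R y)" and t=t and n=n and R="radius t y" for y]
  have Jle: "J y \<le> ennreal (C * radius t y ^ n)"
    and Jeq: "J y = ennreal (C * radius t y ^ n) \<Longrightarrow> \<exists>c. \<forall>r\<ge>0. g (r *\<^sub>R y) = max 0 (1 - c * r)" if y: "y \<noteq> 0" for y
  proof -
    have 1: "continuous_on UNIV (\<lambda>r. g (r *\<^sub>R y))"
      by (intro continuous_on_compose2[OF cont] continuous_intros) auto
    have 2: "(1 - u) * g (x *\<^sub>R y) + u * g (z *\<^sub>R y) \<le> g (((1 - u) * x + u * z) *\<^sub>R y)"
      if "0 < g (x *\<^sub>R y)" "0 < g (z *\<^sub>R y)" "0 \<le> u" "u \<le> 1" for x z u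
      using conc[OF that] by (simp add: scaleR_add_left)
    show "J y \<le> ennreal (C * radius t y ^ n)"
      unfolding J_def C_def
      by (rule ray(1)) (use 1 2 g0 g01 rad(2,4)[OF y] t n in auto)
    assume "J y = ennreal (C * radius t y ^ n)"
    then have "g (r *\<^sub>R y) = max 0 (1 - (1 - t) / radius t y * r)" if "0 \<le> r" for r
      unfolding J_def C_def
      by (intro ray(2)) (use 1 2 g0 g01 rad(2,4)[OF y] t n that in auto)
    then show "\<exists>c. \<forall>r\<ge>0. g (r *\<^sub>R y) = max 0 (1 - c * r)" by blast
  qed
  let ?A = "{y. y \<noteq> 0 \<and> 1 \<le> radius t y}"
  have Aeq: "?A = {y. t \<le> g y} - {0}" using rad(1)[of _ 1] by auto
  have Am[measurable]: "?A \<in> sets borel" by measurable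
  have vA: "emeasure lborel ?A = ennreal (measure lebesgue {x. t \<le> g x})"
    unfolding Aeq emeasure_lborel_eq_measure_lebesgue[OF level_set_lmeasurable(2)[OF t0] level_set_lmeasurable(1)[OF t0], symmetric]
    by (rule emeasure_Diff_null_set) auto
  have eq: "(\<integral>\<^sup>+x. ennreal (g x ^ n) \<partial>lborel) = (\<integral>\<^sup>+y. indicator ?A y * (ennreal ((1 / radius t y) ^ n) * J y) \<partial>lborel)"
    unfolding J_def n_def
    by (rule nn_integral_along_rays) (use rad(2,3) in auto)
  have ptw: "indicator ?A y * (ennreal ((1 / radius t y) ^ n) * J y) \<le> ennreal C * indicator ?A y" for y
  proof (cases "y \<in> ?A")
    case True
    then have y: "y \<noteq> 0" by simp
    have "ennreal ((1 / radius t y) ^ n) * J y \<le> ennreal ((1 / radius t y) ^ n) * ennreal (C * radius t y ^ n)"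
      by (rule mult_left_mono[OF Jle[OF y]]) simp
    also have "\<dots> = ennreal C"
      using rad(2)[OF y] C0 by (subst ennreal_mult[symmetric]) (auto simp: power_divide)
    finally show ?thesis using True by simp
  qed auto
  have tot: "(\<integral>\<^sup>+y. ennreal C * indicator ?A y \<partial>lborel) = ennreal (C * measure lebesgue {x. t \<le> g x})"
    using C0 vA by (simp add: nn_integral_cmult ennreal_mult)
  show "(\<integral>\<^sup>+x. ennreal (g x ^ n) \<partial>lborel) \<le> ennreal (C * measure lebesgue {x. t \<le> g x})"
    unfolding eq tot[symmetric] by (intro nn_integral_mono ptw)
  assume E: "(\<integral>\<^sup>+x. ennreal (g x ^ n) \<partial>lborel) = ennreal (C * measure lebesgue {x. t \<le> g x})"
  define P where "P y \<longleftrightarrow> (\<exists>c. \<forall>r\<ge>0. g (r *\<^sub>R y) = max 0 (1 - c * r))" for y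
  have "(\<integral>\<^sup>+y. ennreal C * indicator ?A y - indicator ?A y * (ennreal ((1 / radius t y) ^ n) * J y) \<partial>lborel) =
     (\<integral>\<^sup>+y. ennreal C * indicator ?A y \<partial>lborel) - (\<integral>\<^sup>+y. indicator ?A y * (ennreal ((1 / radius t y) ^ n) * J y) \<partial>lborel)"
    by (rule nn_integral_diff) (use ptw E eq in auto)
  also have "\<dots> = 0" unfolding tot eq[symmetric] E by simp
  finally have "AE y in lborel. ennreal C * indicator ?A y - indicator ?A y * (ennreal ((1 / radius t y) ^ n) * J y) = 0"
    by (subst (asm) nn_integral_0_iff_AE) auto
  then have ae: "AE y in lborel. y \<in> ?A \<longrightarrow> P y"
  proof eventually_elim
    case (elim y)
    show ?case
    proof
      assume yA: "y \<in> ?A"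
      then have y: "y \<noteq> 0" by simp
      have "ennreal C \<le> ennreal ((1 / radius t y) ^ n) * J y" using elim yA by (simp add: ennreal_minus_eq_0)
      then have "ennreal (radius t y ^ n) * ennreal C \<le> ennreal (radius t y ^ n) * (ennreal ((1 / radius t y) ^ n) * J y)"
        by (rule mult_left_mono) simp
      also have "\<dots> = ennreal (radius t y ^ n * (1 / radius t y) ^ n) * J y"
        using rad(2)[OF y] by (subst ennreal_mult) (auto simp: mult.assoc)
      also have "radius t y ^ n * (1 / radius t y) ^ n = 1" using rad(2)[OF y] by (simp flip: power_mult_distrib)
      finally have "ennreal (C * radius t y ^ n) \<le> J y"
        using C0 rad(2)[OF y] by (simp add: ennreal_mult mult.commute)
      then show "P y" unfolding P_def using Jle[OF y] by (intro Jeq[OF y] antisym)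
    qed
  qed
  have scale: "P (c *\<^sub>R y)" if "P y" "0 \<le> c" for c y
  proof -
    obtain d where d: "\<forall>r\<ge>0. g (r *\<^sub>R y) = max 0 (1 - d * r)" using \<open>P y\<close> unfolding P_def by blast
    have "\<forall>r\<ge>0. g (r *\<^sub>R c *\<^sub>R y) = max 0 (1 - (d * c) * r)"
      using d \<open>0 \<le> c\<close> by (auto simp: mult_ac)
    then show ?thesis unfolding P_def by blast
  qed
  \<comment> \<open>At a radius \<open>r0\<close> where the limit ray is positive, the value of
    \<open>g\<close> determines the slope, so the slopes of the approximating rays converge.\<close>
  have closedP: "P y" if lim: "Y \<longlonglongrightarrow> y" and PY: "\<And>k. P (Y k)" for Y y
  proof -
    obtain c where c: "\<And>k r. 0 \<le> r \<Longrightarrow> g (r *\<^sub>R Y k) = max 0 (1 - c k * r)"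
      using PY unfolding P_def by metis
    have gl: "(\<lambda>k. g (r *\<^sub>R Y k)) \<longlonglongrightarrow> g (r *\<^sub>R y)" for r
      by (rule continuous_on_tendsto_compose[OF cont]) (auto intro!: tendsto_intros lim)
    obtain r0 where r0: "r0 > 0" "0 < g (r0 *\<^sub>R y)"
    proof (cases "y = 0")
      case True then show ?thesis using that[of 1] g0 by simp
    next
      case False then show ?thesis using that[of "radius t y"] rad(2,4)[OF False] t0 by simp
    qed
    have ev: "eventually (\<lambda>k. 0 < g (r0 *\<^sub>R Y k)) sequentially"
      using gl[of r0] r0(2) by (rule order_tendstoD(1))
    define d where "d = (1 - g (r0 *\<^sub>R y)) / r0"
    have "(\<lambda>k. (1 - g (r0 *\<^sub>R Y k)) / r0) \<longlonglongrightarrow> d"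
      unfolding d_def using r0 by (intro tendsto_intros gl) auto
    moreover have "eventually (\<lambda>k. (1 - g (r0 *\<^sub>R Y k)) / r0 = c k) sequentially"
      using ev
    proof eventually_elim
      case (elim k)
      then have "g (r0 *\<^sub>R Y k) = 1 - c k * r0" using c[of r0 k] r0 by auto
      then show ?case using r0 by simp
    qed
    ultimately have cl: "c \<longlonglongrightarrow> d" by (rule Lim_transform_eventually)
    have "g (r *\<^sub>R y) = max 0 (1 - d * r)" if "0 \<le> r" for r
    proof (rule LIMSEQ_unique[OF gl])
      have "(\<lambda>k. max 0 (1 - c k * r)) \<longlonglongrightarrow> max 0 (1 - d * r)" by (intro tendsto_intros cl)
      then show "(\<lambda>k. g (r *\<^sub>R Y k)) \<longlonglongrightarrow> max 0 (1 - d * r)" using c[OF that] by simp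
    qed
    then show ?thesis unfolding P_def by blast
  qed
  have cl: "closed {y. P y}"
    unfolding closed_sequential_limits using closedP by auto
  \<comment> \<open>The points on nonlinear rays within \<open>t < g\<close> form an open null set.
    The strict inequality is what makes it open.\<close>
  have "{y. \<not> P y} \<inter> {y. t < g y} - {0} = {}"
  proof (rule open_AE_notin_imp_empty)
    have "open {y. \<not> P y}" using open_Compl[OF cl] by (simp only: Collect_neg_eq)
    moreover have "open {y. t < g y}" by (intro open_Collect_less cont continuous_intros)
    ultimately show "open ({y. \<not> P y} \<inter> {y. t < g y} - {0})" by (intro open_Diff open_Int) auto
    show "AE x in lborel. x \<notin> {y. \<not> P y} \<inter> {y. t < g y} - {0}"
      using ae by eventually_elim (use rad(1)[of _ 1] in auto)
  qed
  then have small: "P y" if "t < g y" "y \<noteq> 0" for y using that by blast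
  show "\<exists>c. \<forall>r\<ge>0. g (r *\<^sub>R y) = max 0 (1 - c * r)"
  proof (cases "y = 0")
    case True then show ?thesis using g0 by (intro exI[of _ 0]) simp
  next
    case False
    \<comment> \<open>Any level strictly between \<open>t\<close> and 1 serves: the point of the ray
      at this level lies in the open set just treated, and \<open>P\<close> carries over to positive
      multiples.\<close>
    define s where "s = (t + 1) / 2"
    have s: "0 < s" "s < 1" "t < s" using t by (auto simp: s_def)
    have "P (radius s y *\<^sub>R y)"
      using small[of "radius s y *\<^sub>R y"] radius_value[OF s(1,2) False] radius_pos[OF s(1,2) False] s False by simp
    from scale[OF this, of "1 / radius s y"] show ?thesis
      using radius_pos[OF s(1,2) False] by (simp add: P_def)
  qed
qed

end

subsection \<open>The covariogram of two convex bodies\<close>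

lemma mem_reflect_translate: "x \<in> reflect_translate z L \<longleftrightarrow> z - x \<in> L"
  unfolding reflect_translate_def by (auto simp: image_iff intro!: bexI[of _ "z - x"])

lemma minkowski_sum_iff: "z \<in> minkowski_sum K L \<longleftrightarrow> K \<inter> reflect_translate z L \<noteq> {}"
proof
  assume "z \<in> minkowski_sum K L"
  then obtain x y where "x \<in> K" "y \<in> L" "z = x + y" by (auto simp: minkowski_sum_def)
  then have "x \<in> K \<inter> reflect_translate z L" by (simp add: mem_reflect_translate)
  then show "K \<inter> reflect_translate z L \<noteq> {}" by blast
next
  assume "K \<inter> reflect_translate z L \<noteq> {}"
  then obtain x where "x \<in> K" "z - x \<in> L" by (auto simp: mem_reflect_translate)
  then show "z \<in> minkowski_sum K L" unfolding minkowski_sum_def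
    by (intro CollectI exI[of _ x] exI[of _ "z - x"]) simp
qed

lemma compact_reflect_translate: "compact L \<Longrightarrow> compact (reflect_translate z L)"
  unfolding reflect_translate_def by (intro compact_continuous_image continuous_intros)

lemma measure_pos_interior:
  fixes S :: "'a::euclidean_space set"
  assumes "S \<in> lmeasurable" "interior S \<noteq> {}"
  shows "0 < measure lebesgue S"
proof -
  have "\<not> negligible S" using negligible_subset[OF _ interior_subset] open_not_negligible[OF open_interior assms(2)] by blast
  then have "measure lebesgue S \<noteq> 0" using assms(1) by (simp add: negligible_iff_measure0)
  then show ?thesis using measure_nonneg[of lebesgue S] by linarith
qed

text \<open>The part of the interior of \<open>B\<close> outside \<open>A\<close> is open and null,
  hence empty, and a convex body is the closure of its interior.\<close>

lemma closed_body_subset_of_measure_ge: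
  fixes A B :: "'a::euclidean_space set"
  assumes A: "compact A" and B: "compact B" "convex B" "interior B \<noteq> {}"
    and sub: "A \<subseteq> B" and le: "measure lebesgue B \<le> measure lebesgue A"
  shows "A = B"
proof -
  have "measure lebesgue (B - A) = measure lebesgue B - measure lebesgue A"
    using A B sub by (intro measurable_measure_Diff) (auto intro: lmeasurable_compact fmeasurableD)
  then have "measure lebesgue (B - A) = 0" using le measure_nonneg[of lebesgue "B - A"] by linarith
  moreover have "B - A \<in> lmeasurable" using A B by (intro fmeasurable_Diff) (auto intro: lmeasurable_compact fmeasurableD)
  ultimately have "negligible (B - A)" by (simp add: negligible_iff_measure0)
  moreover have "interior B - A \<subseteq> B - A" using interior_subset by auto
  ultimately have "negligible (interior B - A)" by (rule negligible_subset)
  then have "interior B - A = {}" using open_not_negligible[of "interior B - A"] A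
    by (meson compact_imp_closed open_Diff open_interior)
  then have "closure (interior B) \<subseteq> A" using A by (intro closure_minimal) (auto intro: compact_imp_closed)
  moreover have "closure (interior B) = B"
    using convex_closure_interior[OF B(2,3)] closure_closed[OF compact_imp_closed[OF B(1)]] by simp
  ultimately show ?thesis using sub by blast
qed

locale convex_body_pair =
  fixes K L :: "'a::euclidean_space set"
  assumes K: "convex_body K" and L: "convex_body L"
begin

text \<open>This is the convolution of the indicator functions of \<open>K\<close> and
  \<open>L\<close>, the source of its continuity and of its total mass
  \<open>|K||L|\<close>.\<close>

definition cov :: "'a \<Rightarrow> real" where
  "cov z = vol (K \<inter> reflect_translate z L)"

lemma KL: "compact K" "convex K" "interior K \<noteq> {}" "compact L" "convex L" "interior L \<noteq> {}"
  using K L by (auto simp: convex_body_def)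

lemma KL_borel [measurable]: "K \<in> sets borel" "L \<in> sets borel"
  using KL by (auto intro: borel_compact)

lemma compact_slice: "compact (K \<inter> reflect_translate z L)"
  using KL by (intro compact_Int compact_reflect_translate)

lemma cov_nonneg: "0 \<le> cov z" by (simp add: cov_def)

lemma vol_pos: "0 < vol K" "0 < vol L"
  using measure_pos_interior[OF lmeasurable_compact] KL by blast+

lemma cov_eq_nn_integral: "ennreal (cov z) = (\<integral>\<^sup>+x. indicator K x * indicator L (z - x) \<partial>lborel)"
proof -
  have "ennreal (cov z) = emeasure lborel (K \<inter> reflect_translate z L)"
    unfolding cov_def using compact_slice
    by (intro emeasure_lborel_eq_measure_lebesgue[symmetric] lmeasurable_compact borel_compact)
  also have "\<dots> = (\<integral>\<^sup>+x. indicator (K \<inter> reflect_translate z L) x \<partial>lborel)"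
    using compact_slice[of z] by (simp add: borel_compact)
  also have "\<dots> = (\<integral>\<^sup>+x. indicator K x * indicator L (z - x) \<partial>lborel)"
    by (rule nn_integral_cong) (auto simp: mem_reflect_translate split: split_indicator)
  finally show ?thesis .
qed

lemma cov_eq_integral: "cov z = (\<integral>x. indicator K x * indicator L (z - x) \<partial>lborel)"
proof -
  have "ennreal (cov z) = (\<integral>\<^sup>+x. ennreal (indicator K x * indicator L (z - x)) \<partial>lborel)"
    unfolding cov_eq_nn_integral by (rule nn_integral_cong) (auto split: split_indicator)
  then have "enn2real (\<integral>\<^sup>+x. ennreal (indicator K x * indicator L (z - x)) \<partial>lborel) = cov z"
    using enn2real_ennreal[OF cov_nonneg[of z]] by simp
  then show ?thesis by (subst integral_eq_nn_integral) auto
qed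

lemma AE_not_reflected_frontier:
  "AE x in lborel. z - x \<notin> frontier L"
proof -
  have "negligible (frontier L)" using KL by (intro negligible_convex_frontier)
  then have "frontier L \<in> null_sets lebesgue" by (simp add: negligible_iff_null_sets)
  then have e: "emeasure lebesgue (frontier L) = 0" by auto
  have cl: "closed ((\<lambda>x. (-1) *\<^sub>R x + z) ` frontier L)"
    using KL by (intro compact_imp_closed compact_continuous_image continuous_intros) (simp add: compact_frontier)
  have "emeasure lebesgue ((\<lambda>x. (-1) *\<^sub>R x + z) ` frontier L) = 0"
    using emeasure_lebesgue_affine[of "-1" z "frontier L"] e by simp
  then have "(\<lambda>x. (-1) *\<^sub>R x + z) ` frontier L \<in> null_sets lborel"
    using cl by (intro null_setsI) (auto simp: borel_closed)
  then have "AE x in lborel. x \<notin> (\<lambda>x. (-1) *\<^sub>R x + z) ` frontier L" by (rule AE_not_in)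
  then show ?thesis
  proof eventually_elim
    case (elim x)
    show ?case
    proof
      assume "z - x \<in> frontier L"
      then have "(-1) *\<^sub>R (z - x) + z \<in> (\<lambda>x. (-1) *\<^sub>R x + z) ` frontier L" by (rule imageI)
      then show False using elim by simp
    qed
  qed
qed

text \<open>Dominated convergence applies because the indicator of \<open>L\<close> is locally
  constant off the frontier of \<open>L\<close>, and a convex set has a null frontier.\<close>

lemma continuous_cov: "continuous_on UNIV cov"
  unfolding continuous_on_sequentially
proof (intro ballI allI impI)
  fix a and X :: "nat \<Rightarrow> 'a"
  assume "(\<forall>n. X n \<in> UNIV) \<and> X \<longlonglongrightarrow> a"
  then have X: "X \<longlonglongrightarrow> a" by simp
  show "(cov \<circ> X) \<longlonglongrightarrow> cov a"
    unfolding comp_def cov_eq_integral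
  proof (rule integral_dominated_convergence[where w="indicator K"])
    show "integrable lborel (indicator K :: 'a \<Rightarrow> real)"
      using KL by (intro integrable_real_indicator) (auto simp: emeasure_lborel_eq_measure_lebesgue lmeasurable_compact)
    show "AE x in lborel. (\<lambda>i. indicator K x * indicator L (X i - x)) \<longlonglongrightarrow> (indicator K x * indicator L (a - x) :: real)"
      using AE_not_reflected_frontier[of a]
    proof eventually_elim
      case (elim x)
      have lim: "(\<lambda>i. X i - x) \<longlonglongrightarrow> a - x" by (intro tendsto_intros X)
      have "eventually (\<lambda>i. indicator L (X i - x) = (indicator L (a - x) :: real)) sequentially"
      proof (cases "a - x \<in> interior L")
        case True
        then have "eventually (\<lambda>i. X i - x \<in> interior L) sequentially"
          by (rule topological_tendstoD[OF lim open_interior])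
        then show ?thesis by eventually_elim (use True interior_subset in \<open>auto split: split_indicator\<close>)
      next
        case False
        then have "a - x \<notin> L" using elim KL closure_subset unfolding frontier_def by blast
        then have "a - x \<in> - L" by simp
        then have "eventually (\<lambda>i. X i - x \<in> - L) sequentially"
          by (rule topological_tendstoD[OF lim open_Compl[OF compact_imp_closed[OF KL(4)]]])
        then show ?thesis by eventually_elim (use \<open>a - x \<notin> L\<close> in auto)
      qed
      then have "eventually (\<lambda>i. indicator K x * indicator L (X i - x) = (indicator K x * indicator L (a - x) :: real)) sequentially"
        by eventually_elim simp
      then show ?case by (rule tendsto_eventually)
    qed
  qed (auto split: split_indicator)
qed

lemma cov_outside: "z \<notin> minkowski_sum K L \<Longrightarrow> cov z = 0"
  by (simp add: cov_def minkowski_sum_iff)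

lemma compact_minkowski: "compact (minkowski_sum K L)"
  unfolding minkowski_sum_def using KL by (intro compact_sums)

lemma minkowski_nonempty: "minkowski_sum K L \<noteq> {}"
  using KL interior_subset unfolding minkowski_sum_def by blast

lemma cov_pos_ex: "\<exists>z. 0 < cov z"
proof -
  obtain a b where ab: "a \<in> interior K" "b \<in> interior L" using KL by blast
  have "open (reflect_translate (a + b) (interior L))"
  proof -
    have "reflect_translate (a + b) (interior L) = (\<lambda>x. a + b - x) -` interior L"
      by (auto simp: mem_reflect_translate)
    then show ?thesis by (simp add: open_vimage continuous_intros)
  qed
  moreover have "reflect_translate (a + b) (interior L) \<subseteq> reflect_translate (a + b) L"
    using interior_subset[of L] by (auto simp: mem_reflect_translate)
  ultimately have "interior K \<inter> reflect_translate (a + b) (interior L) \<subseteq> interior (K \<inter> reflect_translate (a + b) L)"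
    using interior_subset[of K] by (intro interior_maximal) auto
  moreover have "a \<in> interior K \<inter> reflect_translate (a + b) (interior L)"
    using ab by (simp add: mem_reflect_translate)
  ultimately have "interior (K \<inter> reflect_translate (a + b) L) \<noteq> {}" by blast
  then have "0 < cov (a + b)" unfolding cov_def
    by (intro measure_pos_interior lmeasurable_compact compact_slice)
  then show ?thesis by blast
qed

lemma cov_attains_max:
  obtains z where "Mvol K L = cov z" "\<And>y. cov y \<le> cov z" "0 < cov z" "z \<in> minkowski_sum K L"
proof -
  obtain z where z: "z \<in> minkowski_sum K L" "\<And>y. y \<in> minkowski_sum K L \<Longrightarrow> cov y \<le> cov z"
    using continuous_attains_sup[OF compact_minkowski minkowski_nonempty continuous_on_subset[OF continuous_cov]] by auto
  have max: "cov y \<le> cov z" for y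
    using z(2)[of y] cov_outside[of y] cov_nonneg[of z] by (cases "y \<in> minkowski_sum K L") auto
  have "Mvol K L = cov z"
    unfolding Mvol_def cov_def[symmetric] using max by (intro cSup_eq_maximum) auto
  moreover have "0 < cov z" using cov_pos_ex max by (meson less_le_trans)
  ultimately show ?thesis using that max z(1) by blast
qed

lemma cov_le: "cov z \<le> vol K" "cov z \<le> vol L"
proof -
  show "cov z \<le> vol K" unfolding cov_def
    using compact_slice KL by (intro measure_mono_fmeasurable) (auto intro: lmeasurable_compact fmeasurableD)
  have "cov z \<le> vol (reflect_translate z L)" unfolding cov_def
    using compact_slice KL by (intro measure_mono_fmeasurable) (auto intro: lmeasurable_compact fmeasurableD compact_reflect_translate)
  also have "reflect_translate z L = (\<lambda>x. (-1) *\<^sub>R x + z) ` L" by (auto simp: reflect_translate_def)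
  also have "vol \<dots> = vol L" using measure_lebesgue_affine[of "-1" z L] by simp
  finally show "cov z \<le> vol L" .
qed

lemma nn_integral_cov: "(\<integral>\<^sup>+z. ennreal (cov z) \<partial>lborel) = ennreal (vol K * vol L)"
proof -
  have vK: "emeasure lborel K = ennreal (vol K)" and vL: "emeasure lborel L = ennreal (vol L)"
    using emeasure_lborel_eq_measure_lebesgue[OF borel_compact lmeasurable_compact] KL by blast+
  have "(\<integral>\<^sup>+z. ennreal (cov z) \<partial>lborel) = (\<integral>\<^sup>+z. (\<integral>\<^sup>+x. indicator K x * indicator L (z - x) \<partial>lborel) \<partial>lborel)"
    by (simp add: cov_eq_nn_integral)
  also have "\<dots> = (\<integral>\<^sup>+x. (\<integral>\<^sup>+z. indicator K x * indicator L (z - x) \<partial>lborel) \<partial>lborel)"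
    by (rule lborel_pair.Fubini') measurable
  also have "\<dots> = (\<integral>\<^sup>+x. indicator K x * ennreal (vol L) \<partial>lborel)"
  proof (rule nn_integral_cong)
    fix x
    have "(\<integral>\<^sup>+z. indicator L (z - x) \<partial>lborel) = (\<integral>\<^sup>+z. indicator L (z - x) \<partial>distr lborel borel ((+) x))"
      by (subst lborel_distr_plus) simp
    also have "\<dots> = (\<integral>\<^sup>+z. indicator L z \<partial>lborel)" by (subst nn_integral_distr) auto
    also have "\<dots> = ennreal (vol L)" by (simp add: vL)
    finally show "(\<integral>\<^sup>+z. indicator K x * indicator L (z - x) \<partial>lborel) = indicator K x * ennreal (vol L)"
      by (subst nn_integral_cmult) auto
  qed
  also have "\<dots> = ennreal (vol K) * ennreal (vol L)" by (subst nn_integral_multc) (auto simp: vK)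
  finally show ?thesis by (simp add: ennreal_mult)
qed

text \<open>By convexity of \<open>K\<close> and \<open>L\<close>, the combination of the slices at
  \<open>x\<close> and \<open>y\<close> lies in the slice at the combined point. Membership of
  \<open>x\<close> and \<open>y\<close> in the Minkowski sum makes both slices nonempty, as
  Brunn-Minkowski requires.\<close>

lemma cov_concave:
  assumes x: "x \<in> minkowski_sum K L" and y: "y \<in> minkowski_sum K L" and u: "0 \<le> u" "u \<le> 1"
  defines "e \<equiv> 1 / real DIM('a)"
  shows "(1 - u) * cov x powr e + u * cov y powr e \<le> cov ((1 - u) *\<^sub>R x + u *\<^sub>R y) powr e"
proof -
  let ?S = "\<lambda>z. K \<inter> reflect_translate z L"
  let ?A = "(\<lambda>p. (1 - u) *\<^sub>R p) ` ?S x" and ?B = "(\<lambda>p. u *\<^sub>R p) ` ?S y"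
  let ?C = "{p + q | p q. p \<in> ?A \<and> q \<in> ?B}"
  have cA: "compact ?A" and cB: "compact ?B" by (intro compact_scaling compact_slice)+
  have "?C \<subseteq> ?S ((1 - u) *\<^sub>R x + u *\<^sub>R y)"
  proof clarify
    fix p q assume "p \<in> K" "p \<in> reflect_translate x L" "q \<in> K" "q \<in> reflect_translate y L"
    then have pq: "p \<in> K" "x - p \<in> L" "q \<in> K" "y - q \<in> L" by (auto simp: mem_reflect_translate)
    have "(1 - u) *\<^sub>R p + u *\<^sub>R q \<in> K" using convexD_alt[OF KL(2) pq(1,3) u] .
    moreover have "(1 - u) *\<^sub>R (x - p) + u *\<^sub>R (y - q) \<in> L" using convexD_alt[OF KL(5) pq(2,4) u] .
    ultimately show "(1 - u) *\<^sub>R p + u *\<^sub>R q \<in> ?S ((1 - u) *\<^sub>R x + u *\<^sub>R y)"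
      by (simp add: mem_reflect_translate algebra_simps)
  qed
  then have "vol ?C \<le> cov ((1 - u) *\<^sub>R x + u *\<^sub>R y)" unfolding cov_def
    using compact_slice compact_sums[OF cA cB]
    by (intro measure_mono_fmeasurable) (auto intro: lmeasurable_compact fmeasurableD)
  then have "vol ?C powr e \<le> cov ((1 - u) *\<^sub>R x + u *\<^sub>R y) powr e" by (intro powr_mono2) (auto simp: e_def)
  moreover have "vol ?A powr e + vol ?B powr e \<le> vol ?C powr e"
    unfolding e_def using x y cA cB by (intro brunn_minkowski_compact) (auto simp: minkowski_sum_iff)
  moreover have "vol ?A powr e = (1 - u) * cov x powr e" "vol ?B powr e = u * cov y powr e"
    unfolding measure_lebesgue_scaleR cov_def e_def using u
    by (simp_all add: powr_mult power_powr_inverse_nat)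
  ultimately show ?thesis by linarith
qed

end

section \<open>Volume bounds for convolution bodies\<close>

context convex_body_pair
begin

lemma conv_body_iff: "z \<in> conv_body K \<theta> L \<longleftrightarrow> z \<in> minkowski_sum K L \<and> \<theta> * Mvol K L \<le> cov z"
  by (simp add: conv_body_def cov_def)

lemma compact_conv_body: "compact (conv_body K \<theta> L)"
proof -
  have "conv_body K \<theta> L = minkowski_sum K L \<inter> {z. \<theta> * Mvol K L \<le> cov z}" by (auto simp: conv_body_iff)
  moreover have "closed {z. \<theta> * Mvol K L \<le> cov z}"
    by (intro closed_Collect_le continuous_intros continuous_cov)
  ultimately show ?thesis using compact_minkowski by (simp add: compact_Int_closed)
qed

lemma convex_minkowski: "convex (minkowski_sum K L)"
proof -
  have "minkowski_sum K L = (\<Union>x\<in>K. \<Union>y\<in>L. {x + y})" by (auto simp: minkowski_sum_def)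
  then show ?thesis using convex_sums[OF KL(2,5)] by simp
qed

context
  fixes z0 :: 'a
  assumes z0: "Mvol K L = cov z0" "\<And>y. cov y \<le> cov z0" "0 < cov z0" "z0 \<in> minkowski_sum K L"
begin

definition profile :: "'a \<Rightarrow> real" where
  "profile x = (cov (z0 + x) / cov z0) powr (1 / real DIM('a))"

lemma profile_power: "profile x ^ DIM('a) = cov (z0 + x) / cov z0"
  unfolding profile_def using z0(3) cov_nonneg by (intro powr_inverse_nat_power) auto

lemma concave_profile_profile: "concave_profile profile"
proof
  show "continuous_on UNIV profile"
    unfolding profile_def using z0(3) cov_nonneg
    by (intro continuous_on_powr' continuous_intros continuous_on_compose2[OF continuous_cov]) auto
  fix x y :: 'a and u :: real
  show "0 \<le> profile x" by (simp add: profile_def)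
  show "profile x \<le> 1"
    using power_le_one_iff[of "profile x" "DIM('a)"] profile_power[of x] z0(2)[of "z0 + x"] z0(3)
    by (simp add: profile_def)
  show "profile 0 = 1" using z0(3) by (simp add: profile_def)
  have pos: "z0 + x \<in> minkowski_sum K L" if "0 < profile x" for x
    using that cov_outside[of "z0 + x"] by (auto simp: profile_def)
  show "(1 - u) * profile x + u * profile y \<le> profile ((1 - u) *\<^sub>R x + u *\<^sub>R y)"
    if "0 < profile x" "0 < profile y" "0 \<le> u" "u \<le> 1"
  proof -
    let ?e = "1 / real DIM('a)"
    have eq: "(1 - u) *\<^sub>R (z0 + x) + u *\<^sub>R (z0 + y) = z0 + ((1 - u) *\<^sub>R x + u *\<^sub>R y)"
      by (simp add: algebra_simps)
    have "((1 - u) * cov (z0 + x) powr ?e + u * cov (z0 + y) powr ?e) / cov z0 powr ?e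
        \<le> cov (z0 + ((1 - u) *\<^sub>R x + u *\<^sub>R y)) powr ?e / cov z0 powr ?e"
      using cov_concave[OF pos[OF that(1)] pos[OF that(2)] that(3,4)] unfolding eq
      by (rule divide_right_mono) simp
    then show ?thesis unfolding profile_def using z0(3) cov_nonneg
      by (simp add: powr_divide add_divide_distrib)
  qed
  have "bounded ((\<lambda>z. z - z0) ` minkowski_sum K L)"
    by (rule bounded_translation_minus[OF compact_imp_bounded[OF compact_minkowski]])
  moreover have "{x. 0 < profile x} \<subseteq> (\<lambda>z. z - z0) ` minkowski_sum K L"
  proof
    fix x assume "x \<in> {x. 0 < profile x}"
    then have "z0 + x \<in> minkowski_sum K L" using pos by simp
    then show "x \<in> (\<lambda>z. z - z0) ` minkowski_sum K L" by (rule rev_image_eqI) simp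
  qed
  ultimately show "bounded {x. 0 < profile x}" by (rule bounded_subset)
qed

interpretation concave_profile profile by (rule concave_profile_profile)

text \<open>A positive level keeps \<open>z\<close> in the Minkowski sum, since the covariogram
  vanishes outside it. At \<open>\<theta> = 0\<close> the level set would be the whole space; that
  value is reached by interpolation instead.\<close>

lemma conv_body_eq_level_set:
  assumes "0 < \<theta>"
  shows "conv_body K \<theta> L = (+) z0 ` {x. \<theta> powr (1 / real DIM('a)) \<le> profile x}"
proof -
  have iff: "z \<in> conv_body K \<theta> L \<longleftrightarrow> \<theta> powr (1 / real DIM('a)) \<le> profile (z - z0)" for z
  proof -
    have "z \<in> conv_body K \<theta> L \<longleftrightarrow> \<theta> * cov z0 \<le> cov z"
      using cov_outside[of z] z0(1) mult_pos_pos[OF assms z0(3)]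
      by (cases "z \<in> minkowski_sum K L") (auto simp: conv_body_iff)
    also have "\<dots> \<longleftrightarrow> \<theta> \<le> cov z / cov z0" using z0(3) by (simp add: field_simps)
    also have "\<dots> \<longleftrightarrow> \<theta> powr (1 / real DIM('a)) \<le> (cov z / cov z0) powr (1 / real DIM('a))"
    proof
      assume "\<theta> \<le> cov z / cov z0"
      then show "\<theta> powr (1 / real DIM('a)) \<le> (cov z / cov z0) powr (1 / real DIM('a))"
        using assms by (intro powr_mono2) auto
    next
      assume le: "\<theta> powr (1 / real DIM('a)) \<le> (cov z / cov z0) powr (1 / real DIM('a))"
      show "\<theta> \<le> cov z / cov z0"
      proof (rule ccontr)
        assume "\<not> \<theta> \<le> cov z / cov z0"
        then have "(cov z / cov z0) powr (1 / real DIM('a)) < \<theta> powr (1 / real DIM('a))"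
          using z0(3) cov_nonneg by (intro powr_less_mono2) auto
        then show False using le by simp
      qed
    qed
    finally show ?thesis by (simp add: profile_def)
  qed
  show ?thesis
  proof (intro set_eqI iffI)
    fix z assume "z \<in> conv_body K \<theta> L"
    then have "z = z0 + (z - z0)" "z - z0 \<in> {x. \<theta> powr (1 / real DIM('a)) \<le> profile x}" by (auto simp: iff)
    then show "z \<in> (+) z0 ` {x. \<theta> powr (1 / real DIM('a)) \<le> profile x}" by blast
  qed (auto simp: iff)
qed

lemma nn_integral_profile:
  "(\<integral>\<^sup>+x. ennreal (profile x ^ DIM('a)) \<partial>lborel) = ennreal (vol K * vol L / cov z0)"
proof -
  have [measurable]: "cov \<in> borel_measurable borel"
    using continuous_cov by (rule borel_measurable_continuous_onI)
  have "(\<integral>\<^sup>+x. ennreal (profile x ^ DIM('a)) \<partial>lborel) = (\<integral>\<^sup>+x. ennreal (1 / cov z0) * ennreal (cov (z0 + x)) \<partial>lborel)"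
    using z0(3) cov_nonneg by (intro nn_integral_cong) (simp add: profile_power ennreal_mult[symmetric])
  also have "\<dots> = ennreal (1 / cov z0) * (\<integral>\<^sup>+x. ennreal (cov (z0 + x)) \<partial>lborel)"
    by (rule nn_integral_cmult) simp
  also have "(\<integral>\<^sup>+x. ennreal (cov (z0 + x)) \<partial>lborel) = (\<integral>\<^sup>+x. ennreal (cov x) \<partial>distr lborel borel ((+) z0))"
    by (subst nn_integral_distr) auto
  also have "\<dots> = ennreal (vol K * vol L)" by (simp only: lborel_distr_plus nn_integral_cov)
  also have "ennreal (1 / cov z0) * ennreal (vol K * vol L) = ennreal (vol K * vol L / cov z0)"
    using z0(3) by (subst ennreal_mult[symmetric]) auto
  finally show ?thesis .
qed

lemma vol_conv_body_bound:
  assumes t: "3/4 \<le> t" "t < 1"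
  defines "n \<equiv> DIM('a)"
  defines "b \<equiv> real ((2 * n) choose n)"
  shows "b * (1 - t) ^ n * (vol K * vol L / cov z0) \<le> vol (conv_body K (t ^ n) L)"
    and "b * (1 - t) ^ n * (vol K * vol L / cov z0) = vol (conv_body K (t ^ n) L) \<Longrightarrow>
      \<exists>c. \<forall>r\<ge>0. cov (z0 + r *\<^sub>R y) = cov z0 * max 0 (1 - c * r) ^ n"
proof -
  have "conv_body K (t ^ n) L = (+) z0 ` {x. t \<le> profile x}"
    using conv_body_eq_level_set[of "t ^ n"] t by (simp add: n_def power_powr_inverse_nat)
  then have V: "vol (conv_body K (t ^ n) L) = vol {x. t \<le> profile x}" by (simp add: measure_translation)
  have b: "0 < b * (1 - t) ^ n" using t by (simp add: b_def)
  note bb = ball_body_bound[OF t, folded n_def, unfolded nn_integral_profile[folded n_def], folded b_def V]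
  have "vol K * vol L / cov z0 \<le> 1 / (b * (1 - t) ^ n) * vol (conv_body K (t ^ n) L)"
    using bb(1) b z0(3) by (subst (asm) ennreal_le_iff) auto
  then show "b * (1 - t) ^ n * (vol K * vol L / cov z0) \<le> vol (conv_body K (t ^ n) L)"
    using b by (simp add: field_simps)
  assume E: "b * (1 - t) ^ n * (vol K * vol L / cov z0) = vol (conv_body K (t ^ n) L)"
  have "vol K * vol L / cov z0 = 1 / (b * (1 - t) ^ n) * vol (conv_body K (t ^ n) L)"
  proof -
    have "1 / k * (k * x) = x" if "0 < k" for k x :: real using that by simp
    from this[OF b] show ?thesis unfolding E[symmetric] by simp
  qed
  then obtain c where "\<forall>r\<ge>0. profile (r *\<^sub>R y) = max 0 (1 - c * r)" using bb(2)[of y] by auto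
  then have "\<forall>r\<ge>0. cov (z0 + r *\<^sub>R y) = cov z0 * max 0 (1 - c * r) ^ n"
  proof -
    have "cov (z0 + x) = cov z0 * profile x ^ n" for x using profile_power[of x] z0(3) by (simp add: n_def)
    then show ?thesis using \<open>\<forall>r\<ge>0. profile (r *\<^sub>R y) = max 0 (1 - c * r)\<close> by simp
  qed
  then show "\<exists>c. \<forall>r\<ge>0. cov (z0 + r *\<^sub>R y) = cov z0 * max 0 (1 - c * r) ^ n" by blast
qed

text \<open>The mean of the two roots is at most the larger one, whose \<open>n\<close>-th power is
  at most \<open>|K||L| / M\<close> because \<open>M\<close> is at most both volumes. Equality in
  the first comparison makes the volumes equal, equality in the second makes them equal to
  \<open>M\<close>.\<close>

lemma vol_product_ge:
  defines "e \<equiv> 1 / real DIM('a)"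
  shows "((vol K powr e + vol L powr e) / 2) ^ DIM('a) \<le> vol K * vol L / cov z0"
    and "((vol K powr e + vol L powr e) / 2) ^ DIM('a) = vol K * vol L / cov z0 \<Longrightarrow>
      vol K = cov z0 \<and> vol L = cov z0"
proof -
  let ?n = "DIM('a)"
  define a where "a = vol K powr e"
  define c where "c = vol L powr e"
  have ac: "0 < a" "0 < c" using vol_pos by (simp_all add: a_def c_def)
  have an: "a ^ ?n = vol K" and cn: "c ^ ?n = vol L"
    unfolding a_def c_def e_def by (simp_all add: powr_inverse_nat_power)
  have M: "cov z0 \<le> vol K" "cov z0 \<le> vol L" by (rule cov_le)+
  have 1: "((a + c) / 2) ^ ?n \<le> max a c ^ ?n" using ac by (intro power_mono) auto
  have 2: "max a c ^ ?n \<le> vol K * vol L / cov z0"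
  proof -
    have "vol K \<le> vol K * (vol L / cov z0)" "vol L \<le> vol L * (vol K / cov z0)"
      using M z0(3) vol_pos by (auto intro!: mult_le_cancel_left1[THEN iffD2] simp: field_simps)
    then show ?thesis by (auto simp: max_def an cn mult.commute)
  qed
  show "((vol K powr e + vol L powr e) / 2) ^ ?n \<le> vol K * vol L / cov z0"
    using 1 2 unfolding a_def c_def by linarith
  assume "((vol K powr e + vol L powr e) / 2) ^ ?n = vol K * vol L / cov z0"
  then have eq: "((a + c) / 2) ^ ?n = max a c ^ ?n" and eq2: "max a c ^ ?n = vol K * vol L / cov z0"
    using 1 2 unfolding a_def c_def by linarith+
  have "(a + c) / 2 = max a c" using eq ac by (subst (asm) power_eq_iff_eq_base) auto
  then have "a = c" by (auto simp: max_def split: if_splits)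
  then have "vol K = vol L" using an cn by simp
  then have "vol L * cov z0 = vol L * vol L" using eq2 cn \<open>a = c\<close> z0(3) by (simp add: field_simps)
  then show "vol K = cov z0 \<and> vol L = cov z0" using vol_pos \<open>vol K = vol L\<close> by simp
qed

lemma conv_body_inequality:
  assumes t: "3/4 \<le> t" "t < 1"
  defines "n \<equiv> DIM('a)"
  defines "B \<equiv> real ((2 * n) choose n) powr (1 / real n)"
    and "s \<equiv> vol K powr (1 / real n) + vol L powr (1 / real n)"
  shows "1/2 * B * (1 - t) * s \<le> vol (conv_body K (t ^ n) L) powr (1 / real n)"
    and "vol (conv_body K (t ^ n) L) powr (1 / real n) = 1/2 * B * (1 - t) * s \<Longrightarrow>
      vol K = cov z0 \<and> vol L = cov z0 \<and> (\<forall>y. \<exists>c. \<forall>r\<ge>0. cov (z0 + r *\<^sub>R y) = cov z0 * max 0 (1 - c * r) ^ n)"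
proof -
  let ?b = "real ((2 * n) choose n)" and ?V = "vol (conv_body K (t ^ n) L)"
  have n: "0 < n" by (simp add: n_def)
  have s: "0 \<le> s" by (simp add: s_def)
  have B: "0 < B" "B ^ n = ?b" using n by (simp_all add: B_def powr_inverse_nat_power)
  have X: "(1/2 * B * (1 - t) * s) ^ n = ?b * (1 - t) ^ n * (s / 2) ^ n"
    using B by (simp add: power_mult_distrib power_divide)
  have b0: "0 < ?b * (1 - t) ^ n" using t by simp
  have v1: "(s / 2) ^ n \<le> vol K * vol L / cov z0"
    unfolding s_def n_def by (rule vol_product_ge(1))
  have v2: "?b * (1 - t) ^ n * (vol K * vol L / cov z0) \<le> ?V"
    unfolding n_def by (rule vol_conv_body_bound(1)[OF t])
  have v3: "?b * (1 - t) ^ n * (s / 2) ^ n \<le> ?b * (1 - t) ^ n * (vol K * vol L / cov z0)"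
    using v1 b0 by (intro mult_left_mono) auto
  have nn: "0 \<le> 1/2 * B * (1 - t) * s" using B s t by simp
  have "((1/2 * B * (1 - t) * s) ^ n) powr (1 / real n) \<le> ?V powr (1 / real n)"
  proof (rule powr_mono2)
    show "0 \<le> (1/2 * B * (1 - t) * s) ^ n" using nn by simp
    show "(1/2 * B * (1 - t) * s) ^ n \<le> ?V" using v2 v3 X by linarith
  qed simp
  then show "1/2 * B * (1 - t) * s \<le> ?V powr (1 / real n)"
    using nn n by (simp only: power_powr_inverse_nat)
  assume "?V powr (1 / real n) = 1/2 * B * (1 - t) * s"
  then have "(?V powr (1 / real n)) ^ n = ?b * (1 - t) ^ n * (s / 2) ^ n" using X by (simp only:)
  then have V: "?V = ?b * (1 - t) ^ n * (s / 2) ^ n" using n by (simp add: powr_inverse_nat_power)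
  then have "?b * (1 - t) ^ n * (s / 2) ^ n = ?b * (1 - t) ^ n * (vol K * vol L / cov z0)" using v2 v3 by linarith
  then have "(s / 2) ^ n = vol K * vol L / cov z0" using b0 by (metis less_irrefl mult_cancel_left)
  then have "vol K = cov z0 \<and> vol L = cov z0"
    unfolding s_def n_def by (rule vol_product_ge(2))
  moreover have "?b * (1 - t) ^ n * (vol K * vol L / cov z0) = ?V" using V v2 v3 by linarith
  then have "\<forall>y. \<exists>c. \<forall>r\<ge>0. cov (z0 + r *\<^sub>R y) = cov z0 * max 0 (1 - c * r) ^ n"
    unfolding n_def using vol_conv_body_bound(2)[OF t] by blast
  ultimately show "vol K = cov z0 \<and> vol L = cov z0 \<and> (\<forall>y. \<exists>c. \<forall>r\<ge>0. cov (z0 + r *\<^sub>R y) = cov z0 * max 0 (1 - c * r) ^ n)"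
    by blast
qed

text \<open>Points of the Minkowski sum, at root level at least 0, are mixed with points at root
  level at least 3/4. The weight \<open>4/3 * t\<close> on the latter yields level \<open>t\<close>
  by concavity, and Brunn-Minkowski bounds the volume of the mixture.\<close>

lemma conv_body_interpolation:
  assumes t: "0 \<le> t" "t \<le> 3/4"
  defines "n \<equiv> DIM('a)"
  shows "(1 - 4/3 * t) * vol (minkowski_sum K L) powr (1 / real n) + 4/3 * t * vol (conv_body K ((3/4) ^ n) L) powr (1 / real n)
    \<le> vol (conv_body K (t ^ n) L) powr (1 / real n)"
proof -
  define u where "u = 4/3 * t"
  have u: "0 \<le> u" "u \<le> 1" using t by (auto simp: u_def)
  let ?e = "1 / real n" and ?A34 = "conv_body K ((3/4) ^ n) L"
  have n: "0 < n" by (simp add: n_def)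
  let ?A = "(\<lambda>p. (1 - u) *\<^sub>R p) ` minkowski_sum K L" and ?B = "(\<lambda>p. u *\<^sub>R p) ` ?A34"
  let ?C = "{p + q | p q. p \<in> ?A \<and> q \<in> ?B}"
  have cA: "compact ?A" and cB: "compact ?B" by (intro compact_scaling compact_minkowski compact_conv_body)+
  have "z0 \<in> ?A34"
  proof -
    have "(3/4::real) ^ n \<le> 1" by (intro power_le_one) auto
    then show ?thesis using z0 by (auto simp: conv_body_iff intro: mult_left_le_one_le)
  qed
  then have ne: "?A \<noteq> {}" "?B \<noteq> {}" using minkowski_nonempty by auto
  have "?C \<subseteq> conv_body K (t ^ n) L"
  proof clarify
    fix x y assume x: "x \<in> minkowski_sum K L" and y: "y \<in> ?A34"
    let ?z = "(1 - u) *\<^sub>R x + u *\<^sub>R y"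
    have ym: "y \<in> minkowski_sum K L" "(3/4) ^ n * cov z0 \<le> cov y" using y z0(1) by (auto simp: conv_body_iff)
    have zm: "?z \<in> minkowski_sum K L" using convexD_alt[OF convex_minkowski x ym(1) u] .
    have "u * (3/4 * cov z0 powr ?e) = u * ((3/4) ^ n * cov z0) powr ?e"
      using n z0(3) by (simp add: powr_mult power_powr_inverse_nat)
    also have "\<dots> \<le> u * cov y powr ?e"
      using ym z0(3) u by (intro mult_left_mono powr_mono2) auto
    also have "\<dots> \<le> (1 - u) * cov x powr ?e + u * cov y powr ?e" using u by simp
    also have "\<dots> \<le> cov ?z powr ?e" unfolding n_def by (rule cov_concave[OF x ym(1) u])
    finally have "t * cov z0 powr ?e \<le> cov ?z powr ?e" by (simp add: u_def)
    then have "(t * cov z0 powr ?e) ^ n \<le> (cov ?z powr ?e) ^ n" using t by (intro power_mono) auto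
    then have "t ^ n * cov z0 \<le> cov ?z"
      using n cov_nonneg by (simp add: power_mult_distrib powr_inverse_nat_power)
    then show "?z \<in> conv_body K (t ^ n) L" using zm z0(1) by (simp add: conv_body_iff)
  qed
  then have "vol ?C \<le> vol (conv_body K (t ^ n) L)"
    using compact_conv_body compact_sums[OF cA cB]
    by (intro measure_mono_fmeasurable) (auto intro: lmeasurable_compact fmeasurableD)
  then have le: "vol ?C powr ?e \<le> vol (conv_body K (t ^ n) L) powr ?e" by (intro powr_mono2) auto
  have eqs: "vol ?A powr ?e = (1 - u) * vol (minkowski_sum K L) powr ?e" "vol ?B powr ?e = u * vol ?A34 powr ?e"
    unfolding measure_lebesgue_scaleR n_def using u
    by (simp_all add: powr_mult power_powr_inverse_nat)
  have "vol ?A powr ?e + vol ?B powr ?e \<le> vol ?C powr ?e"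
    using brunn_minkowski_compact[OF cA ne(1) cB ne(2)] by (simp only: n_def)
  from order_trans[OF this le] show ?thesis unfolding eqs by (simp only: u_def)
qed

end

end

subsection \<open>Bodies whose translates intersect in homothets\<close>

lemma extreme_point_convex_combination:
  assumes x: "x extreme_point_of S" and ab: "a \<in> S" "b \<in> S" and u: "0 < u" "u < 1"
    and eq: "x = (1 - u) *\<^sub>R a + u *\<^sub>R b"
  shows "a = x" "b = x"
proof -
  have "a = b"
  proof (rule ccontr)
    assume "a \<noteq> b"
    then have "x \<in> open_segment a b" using u eq by (auto simp: in_segment)
    then show False using x ab by (simp add: extreme_point_of_def)
  qed
  then show "a = x" "b = x" using eq by (simp_all add: algebra_simps)
qed

text \<open>The cone over \<open>K\<close> is treated height by height: its elements of height
  \<open>h\<close> are the points of \<open>h K\<close>, and a nonnegative combination of points of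
  \<open>K\<close> has its coefficient sum as height. Height 0 is separate because nothing can be
  normalised there.\<close>

lemma convex_cone_sum:
  fixes K :: "'a::euclidean_space set"
  assumes "convex K" "K \<noteq> {}" "finite S" "S \<subseteq> K" "\<And>v. v \<in> S \<Longrightarrow> 0 \<le> c v"
  shows "(\<Sum>v\<in>S. c v *\<^sub>R v) \<in> (\<lambda>x. (\<Sum>v\<in>S. c v) *\<^sub>R x) ` K"
proof (cases "(\<Sum>v\<in>S. c v) = 0")
  case True
  then have "\<forall>v\<in>S. c v = 0" using assms by (simp add: sum_nonneg_eq_0_iff)
  then show ?thesis using True assms by (auto simp: image_iff)
next
  case False
  then have T: "0 < (\<Sum>v\<in>S. c v)" using sum_nonneg[of S c] assms(5) by force
  have "(\<Sum>v\<in>S. (c v / (\<Sum>v\<in>S. c v)) *\<^sub>R v) \<in> K"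
    using assms T by (intro convex_sum) (auto simp flip: sum_divide_distrib)
  then have "(\<Sum>v\<in>S. c v) *\<^sub>R (\<Sum>v\<in>S. (c v / (\<Sum>v\<in>S. c v)) *\<^sub>R v) \<in> (\<lambda>x. (\<Sum>v\<in>S. c v) *\<^sub>R x) ` K" by (rule imageI)
  then show ?thesis using False by (simp add: scaleR_sum_right)
qed

lemma sum_list_in_scaled_convex:
  fixes K :: "'a::euclidean_space set"
  assumes "convex K" "K \<noteq> {}" "set ys \<subseteq> K"
  shows "sum_list ys \<in> (\<lambda>x. real (length ys) *\<^sub>R x) ` K"
  using assms(3)
proof (induction ys)
  case Nil
  then show ?case using assms(2) by (auto simp: image_iff)
next
  case (Cons y ys)
  then obtain k where k: "k \<in> K" "sum_list ys = real (length ys) *\<^sub>R k" by auto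
  let ?h = "real (length ys)"
  have "(1 / (?h + 1)) *\<^sub>R y + (?h / (?h + 1)) *\<^sub>R k \<in> K"
    using assms(1) k Cons.prems by (intro convexD) (auto simp: field_simps)
  moreover have "y + ?h *\<^sub>R k = (?h + 1) *\<^sub>R ((1 / (?h + 1)) *\<^sub>R y + (?h / (?h + 1)) *\<^sub>R k)"
    by (simp add: scaleR_add_right del: of_nat_Suc)
  ultimately show ?case using k by (auto simp: add.commute)
qed

text \<open>\<open>translation_homothetic\<close> says that \<open>K \<inter> (r(p - q) + K)\<close> is the homothet \<open>(1 - r)K + rp\<close> whenever
  \<open>p - q\<close> lies on the boundary of the difference body. In the cone over \<open>K\<close> this provides least
  upper bounds of points of equal height, and affine independence of the extreme points follows as in
  the Choquet-Kendall theorem: distinct extreme rays have infimum 0.\<close>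

locale translation_homothetic =
  fixes K :: "'a::euclidean_space set"
  assumes compact: "compact K" and convex: "convex K" and nonempty: "K \<noteq> {}"
    and homothetic: "p \<in> K \<Longrightarrow> q \<in> K \<Longrightarrow> (\<And>s a b. 1 < s \<Longrightarrow> a \<in> K \<Longrightarrow> b \<in> K \<Longrightarrow> s *\<^sub>R (p - q) \<noteq> a - b) \<Longrightarrow>
      0 \<le> r \<Longrightarrow> r < 1 \<Longrightarrow> w \<in> K \<Longrightarrow> w - r *\<^sub>R (p - q) \<in> K \<Longrightarrow> \<exists>k\<in>K. w = (1 - r) *\<^sub>R k + r *\<^sub>R p"
begin

text \<open>Otherwise let \<open>s > 1\<close> be the largest factor with \<open>s (q - p)\<close>
  in the difference body, say equal to \<open>x - y\<close>. The homothety at ratio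
  \<open>1 / s\<close> puts \<open>q\<close> strictly between a point of \<open>K\<close> and
  \<open>x\<close>, so \<open>x = q\<close>; then \<open>p\<close> lies strictly between
  \<open>q\<close> and \<open>y\<close>, against extremality.\<close>

lemma extreme_difference_maximal:
  assumes p: "p extreme_point_of K" and q: "q extreme_point_of K" and ne: "p \<noteq> q"
    and r: "1 < r" "a \<in> K" "b \<in> K"
  shows "r *\<^sub>R (q - p) \<noteq> a - b"
proof
  assume eq: "r *\<^sub>R (q - p) = a - b"
  define D where "D = {x - y | x y. x \<in> K \<and> y \<in> K}"
  have cD: "compact D" unfolding D_def by (rule compact_differences[OF compact compact])
  define S where "S = {s. s *\<^sub>R (q - p) \<in> D}"
  have rS: "r \<in> S" unfolding S_def D_def using eq r by auto
  obtain B where B: "\<And>x. x \<in> D \<Longrightarrow> norm x \<le> B" using compact_imp_bounded[OF cD] unfolding bounded_iff by auto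
  have bd: "bdd_above S"
  proof (rule bdd_aboveI)
    fix s assume "s \<in> S"
    then have "norm (s *\<^sub>R (q - p)) \<le> B" using B[of "s *\<^sub>R (q - p)"] by (simp only: S_def mem_Collect_eq)
    then have "s * norm (q - p) \<le> B" by (smt (verit) norm_scaleR mult_right_mono norm_ge_zero)
    then show "s \<le> B / norm (q - p)" using ne by (simp add: field_simps)
  qed
  have "closed S"
  proof -
    have "S = (\<lambda>s. s *\<^sub>R (q - p)) -` D" by (auto simp: S_def)
    then show ?thesis using cD by (simp add: closed_vimage compact_imp_closed continuous_intros)
  qed
  then have "Sup S \<in> S" using rS bd closed_contains_Sup by blast
  define s where "s = Sup S"
  have s1: "1 < s" using cSup_upper[OF rS bd] r unfolding s_def by linarith
  obtain x y where xy: "x \<in> K" "y \<in> K" "s *\<^sub>R (q - p) = x - y"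
    using \<open>Sup S \<in> S\<close> unfolding S_def D_def s_def by blast
  have max: "s' *\<^sub>R (x - y) \<noteq> a' - b'" if "1 < s'" "a' \<in> K" "b' \<in> K" for s' a' b'
  proof
    assume "s' *\<^sub>R (x - y) = a' - b'"
    then have "(s' * s) *\<^sub>R (q - p) = a' - b'" by (simp flip: xy(3))
    then have "s' * s \<in> S" unfolding S_def D_def using that by auto
    then have "s' * s \<le> s" unfolding s_def using bd by (intro cSup_upper)
    moreover have "1 * s < s' * s" using that s1 by (intro mult_strict_right_mono) auto
    ultimately show False by simp
  qed
  have pK: "p \<in> K" and qK: "q \<in> K" using p q by (auto simp: extreme_point_of_def)
  have "(1 / s) *\<^sub>R (x - y) = q - p" using s1 by (simp flip: xy(3))
  then obtain k where k: "k \<in> K" "q = (1 - 1 / s) *\<^sub>R k + (1 / s) *\<^sub>R x"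
    using homothetic[OF xy(1,2) max, of "1 / s" q] s1 pK qK by auto
  have xq: "x = q" using extreme_point_convex_combination(2)[OF q k(1) xy(1) _ _ k(2)] s1 by simp
  have y: "y = q - s *\<^sub>R (q - p)" using xy(3) xq by (simp add: algebra_simps)
  have "p = (1 - 1 / s) *\<^sub>R q + (1 / s) *\<^sub>R y"
    unfolding y using s1 by (simp add: algebra_simps)
  then have "q = p" using extreme_point_convex_combination(1)[OF p qK xy(2)] s1 by simp
  then show False using ne by simp
qed

text \<open>In the order of the cone, if \<open>e\<close> is below \<open>y + z\<close>, then it is
  below \<open>z\<close>. For \<open>h > 1\<close> the homothety at ratio \<open>1 / h\<close>
  exhibits \<open>y + z - e\<close> as \<open>y\<close> plus an element of height
  \<open>h - 1\<close>. Since ratios must stay below 1, \<open>h \<le> 1\<close> needs its own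
  argument.\<close>

lemma extreme_cancel:
  assumes e: "e extreme_point_of K" and y: "y extreme_point_of K" and ne: "e \<noteq> y" and h: "0 \<le> h"
    and z: "z \<in> (\<lambda>x. h *\<^sub>R x) ` K" and yz: "y + z - e \<in> (\<lambda>x. h *\<^sub>R x) ` K"
  shows "1 \<le> h \<and> z - e \<in> (\<lambda>x. (h - 1) *\<^sub>R x) ` K"
proof -
  have eK: "e \<in> K" and yK: "y \<in> K" using e y by (auto simp: extreme_point_of_def)
  have hom: "\<exists>k\<in>K. w = (1 - r) *\<^sub>R k + r *\<^sub>R y" if "0 \<le> r" "r < 1" "w \<in> K" "w - r *\<^sub>R (y - e) \<in> K" for r w
    by (rule homothetic[OF yK eK extreme_difference_maximal[OF e y ne]]) (use that in auto)
  obtain k1 k2 where k: "k1 \<in> K" "k2 \<in> K" "z = h *\<^sub>R k1" "y + z - e = h *\<^sub>R k2" using z yz by auto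
  show ?thesis
  proof (cases "1 < h")
    case True
    have "y - e = h *\<^sub>R (k2 - k1)" using k(3,4) by (simp add: algebra_simps)
    then have "(1 / h) *\<^sub>R (y - e) = k2 - k1" using True by simp
    then obtain m where m: "m \<in> K" "k2 = (1 - 1 / h) *\<^sub>R m + (1 / h) *\<^sub>R y"
      using hom[of "1 / h" k2] True k by auto
    have "h *\<^sub>R k2 = (h - 1) *\<^sub>R m + y" unfolding m(2) using True by (simp add: algebra_simps)
    moreover have "z - e = h *\<^sub>R k2 - y" by (simp flip: k(4))
    ultimately have "z - e = (h - 1) *\<^sub>R m" by simp
    then show ?thesis using m True by auto
  next
    case False
    \<comment> \<open>The limiting ratio 1, where the intersection of \<open>K\<close> with its
      translate by \<open>y - e\<close> shrinks to \<open>y\<close>. A second point \<open>w\<close>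
      is pulled slightly towards \<open>y\<close>, and the homothety at a ratio \<open>r < 1\<close>
      applies to the result.\<close>
    have uniq: "w = y" if w: "w \<in> K" "w - (y - e) \<in> K" for w
    proof (rule ccontr)
      assume "w \<noteq> y"
      then have d: "0 < norm (w - y)" by simp
      obtain B where B: "\<And>x. x \<in> K \<Longrightarrow> norm x \<le> B" using compact_imp_bounded[OF compact] unfolding bounded_iff by auto
      have B0: "0 \<le> B" using B[OF yK] norm_ge_zero[of y] by linarith
      \<comment> \<open>This makes \<open>(1 - r) / r\<close> equal to
        \<open>norm (w - y) / (2 * B + 1)\<close>, while the homothety gives
        \<open>r * norm (w - y) \<le> (1 - r) * (2 * B)\<close>, as \<open>2 * B\<close> bounds
        distances in \<open>K\<close>. The two are incompatible.\<close>
      define m0 where "m0 = 2 * B + 1 + norm (w - y)"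
      have m0: "0 < m0" "2 * B + 1 < m0" using B0 d unfolding m0_def by linarith+
      define r where "r = (2 * B + 1) / m0"
      have r: "0 \<le> r" "r < 1" using B0 m0 by (simp_all add: r_def)
      have "(1 - r) *\<^sub>R y + r *\<^sub>R w \<in> K" using convexD_alt[OF convex yK w(1), of r] r by simp
      moreover have "(1 - r) *\<^sub>R y + r *\<^sub>R (w - (y - e)) \<in> K" using convexD_alt[OF convex yK w(2), of r] r by simp
      moreover have "(1 - r) *\<^sub>R y + r *\<^sub>R w - r *\<^sub>R (y - e) = (1 - r) *\<^sub>R y + r *\<^sub>R (w - (y - e))"
        by (simp add: algebra_simps)
      ultimately obtain m where m: "m \<in> K" "(1 - r) *\<^sub>R y + r *\<^sub>R w = (1 - r) *\<^sub>R m + r *\<^sub>R y"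
        using hom[OF r] by metis
      then have "r *\<^sub>R (w - y) = (1 - r) *\<^sub>R (m - y)" by (simp add: algebra_simps)
      then have "r * norm (w - y) = (1 - r) * norm (m - y)" using r by (metis abs_of_nonneg diff_ge_0_iff_ge less_imp_le norm_scaleR)
      also have "\<dots> \<le> (1 - r) * (2 * B)"
        using r B[OF m(1)] B[OF yK] norm_triangle_ineq4[of m y] by (intro mult_left_mono) auto
      finally have "m0 * (r * norm (w - y)) \<le> m0 * ((1 - r) * (2 * B))" using m0 by (intro mult_left_mono) auto
      moreover have "m0 * (r * norm (w - y)) = (2 * B + 1) * norm (w - y)" using m0 by (simp add: r_def)
      moreover have "m0 * ((1 - r) * (2 * B)) = (m0 - m0 * r) * (2 * B)" by (simp add: algebra_simps)
      moreover have "m0 - m0 * r = norm (w - y)" using m0 by (simp add: r_def) (simp add: m0_def)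
      ultimately have "(2 * B + 1) * norm (w - y) \<le> norm (w - y) * (2 * B)" by simp
      then have "norm (w - y) \<le> 0" by (simp add: algebra_simps)
      then show False using d by linarith
    qed
    \<comment> \<open>Adding \<open>(1 - h)\<close> times \<open>y\<close> lifts both points to
      height 1, where uniqueness applies. It puts \<open>e\<close> on the segment from
      \<open>y\<close> to \<open>k1\<close>, and extremality leaves only
      \<open>h = 1\<close>.\<close>
    have W: "(1 - h) *\<^sub>R y + h *\<^sub>R k2 \<in> K" "(1 - h) *\<^sub>R y + h *\<^sub>R k1 \<in> K"
      using convexD_alt[OF convex yK k(2), of h] convexD_alt[OF convex yK k(1), of h] h False by auto
    have eqW: "(1 - h) *\<^sub>R y + h *\<^sub>R k2 - (y - e) = (1 - h) *\<^sub>R y + h *\<^sub>R k1"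
      using k(3,4) by (simp add: algebra_simps)
    have "(1 - h) *\<^sub>R y + h *\<^sub>R k2 = y"
      using W(2) unfolding eqW[symmetric] by (rule uniq[OF W(1)])
    then have ez: "e = (1 - h) *\<^sub>R y + h *\<^sub>R k1" using eqW by (metis diff_diff_eq2 add_diff_cancel_left')
    have "h = 1"
    proof (rule ccontr)
      assume "h \<noteq> 1"
      then consider "h = 0" | "0 < h" "h < 1" using h False by linarith
      then show False
      proof cases
        case 1 then show False using ez ne by simp
      next
        case 2
        then show False using extreme_point_convex_combination(1)[OF e yK k(1) _ _ ez] ne by simp
      qed
    qed
    then show ?thesis using ez k(3) nonempty by (auto simp: image_iff)
  qed
qed

text \<open>Cancelling one summand at a time keeps \<open>e\<close> below the rest; when the last
  one goes, the cancellation would claim \<open>1 \<le> 0\<close>. Lists allow repeated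
  summands.\<close>

lemma extreme_not_below_sum:
  assumes "e extreme_point_of K" "\<And>y. y \<in> set ys \<Longrightarrow> y extreme_point_of K \<and> e \<noteq> y" "1 \<le> length ys"
  shows "sum_list ys - e \<notin> (\<lambda>x. (real (length ys) - 1) *\<^sub>R x) ` K"
  using assms(2,3)
proof (induction ys)
  case (Cons y ys)
  show ?case
  proof
    assume in1: "sum_list (y # ys) - e \<in> (\<lambda>x. (real (length (y # ys)) - 1) *\<^sub>R x) ` K"
    have "set ys \<subseteq> K" using Cons.prems(1) by (auto simp: extreme_point_of_def)
    then have "sum_list ys \<in> (\<lambda>x. real (length ys) *\<^sub>R x) ` K"
      by (rule sum_list_in_scaled_convex[OF convex nonempty])
    moreover have "y + sum_list ys - e \<in> (\<lambda>x. real (length ys) *\<^sub>R x) ` K" using in1 by simp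
    ultimately have "1 \<le> real (length ys) \<and> sum_list ys - e \<in> (\<lambda>x. (real (length ys) - 1) *\<^sub>R x) ` K"
      using Cons.prems(1) assms(1) by (intro extreme_cancel[of e y]) auto
    then show False using Cons.IH Cons.prems(1) by auto
  qed
qed simp

text \<open>A dependence is solved for an extreme point \<open>e\<close> with positive coefficient.
  After adding \<open>N\<close> copies of each other point involved, it exhibits \<open>e\<close>
  below a sum of extreme points different from \<open>e\<close>.\<close>

lemma extreme_points_affine_independent: "\<not> affine_dependent {x. x extreme_point_of K}"
proof
  assume "affine_dependent {x. x extreme_point_of K}"
  then obtain S U where S: "finite S" "S \<subseteq> {x. x extreme_point_of K}" "sum U S = 0" "\<exists>v\<in>S. U v \<noteq> 0"
    "(\<Sum>v\<in>S. U v *\<^sub>R v) = 0" unfolding affine_dependent_explicit by blast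
  obtain e where e: "e \<in> S" "0 < U e"
  proof (rule ccontr)
    assume "\<not> thesis"
    then have "\<And>v. v \<in> S \<Longrightarrow> 0 \<le> - U v" using that by (meson neg_0_le_iff_le not_le)
    moreover have "sum (\<lambda>v. - U v) S = 0" using S(3) by (simp add: sum_negf)
    ultimately have "\<forall>v\<in>S. - U v = 0" using S(1) by (simp add: sum_nonneg_eq_0_iff)
    then show False using S(4) by auto
  qed
  define T where "T = S - {e}"
  have T: "finite T" "e \<notin> T" "S = insert e T" using S(1) e by (auto simp: T_def)
  define c where "c v = U v / U e" for v
  have c1: "(\<Sum>v\<in>T. c v) = -1"
  proof -
    have "U e + sum U T = 0" using S(3) T by simp
    then have "sum U T = - U e" by linarith
    then show ?thesis using e by (simp add: c_def flip: sum_divide_distrib)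
  qed
  have c2: "(\<Sum>v\<in>T. c v *\<^sub>R v) = - e"
  proof -
    have "U e *\<^sub>R e + (\<Sum>v\<in>T. U v *\<^sub>R v) = 0" using S(5) T by simp
    then have "(\<Sum>v\<in>T. U v *\<^sub>R v) = - (U e *\<^sub>R e)" by (simp add: add_eq_0_iff)
    then have "(1 / U e) *\<^sub>R (\<Sum>v\<in>T. U v *\<^sub>R v) = (1 / U e) *\<^sub>R (- (U e *\<^sub>R e))" by simp
    then show ?thesis using e by (simp add: scaleR_sum_right c_def)
  qed
  \<comment> \<open>\<open>N\<close> makes all coefficients nonnegative. As the \<open>c v\<close>
    add up to -1, the shifted ones add up to \<open>N * card T - 1\<close>, one less than the number
    of summands.\<close>
  obtain N :: nat where N: "\<And>v. v \<in> T \<Longrightarrow> 0 \<le> real N + c v"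
  proof -
    obtain N :: nat where "(\<Sum>v\<in>T. \<bar>c v\<bar>) \<le> real N" using real_arch_simple by blast
    moreover have "\<bar>c v\<bar> \<le> (\<Sum>v\<in>T. \<bar>c v\<bar>)" if "v \<in> T" for v using that T by (intro member_le_sum) auto
    ultimately show ?thesis using that[of N] by (smt (verit))
  qed
  obtain xs where xs: "set xs = T" "distinct xs" using finite_distinct_list[OF T(1)] by blast
  define ys where "ys = concat (map (replicate N) xs)"
  have len: "length ys = N * card T"
    using distinct_card[OF xs(2)] xs(1) by (simp add: ys_def length_concat comp_def sum_list_triv)
  have sum: "sum_list ys = (\<Sum>v\<in>T. real N *\<^sub>R v)"
  proof -
    have "sum_list (replicate m v) = real m *\<^sub>R v" for m and v :: 'a
      by (induction m) (simp_all add: algebra_simps)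
    then have "sum_list (concat (map (replicate N) zs)) = (\<Sum>v\<leftarrow>zs. real N *\<^sub>R v)" for zs :: "'a list"
      by (induction zs) simp_all
    then show ?thesis using sum_list_distinct_conv_sum_set[OF xs(2)] xs(1) by (simp add: ys_def)
  qed
  have TK: "T \<subseteq> K" using S(2) by (auto simp: T_def extreme_point_of_def)
  have total: "(\<Sum>v\<in>T. real N + c v) = real (length ys) - 1"
    by (simp add: sum.distrib c1 len)
  have "sum_list ys - e = (\<Sum>v\<in>T. (real N + c v) *\<^sub>R v)"
    by (simp add: sum scaleR_add_left sum.distrib c2)
  also have "\<dots> \<in> (\<lambda>x. (real (length ys) - 1) *\<^sub>R x) ` K"
    using convex_cone_sum[OF convex nonempty T(1) TK, of "\<lambda>v. real N + c v"] N unfolding total by simp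
  finally have "sum_list ys - e \<in> (\<lambda>x. (real (length ys) - 1) *\<^sub>R x) ` K" .
  moreover have "1 \<le> length ys"
  proof -
    have "0 \<le> (\<Sum>v\<in>T. real N + c v)" using N by (rule sum_nonneg)
    then show ?thesis unfolding total by linarith
  qed
  moreover have "y extreme_point_of K \<and> e \<noteq> y" if "y \<in> set ys" for y
    using that xs(1) S(2) T by (auto simp: ys_def)
  moreover have "e extreme_point_of K" using e S(2) by auto
  ultimately show False using extreme_not_below_sum by blast
qed

lemma simplex_of_full_dimension:
  assumes "interior K \<noteq> {}"
  shows "(int DIM('a)) simplex K"
proof -
  let ?E = "{x. x extreme_point_of K}"
  have K: "K = convex hull ?E" by (rule Krein_Milman_Minkowski[OF compact convex])
  have "int (card ?E) - 1 = aff_dim ?E" using aff_dim_affine_independent[OF extreme_points_affine_independent] by simp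
  also have "\<dots> = aff_dim K" by (subst (2) K) (simp add: aff_dim_convex_hull)
  also have "\<dots> = int DIM('a)" using assms by (rule aff_dim_nonempty_interior)
  finally show ?thesis unfolding simplex_def using extreme_points_affine_independent K
    by (intro exI[of _ ?E]) auto
qed

end

text \<open>By maximality of \<open>p - q\<close> the translate by \<open>s (p - q)\<close> misses
  \<open>K\<close> for \<open>s > 1\<close>, so the volume formula forces \<open>c \<ge> 1\<close>.
  The intersection at \<open>r\<close> is thus no larger in volume than the homothet
  \<open>(1 - r) K + r p\<close> inside it, and the two coincide.\<close>

lemma translation_homothetic_of_volume:
  fixes K :: "'a::euclidean_space set"
  assumes K: "convex_body K"
    and vol: "\<And>y. \<exists>c. \<forall>r\<ge>0. vol (K \<inter> (+) (r *\<^sub>R y) ` K) = vol K * max 0 (1 - c * r) ^ DIM('a)"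
  shows "translation_homothetic K"
proof
  have K': "compact K" "convex K" "interior K \<noteq> {}" using K by (auto simp: convex_body_def)
  show "compact K" "convex K" "K \<noteq> {}" using K' by auto
  have vp: "0 < vol K" using measure_pos_interior[OF lmeasurable_compact] K' by blast
  fix p q r w
  assume p: "p \<in> K" and q: "q \<in> K" and max: "\<And>s a b. 1 < s \<Longrightarrow> a \<in> K \<Longrightarrow> b \<in> K \<Longrightarrow> s *\<^sub>R (p - q) \<noteq> a - b"
    and r: "0 \<le> r" "r < 1" and w: "w \<in> K" "w - r *\<^sub>R (p - q) \<in> K"
  obtain c where c: "\<And>r. 0 \<le> r \<Longrightarrow> vol (K \<inter> (+) (r *\<^sub>R (p - q)) ` K) = vol K * max 0 (1 - c * r) ^ DIM('a)"
    using vol[of "p - q"] by blast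
  have c1: "1 \<le> c"
  proof (rule ccontr)
    assume "\<not> 1 \<le> c"
    \<comment> \<open>A factor beyond 1 at which the formula would still give positive volume; for
      \<open>c > 0\<close> it is the midpoint of 1 and \<open>1 / c\<close>.\<close>
    define s where "s = (if c \<le> 0 then 2 else (1 + 1 / c) / 2)"
    have s: "1 < s" "c * s < 1" using \<open>\<not> 1 \<le> c\<close> by (auto simp: s_def field_simps)
    have "K \<inter> (+) (s *\<^sub>R (p - q)) ` K = {}"
    proof (rule ccontr)
      assume "K \<inter> (+) (s *\<^sub>R (p - q)) ` K \<noteq> {}"
      then obtain b where "b \<in> K" "s *\<^sub>R (p - q) + b \<in> K" by auto
      then show False using max[OF s(1), of "s *\<^sub>R (p - q) + b" b] by simp
    qed
    then have "vol K * max 0 (1 - c * s) ^ DIM('a) = 0" using c[of s] s by simp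
    then show False using vp s by simp
  qed
  define A where "A = (\<lambda>k. (1 - r) *\<^sub>R k + r *\<^sub>R p) ` K"
  define B where "B = K \<inter> (+) (r *\<^sub>R (p - q)) ` K"
  have cA: "compact A" unfolding A_def by (intro compact_continuous_image continuous_intros K')
  have cB: "compact B" "convex B" unfolding B_def
    by (intro compact_Int compact_translation K' convex_Int convex_translation)+
  have vA: "vol A = (1 - r) ^ DIM('a) * vol K"
    unfolding A_def using measure_lebesgue_affine[of "1 - r" "r *\<^sub>R p" K] r by simp
  have AB: "A \<subseteq> B"
  proof
    fix x assume "x \<in> A"
    then obtain k where k: "k \<in> K" "x = (1 - r) *\<^sub>R k + r *\<^sub>R p" by (auto simp: A_def)
    have "x \<in> K" unfolding k(2) using convexD_alt[OF K'(2) k(1) p, of r] r by simp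
    moreover have "(1 - r) *\<^sub>R k + r *\<^sub>R q \<in> K" using convexD_alt[OF K'(2) k(1) q, of r] r by simp
    then have "r *\<^sub>R (p - q) + ((1 - r) *\<^sub>R k + r *\<^sub>R q) \<in> (+) (r *\<^sub>R (p - q)) ` K" by (rule imageI)
    then have "x \<in> (+) (r *\<^sub>R (p - q)) ` K" unfolding k(2) by (simp add: algebra_simps)
    ultimately show "x \<in> B" by (simp add: B_def)
  qed
  have "vol B \<le> vol A"
  proof -
    have "c * r \<ge> r" using c1 r by (simp add: mult_le_cancel_right1)
    then have "max 0 (1 - c * r) ^ DIM('a) \<le> (1 - r) ^ DIM('a)" using r by (intro power_mono) auto
    then have "vol K * max 0 (1 - c * r) ^ DIM('a) \<le> vol K * (1 - r) ^ DIM('a)" using vp by (intro mult_left_mono) auto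
    then show ?thesis using c[OF r(1)] vA unfolding B_def by (simp add: mult.commute)
  qed
  moreover have "interior B \<noteq> {}"
  proof
    assume "interior B = {}"
    then have "negligible B" using negligible_convex_interior[OF cB(2)] by simp
    then have "negligible A" using AB negligible_subset by blast
    then have "vol A = 0" by (rule negligible_imp_measure0)
    then show False using vA vp r by simp
  qed
  ultimately have "A = B" using closed_body_subset_of_measure_ge[OF cA cB _ AB] by simp
  moreover have "w \<in> B"
  proof -
    have "r *\<^sub>R (p - q) + (w - r *\<^sub>R (p - q)) \<in> (+) (r *\<^sub>R (p - q)) ` K" using w(2) by (rule imageI)
    then show ?thesis using w(1) by (simp add: B_def)
  qed
  ultimately show "\<exists>k\<in>K. w = (1 - r) *\<^sub>R k + r *\<^sub>R p" unfolding A_def by auto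
qed

subsection \<open>The covariogram of a simplex\<close>

text \<open>Linearity on rays makes the level sets dilates of one another with ratio
  \<open>(1 - s) / (1 - t)\<close>, and the layer cake formula reduces to the Beta integral. Such
  profiles attain the bound for Ball's bodies.\<close>

lemma (in concave_profile) nn_integral_linear_rays:
  assumes rays: "\<And>y. \<exists>c. \<forall>r\<ge>0. g (r *\<^sub>R y) = max 0 (1 - c * r)" and t: "0 < t" "t < 1"
  shows "(\<integral>\<^sup>+x. ennreal (g x ^ DIM('a)) \<partial>lborel) =
    ennreal (vol {x. t \<le> g x} / (1 - t) ^ DIM('a) / real ((2 * DIM('a)) choose DIM('a)))"
proof -
  let ?n = "DIM('a)"
  have n: "1 \<le> ?n" by (simp add: Suc_leI)
  have level: "{x. s \<le> g x} = (\<lambda>x. ((1 - s) / (1 - t)) *\<^sub>R x) ` {x. t \<le> g x}" if s: "0 < s" "s < 1" for s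
  proof -
    define \<rho> where "\<rho> = (1 - t) / (1 - s)"
    have \<rho>: "0 < \<rho>" "1 / \<rho> = (1 - s) / (1 - t)" using s t by (auto simp: \<rho>_def)
    have iff: "s \<le> g x \<longleftrightarrow> t \<le> g (\<rho> *\<^sub>R x)" for x
    proof -
      obtain c where c: "\<And>r. 0 \<le> r \<Longrightarrow> g (r *\<^sub>R x) = max 0 (1 - c * r)" using rays[of x] by blast
      have "s \<le> g x \<longleftrightarrow> c \<le> 1 - s" using c[of 1] s by auto
      also have "\<dots> \<longleftrightarrow> c * \<rho> \<le> (1 - s) * \<rho>" using mult_le_cancel_right_pos[OF \<rho>(1)] by simp
      also have "\<dots> \<longleftrightarrow> t \<le> g (\<rho> *\<^sub>R x)"
      proof -
        have "(1 - s) * \<rho> = 1 - t" using s by (simp add: \<rho>_def)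
        then show ?thesis using c[of \<rho>] \<rho> t by auto
      qed
      finally show ?thesis .
    qed
    show ?thesis
    proof (intro set_eqI iffI)
      fix x assume "x \<in> {x. s \<le> g x}"
      then have "\<rho> *\<^sub>R x \<in> {x. t \<le> g x}" using iff by simp
      moreover have "x = ((1 - s) / (1 - t)) *\<^sub>R \<rho> *\<^sub>R x" using \<rho>(1) by (simp flip: \<rho>(2))
      ultimately show "x \<in> (\<lambda>x. ((1 - s) / (1 - t)) *\<^sub>R x) ` {x. t \<le> g x}" by (rule rev_image_eqI)
    next
      fix x assume "x \<in> (\<lambda>x. ((1 - s) / (1 - t)) *\<^sub>R x) ` {x. t \<le> g x}"
      then obtain y where y: "t \<le> g y" "x = (1 / \<rho>) *\<^sub>R y" by (auto simp: \<rho>(2))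
      then have "\<rho> *\<^sub>R x = y" using \<rho>(1) by simp
      then show "x \<in> {x. s \<le> g x}" using y iff by simp
    qed
  qed
  have "(\<integral>\<^sup>+x. ennreal (g x ^ ?n) \<partial>lborel) =
    (\<integral>\<^sup>+s. ennreal (real ?n * s ^ (?n - 1)) * indicator {0..1} s * emeasure lborel {x \<in> space lborel. s \<le> g x} \<partial>lborel)"
    by (rule layer_cake_power[OF sigma_finite_lborel]) (use g01 n in auto)
  also have "\<dots> = (\<integral>\<^sup>+s. ennreal (vol {x. t \<le> g x} / (1 - t) ^ ?n) *
      (ennreal (real ?n * s ^ (?n - 1)) * indicator {0..1} s * ennreal ((1 - s) ^ ?n)) \<partial>lborel)"
  proof (rule nn_integral_cong_AE, use AE_lborel_singleton[of "0::real"] AE_lborel_singleton[of "1::real"] in eventually_elim)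
    case (elim s)
    show ?case
    proof (cases "0 \<le> s \<and> s \<le> 1")
      case True
      then have s: "0 < s" "s < 1" using elim by auto
      have "emeasure lborel {x. s \<le> g x} = ennreal (vol {x. s \<le> g x})"
        by (rule emeasure_lborel_eq_measure_lebesgue[OF level_set_lmeasurable(2)[OF s(1)] level_set_lmeasurable(1)[OF s(1)]])
      also have "vol {x. s \<le> g x} = vol {x. t \<le> g x} / (1 - t) ^ ?n * (1 - s) ^ ?n"
        unfolding level[OF s] measure_lebesgue_scaleR using s t by (simp add: power_divide)
      also have "ennreal \<dots> = ennreal (vol {x. t \<le> g x} / (1 - t) ^ ?n) * ennreal ((1 - s) ^ ?n)"
        using s t by (intro ennreal_mult) auto
      finally show ?thesis by (simp add: mult_ac)
    qed auto
  qed
  also have "\<dots> = ennreal (vol {x. t \<le> g x} / (1 - t) ^ ?n) * ennreal (1 / real ((2 * ?n) choose ?n))"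
    by (subst nn_integral_cmult) (measurable, simp only: nn_integral_central_binomial[OF n])
  also have "\<dots> = ennreal (vol {x. t \<le> g x} / (1 - t) ^ ?n * (1 / real ((2 * ?n) choose ?n)))"
    using t by (intro ennreal_mult[symmetric]) auto
  finally show ?thesis by simp
qed

text \<open>In barycentric coordinates \<open>y\<close> is a vector \<open>a\<close> of sum 0, and a
  point lies in both simplices when each coordinate is at least the positive part of
  \<open>r * a v\<close>. Removing these parts, of total \<open>c * r\<close>, leaves a copy of
  \<open>K\<close> scaled by \<open>1 - c * r\<close>.\<close>

lemma simplex_translate_volume:
  fixes K :: "'a::euclidean_space set"
  assumes "(int DIM('a)) simplex K"
  shows "\<exists>c. \<forall>r\<ge>0. vol (K \<inter> (+) (r *\<^sub>R y) ` K) = vol K * max 0 (1 - c * r) ^ DIM('a)"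
proof -
  obtain C where C: "\<not> affine_dependent C" "int (card C) = int DIM('a) + 1" "K = convex hull C"
    using assms unfolding simplex_def by blast
  have fC: "finite C" using C(1) by (rule aff_independent_finite)
  have "aff_dim C = int DIM('a)" using aff_dim_affine_independent[OF C(1)] C(2) by simp
  then have hull: "affine hull C = UNIV" by (simp add: aff_dim_eq_full)
  have ind: "f v = 0" if "sum f C = 0" "(\<Sum>v\<in>C. f v *\<^sub>R v) = 0" "v \<in> C" for f v
    using C(1) that unfolding affine_dependent_explicit_finite[OF fC] by blast
  have KI: "(\<Sum>v\<in>C. f v *\<^sub>R v) \<in> K" if "\<And>v. v \<in> C \<Longrightarrow> 0 \<le> f v" "sum f C = 1" for f
    unfolding C(3) convex_hull_finite[OF fC] using that by blast
  have KE: "\<exists>f. (\<forall>v\<in>C. 0 \<le> f v) \<and> sum f C = 1 \<and> x = (\<Sum>v\<in>C. f v *\<^sub>R v)" if "x \<in> K" for x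
    using that unfolding C(3) convex_hull_finite[OF fC] by blast
  obtain a where a: "sum a C = 0" "(\<Sum>v\<in>C. a v *\<^sub>R v) = y"
  proof -
    have "y \<in> affine hull C" "0 \<in> affine hull C" by (simp_all add: hull)
    then obtain u u' where "sum u C = 1" "(\<Sum>v\<in>C. u v *\<^sub>R v) = y" "sum u' C = 1" "(\<Sum>v\<in>C. u' v *\<^sub>R v) = 0"
      unfolding affine_hull_finite[OF fC] by blast
    then show ?thesis using that[of "\<lambda>v. u v - u' v"] by (simp add: sum_subtractf scaleR_diff_left)
  qed
  define c where "c = (\<Sum>v\<in>C. max 0 (a v))"
  have "vol (K \<inter> (+) (r *\<^sub>R y) ` K) = vol K * max 0 (1 - c * r) ^ DIM('a)" if r: "0 \<le> r" for r
  proof -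
    define d where "d v = r * max 0 (a v)" for v
    have d: "sum d C = c * r" "\<And>v. 0 \<le> d v" "\<And>v. 0 \<le> d v - r * a v"
      using r by (auto simp: d_def c_def mult.commute simp flip: sum_distrib_left intro!: mult_left_mono)
    define q where "q = (\<Sum>v\<in>C. d v *\<^sub>R v)"
    have coord: "\<exists>f. (\<forall>v\<in>C. d v \<le> f v) \<and> sum f C = 1 \<and> z = (\<Sum>v\<in>C. f v *\<^sub>R v)"
      if zin: "z \<in> K \<inter> (+) (r *\<^sub>R y) ` K" for z
    proof -
      obtain w where w: "z \<in> K" "w \<in> K" "z = r *\<^sub>R y + w" using zin by auto
      obtain f where f: "\<forall>v\<in>C. 0 \<le> f v" "sum f C = 1" "z = (\<Sum>v\<in>C. f v *\<^sub>R v)" using KE[OF w(1)] by blast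
      obtain h where h: "\<forall>v\<in>C. 0 \<le> h v" "sum h C = 1" "w = (\<Sum>v\<in>C. h v *\<^sub>R v)" using KE[OF w(2)] by blast
      have "f v - r * a v - h v = 0" if "v \<in> C" for v
      proof (rule ind[OF _ _ that])
        show "(\<Sum>v\<in>C. f v - r * a v - h v) = 0"
          by (simp add: sum_subtractf f h a flip: sum_distrib_left)
        have "(\<Sum>v\<in>C. (f v - r * a v - h v) *\<^sub>R v) = z - r *\<^sub>R y - w"
          by (simp add: scaleR_diff_left sum_subtractf f(3) h(3) a(2)[symmetric] scaleR_sum_right)
        then show "(\<Sum>v\<in>C. (f v - r * a v - h v) *\<^sub>R v) = 0" using w(3) by simp
      qed
      then have "r * a v \<le> f v" if "v \<in> C" for v using h(1) that by (smt (verit))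
      then have "d v \<le> f v" if "v \<in> C" for v using f(1) that r by (auto simp: d_def max_def)
      then show ?thesis using f by blast
    qed
    show ?thesis
    proof (cases "c * r < 1")
      case False
      \<comment> \<open>The coordinates sum to 1 while their lower bounds \<open>d v\<close> sum to
        at least 1, so at most one point remains; this is the zero of \<open>max 0\<close>.\<close>
      have "K \<inter> (+) (r *\<^sub>R y) ` K \<subseteq> {q}"
      proof
        fix z assume "z \<in> K \<inter> (+) (r *\<^sub>R y) ` K"
        then obtain f where f: "\<forall>v\<in>C. d v \<le> f v" "sum f C = 1" "z = (\<Sum>v\<in>C. f v *\<^sub>R v)" using coord by blast
        have "(\<Sum>v\<in>C. f v - d v) \<le> 0" using False by (simp add: sum_subtractf f(2) d(1))
        moreover have "0 \<le> (\<Sum>v\<in>C. f v - d v)" using f(1) by (intro sum_nonneg) auto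
        ultimately have "(\<Sum>v\<in>C. f v - d v) = 0" by linarith
        then have "\<forall>v\<in>C. f v - d v = 0" using f(1) fC by (subst (asm) sum_nonneg_eq_0_iff) auto
        then show "z \<in> {q}" using f(3) by (auto simp: q_def intro!: sum.cong)
      qed
      then have "negligible (K \<inter> (+) (r *\<^sub>R y) ` K)" using negligible_sing negligible_subset by blast
      then show ?thesis using False by (simp add: negligible_imp_measure0)
    next
      case True
      let ?s = "c * r"
      have "K \<inter> (+) (r *\<^sub>R y) ` K = (\<lambda>k. (1 - ?s) *\<^sub>R k + q) ` K"
      proof (intro set_eqI iffI)
        fix z assume "z \<in> K \<inter> (+) (r *\<^sub>R y) ` K"
        then obtain f where f: "\<forall>v\<in>C. d v \<le> f v" "sum f C = 1" "z = (\<Sum>v\<in>C. f v *\<^sub>R v)" using coord by blast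
        have "(\<Sum>v\<in>C. ((f v - d v) / (1 - ?s)) *\<^sub>R v) \<in> K"
          using f d True by (intro KI) (auto simp: sum_subtractf simp flip: sum_divide_distrib)
        moreover have "z = (1 - ?s) *\<^sub>R (\<Sum>v\<in>C. ((f v - d v) / (1 - ?s)) *\<^sub>R v) + q"
          using True by (simp add: scaleR_sum_right q_def f(3) scaleR_diff_left sum_subtractf)
        ultimately show "z \<in> (\<lambda>k. (1 - ?s) *\<^sub>R k + q) ` K" by (rule rev_image_eqI)
      next
        fix z assume "z \<in> (\<lambda>k. (1 - ?s) *\<^sub>R k + q) ` K"
        then obtain k where k: "k \<in> K" "z = (1 - ?s) *\<^sub>R k + q" by auto
        obtain f where f: "\<forall>v\<in>C. 0 \<le> f v" "sum f C = 1" "k = (\<Sum>v\<in>C. f v *\<^sub>R v)" using KE[OF k(1)] by blast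
        have "z = (\<Sum>v\<in>C. ((1 - ?s) * f v + d v) *\<^sub>R v)"
          by (simp add: k(2) f(3) q_def scaleR_sum_right scaleR_add_left sum.distrib)
        also have "\<dots> \<in> K"
          using f d True by (intro KI) (auto simp: sum.distrib simp flip: sum_distrib_left)
        finally have zK: "z \<in> K" .
        have "(\<Sum>v\<in>C. ((1 - ?s) * f v + (d v - r * a v)) *\<^sub>R v) \<in> K"
          using f d True a by (intro KI) (auto simp: sum.distrib sum_subtractf intro!: add_nonneg_nonneg mult_nonneg_nonneg simp flip: sum_distrib_left)
        moreover have "z = r *\<^sub>R y + (\<Sum>v\<in>C. ((1 - ?s) * f v + (d v - r * a v)) *\<^sub>R v)"
          by (simp add: k(2) f(3) q_def scaleR_sum_right scaleR_add_left scaleR_diff_left sum.distrib sum_subtractf a(2)[symmetric])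
        ultimately have "z \<in> (+) (r *\<^sub>R y) ` K" by (rule rev_image_eqI)
        then show "z \<in> K \<inter> (+) (r *\<^sub>R y) ` K" using zK by simp
      qed
      then have "vol (K \<inter> (+) (r *\<^sub>R y) ` K) = \<bar>1 - ?s\<bar> ^ DIM('a) * vol K"
        by (simp only: measure_lebesgue_affine)
      then show ?thesis using True by simp
    qed
  qed
  then show ?thesis by blast
qed

section \<open>Reflected simplices as the equality case\<close>

context convex_body_pair
begin

lemma cov_reflected:
  assumes "K = reflect_translate z L"
  shows "cov (z + x) = vol (K \<inter> (+) x ` K)"
proof -
  have "reflect_translate (z + x) L = (+) x ` reflect_translate z L"
    by (auto simp: reflect_translate_def image_image algebra_simps)
  then show ?thesis unfolding cov_def assms[symmetric] by simp
qed

text \<open>The slice at \<open>z\<close> has the full volume of both bodies, hence fills each of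
  them.\<close>

lemma reflected_if_max_volume:
  assumes "vol K = cov z" "vol L = cov z"
  shows "K = reflect_translate z L"
proof -
  let ?S = "K \<inter> reflect_translate z L"
  have R: "reflect_translate z L = (\<lambda>x. (-1) *\<^sub>R x + z) ` L" by (auto simp: reflect_translate_def)
  have vR: "vol (reflect_translate z L) = vol L"
    unfolding R using measure_lebesgue_affine[of "-1" z L] by simp
  have cR: "compact (reflect_translate z L)" using KL by (intro compact_reflect_translate)
  have xR: "convex (reflect_translate z L)"
    unfolding R using convex_affinity[OF KL(5), of z "-1"] by (simp add: add.commute)
  have iR: "interior (reflect_translate z L) \<noteq> {}"
  proof
    assume "interior (reflect_translate z L) = {}"
    then have "negligible (reflect_translate z L)" using negligible_convex_interior[OF xR] by simp
    then show False using vR vol_pos negligible_imp_measure0 by fastforce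
  qed
  have "?S = K"
    by (rule closed_body_subset_of_measure_ge[OF compact_slice KL(1-3)]) (use assms in \<open>auto simp: cov_def\<close>)
  moreover have "?S = reflect_translate z L"
    by (rule closed_body_subset_of_measure_ge[OF compact_slice cR xR iR]) (use assms vR in \<open>auto simp: cov_def\<close>)
  ultimately show ?thesis by simp
qed

text \<open>The slice at \<open>z\<close> is all of \<open>K\<close>, so the covariogram peaks there
  with value \<open>|K|\<close>, and its profile is linear on rays. The integral of the
  \<open>n\<close>-th power of the profile is \<open>|K||L| / |K| = |K|\<close>, which determines
  the volume of the level set.\<close>

lemma simplex_conv_body:
  assumes KL_eq: "K = (\<lambda>y. z - y) ` L" and splx: "(int DIM('a)) simplex K" and t: "0 < t" "t < 1"
  shows "vol L = vol K" "vol (conv_body K (t ^ DIM('a)) L) = real ((2 * DIM('a)) choose DIM('a)) * (1 - t) ^ DIM('a) * vol K"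
proof -
  let ?n = "DIM('a)"
  have R: "K = reflect_translate z L" using KL_eq by (simp add: reflect_translate_def)
  have "K = (\<lambda>x. (-1) *\<^sub>R x + z) ` L" unfolding KL_eq by auto
  then have "vol K = vol L" using measure_lebesgue_affine[of "-1" z L] by simp
  then show vL: "vol L = vol K" by simp
  have cz: "cov z = vol K" by (simp add: cov_def flip: R)
  have M: "Mvol K L = cov z"
    unfolding Mvol_def cov_def[symmetric]
  proof (rule cSup_eq_maximum)
    show "y \<le> cov z" if "y \<in> range cov" for y using that cov_le(1) unfolding cz by blast
  qed blast
  have zm: "z \<in> minkowski_sum K L" using cov_outside[of z] cz vol_pos by auto
  have z0: "Mvol K L = cov z" "\<And>y. cov y \<le> cov z" "0 < cov z" "z \<in> minkowski_sum K L"
    using M cov_le(1) cz vol_pos zm by auto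
  interpret concave_profile "profile z" by (rule concave_profile_profile[OF z0])
  have rays: "\<exists>c. \<forall>r\<ge>0. profile z (r *\<^sub>R y) = max 0 (1 - c * r)" for y
  proof -
    obtain c where c: "\<And>r. 0 \<le> r \<Longrightarrow> vol (K \<inter> (+) (r *\<^sub>R y) ` K) = vol K * max 0 (1 - c * r) ^ ?n"
      using simplex_translate_volume[OF splx, of y] by blast
    have "profile z (r *\<^sub>R y) = max 0 (1 - c * r)" if "0 \<le> r" for r
    proof -
      have "cov (z + r *\<^sub>R y) / cov z = max 0 (1 - c * r) ^ ?n"
        using cov_reflected[OF R, of "r *\<^sub>R y"] c[OF that] cz vol_pos by simp
      then show ?thesis unfolding profile_def[OF z0] by (simp only:) (simp add: power_powr_inverse_nat)
    qed
    then show ?thesis by blast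
  qed
  have "ennreal (vol K * vol L / cov z) = ennreal (vol {x. t \<le> profile z x} / (1 - t) ^ ?n / real ((2 * ?n) choose ?n))"
    using nn_integral_linear_rays[OF rays t] nn_integral_profile[OF z0] by simp
  then have "vol K * vol L / cov z = vol {x. t \<le> profile z x} / (1 - t) ^ ?n / real ((2 * ?n) choose ?n)"
    using t cz vol_pos by (subst (asm) ennreal_inj) auto
  then have eq: "vol K = vol {x. t \<le> profile z x} / (1 - t) ^ ?n / real ((2 * ?n) choose ?n)"
    using vL cz vol_pos by simp
  have "conv_body K (t ^ ?n) L = (+) z ` {x. t \<le> profile z x}"
    using conv_body_eq_level_set[OF z0, of "t ^ ?n"] t by (simp add: power_powr_inverse_nat)
  then have "vol (conv_body K (t ^ ?n) L) = vol {x. t \<le> profile z x}" by (simp add: measure_translation)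
  then show "vol (conv_body K (t ^ ?n) L) = real ((2 * ?n) choose ?n) * (1 - t) ^ ?n * vol K"
    unfolding eq using t by simp
qed

end

section \<open>Passage from the level \<open>\<theta>\<close> to its root \<open>t\<close>\<close>

theorem theorem1p1:
  fixes K L :: "'a::euclidean_space set"
  defines "n \<equiv> DIM('a)"
  assumes K: "convex_body K" and L: "convex_body L"
  shows "(\<forall>\<theta>::real. (3/4) ^ n \<le> \<theta> \<and> \<theta> \<le> 1 \<longrightarrow>
           vol (conv_body K \<theta> L) powr (1 / real n)
             \<ge> 1/2 * real ((2*n) choose n) powr (1 / real n) * (1 - \<theta> powr (1 / real n))
               * (vol K powr (1 / real n) + vol L powr (1 / real n)))
      \<and> (\<forall>\<theta>::real. 0 \<le> \<theta> \<and> \<theta> \<le> (3/4) ^ n \<longrightarrow>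
           vol (conv_body K \<theta> L) powr (1 / real n)
             \<ge> (1 - (4/3 - 1/6 * real ((2*n) choose n) powr (1 / real n)) * \<theta> powr (1 / real n))
               * (vol K powr (1 / real n) + vol L powr (1 / real n)))
      \<and> (\<forall>\<theta>::real. (3/4) ^ n \<le> \<theta> \<and> \<theta> < 1 \<longrightarrow>
           (vol (conv_body K \<theta> L) powr (1 / real n)
              = 1/2 * real ((2*n) choose n) powr (1 / real n) * (1 - \<theta> powr (1 / real n))
                * (vol K powr (1 / real n) + vol L powr (1 / real n))
            \<longleftrightarrow> (\<exists>v. K = (\<lambda>y. v - y) ` L) \<and> (int n) simplex K))"
proof -
  interpret convex_body_pair K L using K L by unfold_locales
  obtain z0 where z0: "Mvol K L = cov z0" "\<And>y. cov y \<le> cov z0" "0 < cov z0" "z0 \<in> minkowski_sum K L"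
    using cov_attains_max by blast
  let ?B = "real ((2*n) choose n) powr (1 / real n)" and ?s = "vol K powr (1 / real n) + vol L powr (1 / real n)"
  let ?V = "\<lambda>\<theta>. vol (conv_body K \<theta> L) powr (1 / real n)"
  have n: "0 < n" by (simp add: n_def)
  have root: "(\<theta> powr (1 / real n)) ^ n = \<theta>" if "0 \<le> \<theta>" for \<theta> :: real
    using that n by (rule powr_inverse_nat_power)
  have root_ge: "3/4 \<le> \<theta> powr (1 / real n)" if "(3/4) ^ n \<le> \<theta>" for \<theta> :: real
  proof -
    have "((3/4::real) ^ n) powr (1 / real n) \<le> \<theta> powr (1 / real n)" using that by (intro powr_mono2) auto
    then show ?thesis using n by (simp add: power_powr_inverse_nat)
  qed
  have pos: "0 < \<theta>" if "(3/4) ^ n \<le> \<theta>" for \<theta> :: real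
    using that zero_less_power[of "3/4::real" n] by linarith
  have root_less: "\<theta> powr (1 / real n) < 1" if "(3/4) ^ n \<le> \<theta>" "\<theta> < 1" for \<theta> :: real
    using powr_less_mono2[of "1 / real n" \<theta> 1] pos[OF that(1)] that(2) n by simp
  have first: "1/2 * ?B * (1 - \<theta> powr (1 / real n)) * ?s \<le> ?V \<theta>" if \<theta>: "(3/4) ^ n \<le> \<theta>" "\<theta> \<le> 1" for \<theta> :: real
  \<comment> \<open>The profile bounds need \<open>t < 1\<close>; at \<open>\<theta> = 1\<close> the
    right-hand side is 0.\<close>
  proof (cases "\<theta> = 1")
    case False
    then show ?thesis
      using conv_body_inequality(1)[OF z0 root_ge[OF \<theta>(1)] root_less[OF \<theta>(1)], folded n_def] \<theta> root[of \<theta>] pos[of \<theta>]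
      by simp
  qed simp
  have second: "(1 - (4/3 - 1/6 * ?B) * \<theta> powr (1 / real n)) * ?s \<le> ?V \<theta>" if \<theta>: "0 \<le> \<theta>" "\<theta> \<le> (3/4) ^ n" for \<theta> :: real
  proof -
    define t where "t = \<theta> powr (1 / real n)"
    have "\<theta> powr (1 / real n) \<le> ((3/4::real) ^ n) powr (1 / real n)" using \<theta> by (intro powr_mono2) auto
    then have t: "0 \<le> t" "t \<le> 3/4" using n by (simp_all add: t_def power_powr_inverse_nat)
    have "?s \<le> vol (minkowski_sum K L) powr (1 / real n)"
      unfolding n_def minkowski_sum_def using KL by (intro brunn_minkowski_compact) auto
    then have 1: "(1 - 4/3 * t) * ?s \<le> (1 - 4/3 * t) * vol (minkowski_sum K L) powr (1 / real n)"
      using t by (intro mult_left_mono) auto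
    have "1/2 * ?B * (1 - 3/4) * ?s \<le> ?V ((3/4) ^ n)"
      using first[of "(3/4) ^ n"] power_le_one[of "3/4::real" n] n by (simp add: power_powr_inverse_nat)
    then have 2: "4/3 * t * (1/2 * ?B * (1 - 3/4) * ?s) \<le> 4/3 * t * ?V ((3/4) ^ n)"
      using t by (intro mult_left_mono) auto
    \<comment> \<open>Origin of the constant: at root level 3/4 the first inequality has the factor
      \<open>?B / 8\<close>, and the weight \<open>4/3 * t\<close> turns it into
      \<open>?B * t / 6\<close>.\<close>
    have "(1 - (4/3 - 1/6 * ?B) * t) * ?s = (1 - 4/3 * t) * ?s + 4/3 * t * (1/2 * ?B * (1 - 3/4) * ?s)"
      by (simp add: algebra_simps)
    also have "\<dots> \<le> (1 - 4/3 * t) * vol (minkowski_sum K L) powr (1 / real n) + 4/3 * t * ?V ((3/4) ^ n)"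
      by (rule add_mono[OF 1 2])
    also have "\<dots> \<le> ?V (t ^ n)" using conv_body_interpolation[OF z0 t] by (simp only: n_def)
    finally show ?thesis using root[OF \<theta>(1)] by (simp only: t_def)
  qed
  have third: "?V \<theta> = 1/2 * ?B * (1 - \<theta> powr (1 / real n)) * ?s \<longleftrightarrow> (\<exists>v. K = (\<lambda>y. v - y) ` L) \<and> (int n) simplex K"
    if \<theta>: "(3/4) ^ n \<le> \<theta>" "\<theta> < 1" for \<theta> :: real
  proof -
    define t where "t = \<theta> powr (1 / real n)"
    have t: "3/4 \<le> t" "t < 1" "t ^ n = \<theta>"
      using root_ge[OF \<theta>(1)] root_less[OF \<theta>] root[of \<theta>] pos[OF \<theta>(1)] by (auto simp: t_def)
    have "?V (t ^ n) = 1/2 * ?B * (1 - t) * ?s \<longleftrightarrow> (\<exists>v. K = (\<lambda>y. v - y) ` L) \<and> (int n) simplex K"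
    proof
      assume "?V (t ^ n) = 1/2 * ?B * (1 - t) * ?s"
      then have eq: "vol K = cov z0" "vol L = cov z0"
        and lin: "\<And>y. \<exists>c. \<forall>r\<ge>0. cov (z0 + r *\<^sub>R y) = cov z0 * max 0 (1 - c * r) ^ DIM('a)"
        using conv_body_inequality(2)[OF z0 t(1,2)] unfolding n_def by blast+
      have R: "K = reflect_translate z0 L" by (rule reflected_if_max_volume[OF eq])
      have "translation_homothetic K"
      proof (rule translation_homothetic_of_volume[OF K])
        fix y
        show "\<exists>c. \<forall>r\<ge>0. vol (K \<inter> (+) (r *\<^sub>R y) ` K) = vol K * max 0 (1 - c * r) ^ DIM('a)"
          using lin[of y] unfolding cov_reflected[OF R] eq(1) .
      qed
      then have "(int n) simplex K"
        unfolding n_def using KL(3) by (rule translation_homothetic.simplex_of_full_dimension)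
      then show "(\<exists>v. K = (\<lambda>y. v - y) ` L) \<and> (int n) simplex K"
        using R unfolding reflect_translate_def by blast
    next
      assume "(\<exists>v. K = (\<lambda>y. v - y) ` L) \<and> (int n) simplex K"
      then obtain v where v: "K = (\<lambda>y. v - y) ` L" "(int DIM('a)) simplex K" by (auto simp: n_def)
      have t0: "0 < t" using t by simp
      note sc = simplex_conv_body[OF v t0 t(2), folded n_def]
      have "?V (t ^ n) = ?B * ((1 - t) ^ n) powr (1 / real n) * vol K powr (1 / real n)"
        unfolding sc(2) using t by (simp add: powr_mult)
      \<comment> \<open>Equal volumes give \<open>?s = 2 |K|^(1/n)\<close>, which absorbs the factor
        1/2.\<close>
      also have "\<dots> = 1/2 * ?B * (1 - t) * ?s" using t n by (simp add: sc(1) power_powr_inverse_nat)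
      finally show "?V (t ^ n) = 1/2 * ?B * (1 - t) * ?s" .
    qed
    then show ?thesis unfolding t(3) by (simp only: t_def)
  qed
  show ?thesis using first second third by blast
qed

end
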